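(* Let $n\ge 2$. There exist a radius $R>0$, a smooth radially decreasing function $f>0$ about the origin in $\mathbb{R}^n$, and a bounded nonempty open interval $I\subset(0,\infty)$ such that for every $\beta\in I$ the Talenti-type pointwise comparison for the Robin problem fails on small translations of the ball $B_R$ centered at the origin: for every sufficiently small nonzero $x_0\in\mathbb{R}^n$ (with smallness allowed to depend on $\beta$), the domain $\Omega=B_R+x_0$ satisfies $J_\beta^f(\Omega)<J_\beta^f(B_R)$, and the inequality $$\big(u_\Omega^{f,\beta}\big)^\sharp(x)\le u_{\Omega^\sharp}^{(f|_\Omega)^\sharp,\beta}(x)\quad\text{for a.e. }x\in\Omega^\sharp=B_R$$ does not hold.
   Context: "Radially decreasing about the origin" means that $f(x)$ depends only on $|x|$ and is non-increasing in $|x|$. For a bounded Lipschitz domain $\Omega$, a non-negative $g\in L^2(\Omega)$ and $\beta>0$, $u_\Omega^{g,\beta}\in H^1(\Omega)$ denotes the (weak) solution of $-\Delta u=g$ in $\Omega$, $\frac{\partial u}{\partial\nu}+\beta u=0$ on $\partial\Omega$ ($\nu$ the outward unit normal), and $$J_\beta^f(\Omega):=\inf\Big\{\tfrac12\int_\Omega|\nabla u|^2\,dx+\tfrac{\beta}{2}\int_{\partial\Omega}u^2\,d\sigma-\int_\Omega fu\,dx:\ u\in H^1(\Omega)\Big\}.$$ $\Omega^\sharp$ is the ball centered at the origin with $|\Omega^\sharp|=|\Omega|$. For a non-negative measurable $\varphi$ on $\Omega$, $\varphi^\sharp$ is its spherically decreasing rearrangement on $\Omega^\sharp$ (the radially non-increasing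 function about the origin equimeasurable with $\varphi$), and $f|_\Omega$ is the restriction of $f$ to $\Omega$. *)

theory Defs
  imports "HOL-Analysis.Analysis"
begin

fun C_k :: "nat \<Rightarrow> ('a::euclidean_space \<Rightarrow> real) \<Rightarrow> bool" where
  "C_k 0 f \<longleftrightarrow> continuous_on UNIV f"
| "C_k (Suc k) f \<longleftrightarrow> (\<forall>x. f differentiable (at x)) \<and>
     (\<forall>b\<in>Basis. C_k k (\<lambda>x. frechet_derivative f (at x) b))"

definition smooth :: "('a::euclidean_space \<Rightarrow> real) \<Rightarrow> bool" where
  "smooth f \<longleftrightarrow> (\<forall>k. C_k k f)"

definition grad :: "('a::euclidean_space \<Rightarrow> real) \<Rightarrow> 'a \<Rightarrow> 'a" where
  "grad f x = (\<Sum>b\<in>Basis. frechet_derivative f (at x) b *\<^sub>R b)"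

text \<open>Points of equal norm are compared in both directions, so \<open>f x\<close> depends only on \<open>norm x\<close>.\<close>

definition radially_decreasing :: "('a::euclidean_space \<Rightarrow> real) \<Rightarrow> bool" where
  "radially_decreasing f \<longleftrightarrow> (\<forall>x y. norm x \<le> norm y \<longrightarrow> f y \<le> f x)"

definition test_function :: "'a::euclidean_space set \<Rightarrow> ('a \<Rightarrow> real) \<Rightarrow> bool" where
  "test_function \<Omega> \<phi> \<longleftrightarrow> smooth \<phi> \<and> (\<exists>K. compact K \<and> K \<subseteq> \<Omega> \<and> (\<forall>x. x \<notin> K \<longrightarrow> \<phi> x = 0))"

definition L2 :: "'a measure \<Rightarrow> ('a \<Rightarrow> 'b::euclidean_space) \<Rightarrow> bool" where
  "L2 M f \<longleftrightarrow> f \<in> borel_measurable M \<and> integrable M (\<lambda>x. (norm (f x))\<^sup>2)"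

text \<open>\<open>weak_gradient \<Omega> u G\<close>: \<open>u\<close> belongs to \<open>H\<^sup>1(\<Omega>)\<close> and \<open>G\<close> is its distributional gradient.\<close>

definition weak_gradient :: "'a::euclidean_space set \<Rightarrow> ('a \<Rightarrow> real) \<Rightarrow> ('a \<Rightarrow> 'a) \<Rightarrow> bool" where
  "weak_gradient \<Omega> u G \<longleftrightarrow> L2 (lebesgue_on \<Omega>) u \<and> L2 (lebesgue_on \<Omega>) G \<and>
     (\<forall>\<phi>. test_function \<Omega> \<phi> \<longrightarrow> (\<forall>b\<in>Basis.
        (LINT x|lebesgue_on \<Omega>. u x * frechet_derivative \<phi> (at x) b) =
        - (LINT x|lebesgue_on \<Omega>. (G x \<bullet> b) * \<phi> x)))"

text \<open>
  The \<open>d\<close>-dimensional Hausdorff (outer) measure for \<open>d \<ge> 1\<close>, normalised so that in dimension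
  \<open>d\<close> it agrees with Lebesgue measure. It is a metric outer measure, hence countably
  additive on the Borel sets. (Boundedness of the covering sets is required because
  \<^const>\<open>diameter\<close> carries no information on unbounded sets.)
\<close>

definition hausdorff_outer :: "nat \<Rightarrow> 'a::euclidean_space set \<Rightarrow> ennreal" where
  "hausdorff_outer d A =
     (SUP \<delta>\<in>{0<..}. INF C\<in>{C :: nat \<Rightarrow> 'a set. A \<subseteq> (\<Union>i. C i) \<and>
                                  (\<forall>i. bounded (C i) \<and> diameter (C i) \<le> \<delta>)}.
        \<Sum>i. ennreal (unit_ball_vol (real d) * (diameter (C i) / 2) ^ d))"

definition hausdorff_measure :: "nat \<Rightarrow> 'a::euclidean_space measure" where
  "hausdorff_measure d = measure_of UNIV (sets borel) (hausdorff_outer d)"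

definition surface_measure :: "'a::euclidean_space set \<Rightarrow> 'a measure" where
  "surface_measure \<Omega> = restrict_space (hausdorff_measure (DIM('a) - 1)) (frontier \<Omega>)"

text \<open>
  \<open>H1_data \<Omega> u G w\<close>: \<open>u\<close> belongs to \<open>H\<^sup>1(\<Omega>)\<close>, with weak gradient \<open>G\<close> and trace \<open>w\<close> on the
  boundary. The trace operator is the continuous extension to \<open>H\<^sup>1(\<Omega>)\<close> of the restriction
  \<open>\<phi> \<mapsto> \<phi>|\<^bsub>\<partial>\<Omega>\<^esub>\<close> of functions that are \<open>C\<^sup>1\<close> up to the boundary. For a bounded Lipschitz domain
  these are dense in \<open>H\<^sup>1(\<Omega>)\<close> and the restriction is bounded into \<open>L\<^sup>2(\<partial>\<Omega>)\<close>; so for every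
  \<open>u\<close> in \<open>H\<^sup>1(\<Omega>)\<close> there are such \<open>G\<close> and \<open>w\<close>, and both are unique up to null sets.
\<close>

definition H1_data ::
  "'a::euclidean_space set \<Rightarrow> ('a \<Rightarrow> real) \<Rightarrow> ('a \<Rightarrow> 'a) \<Rightarrow> ('a \<Rightarrow> real) \<Rightarrow> bool" where
  "H1_data \<Omega> u G w \<longleftrightarrow> weak_gradient \<Omega> u G \<and> L2 (surface_measure \<Omega>) w \<and>
     (\<exists>\<phi> :: nat \<Rightarrow> 'a \<Rightarrow> real. (\<forall>k. C_k 1 (\<phi> k)) \<and>
        (\<lambda>k. LINT x|lebesgue_on \<Omega>. (\<phi> k x - u x)\<^sup>2) \<longlonglongrightarrow> 0 \<and>
        (\<lambda>k. LINT x|lebesgue_on \<Omega>. (norm (grad (\<phi> k) x - G x))\<^sup>2) \<longlonglongrightarrow> 0 \<and>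
        (\<lambda>k. LINT x|surface_measure \<Omega>. (\<phi> k x - w x)\<^sup>2) \<longlonglongrightarrow> 0)"

text \<open>
  Weak form of \<open>- \<Delta>u = g\<close> in \<open>\<Omega>\<close>, \<open>\<partial>u/\<partial>\<nu> + \<beta> u = 0\<close> on \<open>\<partial>\<Omega>\<close>, tested against all
  \<open>v\<close> in \<open>H\<^sup>1(\<Omega>)\<close>.
\<close>

definition robin_solution ::
  "'a::euclidean_space set \<Rightarrow> ('a \<Rightarrow> real) \<Rightarrow> real \<Rightarrow> ('a \<Rightarrow> real) \<Rightarrow> bool" where
  "robin_solution \<Omega> g \<beta> u \<longleftrightarrow> (\<exists>G w. H1_data \<Omega> u G w \<and>
     (\<forall>v H h. H1_data \<Omega> v H h \<longrightarrow>
        (LINT x|lebesgue_on \<Omega>. G x \<bullet> H x) + \<beta> * (LINT x|surface_measure \<Omega>. w x * h x) =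
        (LINT x|lebesgue_on \<Omega>. g x * v x)))"

text \<open>The infimum is taken in the extended reals, so that no lower bound is presupposed.\<close>

definition robin_J :: "real \<Rightarrow> ('a::euclidean_space \<Rightarrow> real) \<Rightarrow> 'a set \<Rightarrow> ereal" where
  "robin_J \<beta> f \<Omega> = (INF (u, G, w) \<in> {(u, G, w). H1_data \<Omega> u G w}.
     ereal (1/2 * (LINT x|lebesgue_on \<Omega>. (norm (G x))\<^sup>2)
          + \<beta>/2 * (LINT x|surface_measure \<Omega>. (w x)\<^sup>2)
          - (LINT x|lebesgue_on \<Omega>. f x * u x)))"

definition symm_ball :: "'a::euclidean_space set \<Rightarrow> 'a set" where
  "symm_ball \<Omega> =
     ball 0 (root DIM('a) (measure lebesgue \<Omega> / unit_ball_vol (real DIM('a))))"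

text \<open>
  \<open>\<phi>\<^sup>\<sharp>(x) = \<phi>\<^sup>*(|ball 0 |x||)\<close>, where \<open>\<phi>\<^sup>*\<close> is the decreasing rearrangement
  \<open>\<phi>\<^sup>*(s) = inf {t \<ge> 0. |{\<phi> > t}| \<le> s}\<close>. Only the values of \<open>\<phi>\<close> on \<open>\<Omega>\<close> are used. For unbounded \<open>\<phi>\<close>
  the value at the single point \<open>x = 0\<close> is meaningless.
\<close>

definition symm_rearr :: "'a::euclidean_space set \<Rightarrow> ('a \<Rightarrow> real) \<Rightarrow> 'a \<Rightarrow> real" where
  "symm_rearr \<Omega> \<phi> x =
     Inf {t. 0 \<le> t \<and> measure lebesgue {y\<in>\<Omega>. \<phi> y > t} \<le> measure lebesgue (ball (0::'a) (norm x))}"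


text \<open>
  The next facts confirm that \<^const>\<open>symm_rearr\<close> is the radially non-increasing function on
  \<^const>\<open>symm_ball\<close> that is equimeasurable with \<open>\<phi>\<close> (up to the value at the origin).
\<close>

lemma superlevel_lmeasurable:
  fixes \<Omega> :: "'a::euclidean_space set" and \<phi> :: "'a \<Rightarrow> real"
  assumes "\<Omega> \<in> lmeasurable" "\<phi> \<in> borel_measurable (lebesgue_on \<Omega>)"
  shows "{y\<in>\<Omega>. \<phi> y > t} \<in> lmeasurable"
proof -
  have "{y \<in> space (lebesgue_on \<Omega>). \<phi> y > t} \<in> sets (lebesgue_on \<Omega>)"
    using assms(2) by measurable
  then have "{y\<in>\<Omega>. \<phi> y > t} \<in> sets (lebesgue_on \<Omega>)" by simp
  then have "{y\<in>\<Omega>. \<phi> y > t} \<in> sets lebesgue"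
    using assms(1) by (subst (asm) sets_restrict_space_iff) (auto simp: fmeasurableD)
  then show ?thesis
    using assms(1) by (rule_tac fmeasurableI2[of \<Omega>]) auto
qed

lemma superlevel_mono:
  fixes \<Omega> :: "'a::euclidean_space set" and \<phi> :: "'a \<Rightarrow> real"
  assumes "\<Omega> \<in> lmeasurable" "\<phi> \<in> borel_measurable (lebesgue_on \<Omega>)" "s \<le> t"
  shows "measure lebesgue {y\<in>\<Omega>. \<phi> y > t} \<le> measure lebesgue {y\<in>\<Omega>. \<phi> y > s}"
  using assms superlevel_lmeasurable[OF assms(1,2)]
  by (intro measure_mono_fmeasurable) (auto simp: fmeasurableD)

lemma symm_rearr_nonempty:
  fixes \<Omega> :: "'a::euclidean_space set" and \<phi> :: "'a \<Rightarrow> real"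
  assumes "\<Omega> \<in> lmeasurable" "\<phi> \<in> borel_measurable (lebesgue_on \<Omega>)" "m > 0"
  shows "\<exists>t\<ge>0. measure lebesgue {y\<in>\<Omega>. \<phi> y > t} \<le> m"
proof -
  let ?A = "\<lambda>k::nat. {y\<in>\<Omega>. \<phi> y > real k}"
  have lm: "?A k \<in> lmeasurable" for k using superlevel_lmeasurable[OF assms(1,2)] .
  have "(\<lambda>k. measure lebesgue (?A k)) \<longlonglongrightarrow> measure lebesgue (\<Inter>k. ?A k)"
  proof (rule Lim_measure_decseq)
    show "range ?A \<subseteq> sets lebesgue" using lm by blast
    show "decseq ?A" unfolding decseq_def
    proof (intro allI impI subsetI)
      fix i j :: nat and y assume ij: "i \<le> j" and y: "y \<in> ?A j"
      have "real i \<le> real j" using ij by simp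
      moreover have "y \<in> \<Omega>" "real j < \<phi> y" using y by blast+
      ultimately have "y \<in> \<Omega>" "real i < \<phi> y" by (blast, linarith)
      then show "y \<in> ?A i" by blast
    qed
    show "emeasure lebesgue (?A k) \<noteq> \<infinity>" for k using fmeasurableD2[OF lm] by simp
  qed
  moreover have "(\<Inter>k. ?A k) = {}"
  proof -
    have "\<exists>k. \<not> \<phi> y > real k" for y
      using real_arch_simple[of "\<phi> y"] by (auto simp: not_less)
    then show ?thesis by blast
  qed
  ultimately have "(\<lambda>k. measure lebesgue (?A k)) \<longlonglongrightarrow> 0" by simp
  then have "eventually (\<lambda>k. measure lebesgue (?A k) < m) sequentially"
    using assms(3) by (rule order_tendstoD)
  then obtain k where "measure lebesgue (?A k) < m"
    by (auto simp: eventually_sequentially)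
  then show ?thesis by (intro exI[of _ "real k"]) auto
qed

lemma measure_ball_pos:
  fixes x :: "'a::euclidean_space"
  assumes "x \<noteq> 0"
  shows "measure lebesgue (ball (0::'a) (norm x)) > 0"
  using assms by (simp add: content_ball measure_completion)

lemma symm_rearr_gt_iff:
  fixes \<Omega> :: "'a::euclidean_space set" and \<phi> :: "'a \<Rightarrow> real"
  assumes "\<Omega> \<in> lmeasurable" "\<phi> \<in> borel_measurable (lebesgue_on \<Omega>)" "x \<noteq> 0" "t \<ge> 0"
  shows "symm_rearr \<Omega> \<phi> x > t \<longleftrightarrow>
    measure lebesgue (ball (0::'a) (norm x)) < measure lebesgue {y\<in>\<Omega>. \<phi> y > t}"
    (is "_ \<longleftrightarrow> ?m < _")
proof
  let ?S = "{t. 0 \<le> t \<and> measure lebesgue {y\<in>\<Omega>. \<phi> y > t} \<le> ?m}"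
  have bdd: "bdd_below ?S" by (rule bdd_belowI[of _ 0]) auto
  show "?m < measure lebesgue {y\<in>\<Omega>. \<phi> y > t}" if "symm_rearr \<Omega> \<phi> x > t"
  proof (rule ccontr)
    assume "\<not> ?thesis"
    then have "t \<in> ?S" using assms(4) by auto
    then have "Inf ?S \<le> t" using bdd by (rule cInf_lower)
    then show False using that by (simp add: symm_rearr_def)
  qed
  assume gt: "?m < measure lebesgue {y\<in>\<Omega>. \<phi> y > t}"
  let ?A = "\<lambda>k::nat. {y\<in>\<Omega>. \<phi> y > t + inverse (real (Suc k))}"
  have lm: "?A k \<in> lmeasurable" for k using superlevel_lmeasurable[OF assms(1,2)] .
  have inc: "incseq ?A"
    unfolding incseq_Suc_iff
  proof (intro allI subsetI)
    fix k y assume "y \<in> ?A k"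
    moreover have "inverse (real (Suc (Suc k))) \<le> inverse (real (Suc k))"
      by (intro le_imp_inverse_le) auto
    moreover have "y \<in> \<Omega>" "t + inverse (real (Suc k)) < \<phi> y" using calculation by blast+
    ultimately have "y \<in> \<Omega>" "t + inverse (real (Suc (Suc k))) < \<phi> y" by (blast, linarith)
    then show "y \<in> ?A (Suc k)" by blast
  qed
  have un: "(\<Union>k. ?A k) = {y\<in>\<Omega>. \<phi> y > t}"
  proof -
    have "t < \<phi> y" if "t + inverse (real (Suc k)) < \<phi> y" for y k
    proof -
      have "inverse (real (Suc k)) > 0" by simp
      then show ?thesis using that by linarith
    qed
    moreover have "\<exists>k. t + inverse (real (Suc k)) < \<phi> y" if "t < \<phi> y" for y
      using reals_Archimedean[of "\<phi> y - t"] that by (auto simp: algebra_simps)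
    ultimately show ?thesis by blast
  qed
  have "(\<Union>k. ?A k) \<in> lmeasurable"
    unfolding un using superlevel_lmeasurable[OF assms(1,2)] .
  then have "(\<lambda>k. measure lebesgue (?A k)) \<longlonglongrightarrow> measure lebesgue (\<Union>k. ?A k)"
    using lm inc by (intro Lim_measure_incseq) (auto simp: fmeasurableD dest: fmeasurableD2)
  then have "eventually (\<lambda>k. ?m < measure lebesgue (?A k)) sequentially"
    using gt unfolding un by (rule order_tendstoD)
  then obtain k where k: "?m < measure lebesgue (?A k)"
    by (auto simp: eventually_sequentially)
  let ?s = "t + inverse (real (Suc k))"
  have "?S \<noteq> {}"
    using symm_rearr_nonempty[OF assms(1,2) measure_ball_pos[OF assms(3)]] by auto
  moreover have "?s \<le> r" if "r \<in> ?S" for r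
  proof (rule ccontr)
    assume "\<not> ?thesis"
    then have "measure lebesgue (?A k) \<le> measure lebesgue {y\<in>\<Omega>. \<phi> y > r}"
      by (intro superlevel_mono[OF assms(1,2)]) auto
    then show False using that k by auto
  qed
  ultimately have "?s \<le> Inf ?S" by (rule cInf_greatest)
  moreover have "t < ?s" by simp
  ultimately show "symm_rearr \<Omega> \<phi> x > t" unfolding symm_rearr_def by linarith
qed

lemma symm_rearr_radial:
  fixes \<Omega> :: "'a::euclidean_space set" and \<phi> :: "'a \<Rightarrow> real"
  assumes "\<Omega> \<in> lmeasurable" "\<phi> \<in> borel_measurable (lebesgue_on \<Omega>)" "x \<noteq> 0" "norm x \<le> norm y"
  shows "symm_rearr \<Omega> \<phi> y \<le> symm_rearr \<Omega> \<phi> x"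
  unfolding symm_rearr_def
proof (rule cInf_superset_mono)
  have "measure lebesgue (ball (0::'a) (norm x)) \<le> measure lebesgue (ball (0::'a) (norm y))"
    using assms(4) by (intro measure_mono_fmeasurable) auto
  then show "{t. 0 \<le> t \<and> measure lebesgue {y\<in>\<Omega>. \<phi> y > t} \<le> measure lebesgue (ball (0::'a) (norm x))}
    \<subseteq> {t. 0 \<le> t \<and> measure lebesgue {y\<in>\<Omega>. \<phi> y > t} \<le> measure lebesgue (ball (0::'a) (norm y))}"
    by auto
qed (use symm_rearr_nonempty[OF assms(1,2) measure_ball_pos[OF assms(3)]] in
      \<open>auto intro!: bdd_belowI[of _ 0]\<close>)

lemma symm_rearr_equimeasurable:
  fixes \<Omega> :: "'a::euclidean_space set" and \<phi> :: "'a \<Rightarrow> real"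
  assumes "\<Omega> \<in> lmeasurable" "\<phi> \<in> borel_measurable (lebesgue_on \<Omega>)" "t \<ge> 0"
  shows "measure lebesgue {x\<in>symm_ball \<Omega>. symm_rearr \<Omega> \<phi> x > t} = measure lebesgue {y\<in>\<Omega>. \<phi> y > t}"
proof -
  let ?n = "DIM('a)"
  let ?c = "unit_ball_vol (real ?n)"
  let ?\<mu> = "measure lebesgue {y\<in>\<Omega>. \<phi> y > t}"
  let ?r = "root ?n (?\<mu> / ?c)"
  have c: "?c > 0" by simp
  have \<mu>: "?\<mu> \<le> measure lebesgue \<Omega>"
    using assms superlevel_lmeasurable[OF assms(1,2)]
    by (intro measure_mono_fmeasurable) (auto simp: fmeasurableD)
  have r0: "?r \<ge> 0" using c by simp
  have vol: "measure lebesgue (ball (0::'a) s) = ?c * s ^ ?n" if "s \<ge> 0" for s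
    using that by (simp add: content_ball measure_completion)
  have iff: "measure lebesgue (ball (0::'a) (norm x)) < ?\<mu> \<longleftrightarrow> norm x < ?r" for x :: 'a
  proof -
    have "measure lebesgue (ball (0::'a) (norm x)) < ?\<mu> \<longleftrightarrow> norm x ^ ?n < ?\<mu> / ?c"
      unfolding vol[OF norm_ge_zero] using c by (simp add: field_simps)
    also have "\<dots> \<longleftrightarrow> root ?n (norm x ^ ?n) < ?r" by (simp add: real_root_less_iff)
    also have "root ?n (norm x ^ ?n) = norm x" by (simp add: real_root_power_cancel)
    finally show ?thesis .
  qed
  have sub: "ball 0 ?r \<subseteq> symm_ball \<Omega>"
    unfolding symm_ball_def using \<mu> c by (intro subset_ball) (simp add: divide_right_mono)
  have eq: "{x\<in>symm_ball \<Omega>. symm_rearr \<Omega> \<phi> x > t} - {0} = ball 0 ?r - {0}"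
    using sub symm_rearr_gt_iff[OF assms(1,2) _ assms(3)] iff by auto
  have "measure lebesgue {x\<in>symm_ball \<Omega>. symm_rearr \<Omega> \<phi> x > t}
      = measure lebesgue ({x\<in>symm_ball \<Omega>. symm_rearr \<Omega> \<phi> x > t} - {0})"
  proof -
    have lm: "{x\<in>symm_ball \<Omega>. symm_rearr \<Omega> \<phi> x > t} - {0} \<in> sets lebesgue"
      unfolding eq by auto
    have ns: "{0::'a} \<in> null_sets lebesgue" by auto
    let ?X = "{x\<in>symm_ball \<Omega>. symm_rearr \<Omega> \<phi> x > t}"
    have X: "?X \<in> sets lebesgue"
    proof (cases "0 \<in> ?X")
      case True
      then have "?X = {0} \<union> (?X - {0})" by auto
      moreover have "{0} \<union> (?X - {0}) \<in> sets lebesgue"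
        using lm ns by (intro sets.Un) auto
      ultimately show ?thesis by simp
    next
      case False
      then have "?X - {0} = ?X" by auto
      then show ?thesis using lm by simp
    qed
    show ?thesis using measure_Diff_null_set[OF X ns] by simp
  qed
  also have "\<dots> = measure lebesgue (ball (0::'a) ?r)"
    unfolding eq by (rule measure_Diff_null_set) auto
  also have "\<dots> = ?\<mu>"
  proof -
    have "?c * ?r ^ ?n = ?\<mu>" using c less_imp_neq[OF c] by (simp add: real_root_pow_pos2)
    then show ?thesis using vol[OF r0] by simp
  qed
  finally show ?thesis .
qed

end

(*
  Idea. For a source concentrated at the origin the energy J is essentially -1/2 times the diagonal value of the
  Robin Green function, and for a Robin parameter below n - 1 the regular part of that function increases when
  the pole moves off the centre; so translating the ball lowers J. As source we take a bubble
  f = n s (s + |x|^2)^(-n/2-1) with s = 1/100, which is -div of the explicit field -x (s + |x|^2)^(-n/2). The energy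
  of the translated ball is bounded by testing with the centred solution plus the solution of the linearised
  problem, both explicit; the second order term is computed by the divergence theorem alone, and the remainder is cubic.

  If the pointwise comparison held on a translated ball, then the Hardy-Littlewood inequality and f# <= f would give
  J(B) <= J(translated ball), a contradiction.

  On the unit sphere the Hausdorff measure is uniformly distributed, hence a
  positive multiple of the cone measure, for which the divergence theorem follows from cutoff functions and scaling.
  The unknown multiple only rescales the interval of admissible Robin parameters.
*)

theory Submission
  imports Defs
begin

section \<open>Hausdorff measure\<close>

text \<open>Two features of the setting shape the proof. The boundary measure is a Hausdorff outer
  measure, so on the sphere it must first be shown to be positive, finite and rotation invariant.
  Traces are defined by approximation with \<open>C_k 1\<close> functions, so every identity is
  proved for such functions and passes to all of H^1 by L^2 limits. All translates of the ball carry
  the same quadratic form: after pulling back only the source changes, to f(x + a), so that the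
  shape derivative becomes a Taylor expansion of f. On the translated ball an upper bound for J
  suffices; the solution there enters through its existence and the value J = -1/2 (integral of f
  u). For a point mass J would be minus infinity, hence the regularisation. It costs a term
  proportional to 1/bb with bb = \<beta>/\<kappa>, which keeps bb away from 0; the range 1/4 < bb <
  1/2 is admissible for all n >= 2 at once, and multiplied by the unknown \<kappa> it is the
  interval I, with R = 1. Monotonicity of f yields f# <= f on every translated ball, and f > 0
  compensates for the unknown sign of the solution.\<close>

definition hausdorff_cover :: "real \<Rightarrow> 'a::euclidean_space set \<Rightarrow> (nat \<Rightarrow> 'a set) \<Rightarrow> bool" where
  "hausdorff_cover \<delta> A C \<longleftrightarrow> A \<subseteq> (\<Union>i. C i) \<and> (\<forall>i. bounded (C i) \<and> diameter (C i) \<le> \<delta>)"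

definition hausdorff_cost :: "nat \<Rightarrow> 'a::euclidean_space set \<Rightarrow> ennreal" where
  "hausdorff_cost d C = ennreal (unit_ball_vol (real d) * (diameter C / 2) ^ d)"

definition hausdorff_pre :: "nat \<Rightarrow> real \<Rightarrow> 'a::euclidean_space set \<Rightarrow> ennreal" where
  "hausdorff_pre d \<delta> A = (INF C\<in>{C. hausdorff_cover \<delta> A C}. \<Sum>i. hausdorff_cost d (C i))"

lemma hausdorff_outer_eq: "hausdorff_outer d A = (SUP \<delta>\<in>{0<..}. hausdorff_pre d \<delta> A)"
  unfolding hausdorff_outer_def hausdorff_pre_def hausdorff_cover_def hausdorff_cost_def by simp

lemma hausdorff_cost_mono:
  assumes "C \<subseteq> D" "bounded D"
  shows "hausdorff_cost d C \<le> hausdorff_cost d D"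
  unfolding hausdorff_cost_def
  using assms
  by (intro ennreal_leI mult_left_mono power_mono divide_right_mono diameter_subset)
     (auto simp: diameter_ge_0 bounded_subset)

text \<open>In dimension 0 the empty set would cost \<open>0 ^ 0 = 1\<close>. This is the origin of
  the hypothesis \<open>d \<noteq> 0\<close> in the sequel; for the sphere \<open>d\<close> is n -
  1, at least 1.\<close>

lemma hausdorff_cost_empty: "d \<noteq> 0 \<Longrightarrow> hausdorff_cost d {} = 0"
  by (simp add: hausdorff_cost_def)

lemma hausdorff_pre_le: "hausdorff_cover \<delta> A C \<Longrightarrow> hausdorff_pre d \<delta> A \<le> (\<Sum>i. hausdorff_cost d (C i))"
  unfolding hausdorff_pre_def by (auto intro: INF_lower)

lemma hausdorff_pre_mono: "A \<subseteq> B \<Longrightarrow> hausdorff_pre d \<delta> A \<le> hausdorff_pre d \<delta> B"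
  unfolding hausdorff_pre_def hausdorff_cover_def by (rule INF_superset_mono) auto

lemma hausdorff_pre_antimono: "\<delta> \<le> \<delta>' \<Longrightarrow> hausdorff_pre d \<delta>' A \<le> hausdorff_pre d \<delta> A"
  unfolding hausdorff_pre_def hausdorff_cover_def by (rule INF_superset_mono) (auto intro: order_trans)

lemma hausdorff_pre_le_outer: "0 < \<delta> \<Longrightarrow> hausdorff_pre d \<delta> A \<le> hausdorff_outer d A"
  unfolding hausdorff_outer_eq by (auto intro: SUP_upper)

lemma hausdorff_outer_mono: "A \<subseteq> B \<Longrightarrow> hausdorff_outer d A \<le> hausdorff_outer d B"
  unfolding hausdorff_outer_eq by (intro SUP_mono) (auto intro!: hausdorff_pre_mono)

lemma hausdorff_pre_empty: "0 < \<delta> \<Longrightarrow> d \<noteq> 0 \<Longrightarrow> hausdorff_pre d \<delta> {} = 0"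
  using hausdorff_pre_le[of \<delta> "{}" "\<lambda>_. {}" d]
  by (simp add: hausdorff_cover_def hausdorff_cost_empty)

lemma hausdorff_outer_empty: "d \<noteq> 0 \<Longrightarrow> hausdorff_outer d {} = 0"
  unfolding hausdorff_outer_eq by (simp add: hausdorff_pre_empty)

lemma hausdorff_cover_exI:
  assumes "hausdorff_pre d \<delta> A < c"
  obtains C where "hausdorff_cover \<delta> A C" "(\<Sum>i. hausdorff_cost d (C i)) < c"
  using assms unfolding hausdorff_pre_def by (auto simp: Inf_less_iff)

lemma hausdorff_pre_countably_subadditive:
  "hausdorff_pre d \<delta> (\<Union>i. A i) \<le> (\<Sum>i::nat. hausdorff_pre d \<delta> (A i))"
proof (cases "(\<Sum>i. hausdorff_pre d \<delta> (A i)) = \<infinity>")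
  case False
  have fin: "hausdorff_pre d \<delta> (A i) < \<infinity>" for i
    using False by (metis ennreal_suminf_lessD infinity_ennreal_def less_top)
  show ?thesis
  proof (rule ennreal_le_epsilon)
    fix e :: real assume e: "0 < e"
    have "\<exists>C. hausdorff_cover \<delta> (A i) C \<and>
        (\<Sum>j. hausdorff_cost d (C j)) \<le> hausdorff_pre d \<delta> (A i) + ennreal (e * (1/2)^Suc i)" for i
    proof -
      have "hausdorff_pre d \<delta> (A i) < hausdorff_pre d \<delta> (A i) + ennreal (e * (1/2)^Suc i)"
      proof -
        have "0 < ennreal (e * (1/2)^Suc i)" using e by (simp add: ennreal_zero_less_mult_iff)
        then show ?thesis using fin[of i]
          by (metis add.right_neutral ennreal_add_left_cancel_less infinity_ennreal_def less_top)
      qed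
      then show ?thesis by (metis hausdorff_cover_exI less_imp_le)
    qed
    then obtain C where C: "\<And>i. hausdorff_cover \<delta> (A i) (C i)"
        "\<And>i. (\<Sum>j. hausdorff_cost d (C i j)) \<le> hausdorff_pre d \<delta> (A i) + ennreal (e * (1/2)^Suc i)"
      by metis
    let ?D = "\<lambda>k. case prod_decode k of (i, j) \<Rightarrow> C i j"
    have cov: "hausdorff_cover \<delta> (\<Union>i. A i) ?D"
      unfolding hausdorff_cover_def
    proof (intro conjI allI)
      show "(\<Union>i. A i) \<subseteq> (\<Union>k. ?D k)"
      proof
        fix x assume "x \<in> (\<Union>i. A i)"
        then obtain i where "x \<in> A i" by auto
        then obtain j where "x \<in> C i j" using C(1)[of i] unfolding hausdorff_cover_def by auto
        then have "x \<in> ?D (prod_encode (i, j))" by simp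
        then show "x \<in> (\<Union>k. ?D k)" by (rule UN_I[OF UNIV_I])
      qed
    qed (use C(1) in \<open>auto simp: hausdorff_cover_def split: prod.split\<close>)
    have "hausdorff_pre d \<delta> (\<Union>i. A i) \<le> (\<Sum>k. hausdorff_cost d (?D k))"
      by (rule hausdorff_pre_le[OF cov])
    also have "\<dots> = (\<Sum>k. (\<lambda>(i, j). hausdorff_cost d (C i j)) (prod_decode k))"
      by (auto intro!: suminf_cong split: prod.split)
    also have "\<dots> = (\<Sum>i. \<Sum>j. hausdorff_cost d (C i j))"
      by (subst suminf_ennreal_2dimen) auto
    also have "\<dots> \<le> (\<Sum>i. hausdorff_pre d \<delta> (A i) + ennreal (e * (1/2)^Suc i))"
      by (intro suminf_le C(2)) auto
    also have "\<dots> = (\<Sum>i. hausdorff_pre d \<delta> (A i)) + (\<Sum>i. ennreal (e * (1/2)^Suc i))"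
      by (intro suminf_add[symmetric]) auto
    also have "(\<Sum>i. ennreal (e * (1/2)^Suc i)) = ennreal e"
      using sums_mult[OF power_half_series, of e] e
      by (intro suminf_ennreal_eq) (auto simp: mult.assoc)
    finally show "hausdorff_pre d \<delta> (\<Union>i. A i) \<le> (\<Sum>i. hausdorff_pre d \<delta> (A i)) + ennreal e" .
  qed
qed simp

lemma hausdorff_outer_countably_subadditive:
  "hausdorff_outer d (\<Union>i. A i) \<le> (\<Sum>i::nat. hausdorff_outer d (A i))"
  unfolding hausdorff_outer_eq[of d "\<Union>i. A i"]
proof (rule SUP_least)
  fix \<delta> :: real assume "\<delta> \<in> {0<..}"
  then have "(\<Sum>i. hausdorff_pre d \<delta> (A i)) \<le> (\<Sum>i. hausdorff_outer d (A i))"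
    by (intro suminf_le hausdorff_pre_le_outer) auto
  with hausdorff_pre_countably_subadditive
  show "hausdorff_pre d \<delta> (\<Union>i. A i) \<le> (\<Sum>i. hausdorff_outer d (A i))"
    by (rule order_trans)
qed

lemma hausdorff_outer_measure_space:
  "d \<noteq> 0 \<Longrightarrow> outer_measure_space UNIV (hausdorff_outer d)"
  unfolding outer_measure_space_def positive_def increasing_def countably_subadditive_def
  by (auto intro: hausdorff_outer_empty hausdorff_outer_mono hausdorff_outer_countably_subadditive)

lemma hausdorff_outer_subadditive:
  assumes "d \<noteq> 0" shows "hausdorff_outer d (A \<union> B) \<le> hausdorff_outer d A + hausdorff_outer d B"
proof -
  have "hausdorff_outer d (\<Union>i::nat. (if i = 0 then A else if i = 1 then B else {}))
     \<le> (\<Sum>i::nat. hausdorff_outer d (if i = 0 then A else if i = 1 then B else {}))"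
    by (rule hausdorff_outer_countably_subadditive)
  also have "\<dots> = (\<Sum>i\<in>{0,1::nat}. hausdorff_outer d (if i = 0 then A else if i = 1 then B else {}))"
    by (rule suminf_finite) (use assms in \<open>auto simp: hausdorff_outer_empty\<close>)
  also have "(\<Union>i::nat. (if i = 0 then A else if i = 1 then B else {})) = A \<union> B"
    by (auto split: if_splits)
  finally show ?thesis by simp
qed

text \<open>A set of diameter less than the distance of \<open>A\<close> and \<open>B\<close> meets only one of them.\<close>

lemma hausdorff_outer_metric_additive:
  assumes d: "d \<noteq> 0" and r: "0 < r" and sep: "\<And>x y. x \<in> A \<Longrightarrow> y \<in> B \<Longrightarrow> r \<le> dist x y"
  shows "hausdorff_outer d A + hausdorff_outer d B \<le> hausdorff_outer d (A \<union> B)"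
proof -
  have pre: "hausdorff_pre d \<delta> A + hausdorff_pre d \<delta> B \<le> hausdorff_outer d (A \<union> B)"
    if \<delta>: "0 < \<delta>" "\<delta> < r" for \<delta>
  proof -
    have "hausdorff_pre d \<delta> A + hausdorff_pre d \<delta> B \<le> (\<Sum>i. hausdorff_cost d (C i))"
      if C: "hausdorff_cover \<delta> (A \<union> B) C" for C
    proof -
      have bd: "bounded (C i)" "diameter (C i) \<le> \<delta>" for i
        using C by (auto simp: hausdorff_cover_def)
      have one: "C i \<inter> A = {} \<or> C i \<inter> B = {}" for i
      proof (rule ccontr)
        assume "\<not> ?thesis"
        then obtain x y where "x \<in> C i" "x \<in> A" "y \<in> C i" "y \<in> B" by auto
        then have "r \<le> dist x y" "dist x y \<le> diameter (C i)"
          using sep bd diameter_bounded_bound by blast+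
        then show False using bd[of i] \<delta> by linarith
      qed
      have cov: "hausdorff_cover \<delta> E (\<lambda>i. C i \<inter> E)" if "E \<subseteq> A \<union> B" for E
        unfolding hausdorff_cover_def
      proof (intro conjI allI)
        show "E \<subseteq> (\<Union>i. C i \<inter> E)" using C that by (auto simp: hausdorff_cover_def)
        show "bounded (C i \<inter> E)" for i using bd by blast
        show "diameter (C i \<inter> E) \<le> \<delta>" for i
          using diameter_subset[of "C i \<inter> E" "C i"] bd[of i] by auto
      qed
      have "hausdorff_pre d \<delta> A + hausdorff_pre d \<delta> B
        \<le> (\<Sum>i. hausdorff_cost d (C i \<inter> A)) + (\<Sum>i. hausdorff_cost d (C i \<inter> B))"
        by (intro add_mono hausdorff_pre_le cov) auto
      also have "\<dots> = (\<Sum>i. hausdorff_cost d (C i \<inter> A) + hausdorff_cost d (C i \<inter> B))"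
        by (intro suminf_add) auto
      also have "\<dots> \<le> (\<Sum>i. hausdorff_cost d (C i))"
      proof (rule suminf_le)
        fix i
        show "hausdorff_cost d (C i \<inter> A) + hausdorff_cost d (C i \<inter> B) \<le> hausdorff_cost d (C i)"
          using one[of i] hausdorff_cost_mono[of "C i \<inter> A" "C i" d]
            hausdorff_cost_mono[of "C i \<inter> B" "C i" d] bd[of i] d
          by (auto simp: hausdorff_cost_empty)
      qed auto
      finally show ?thesis .
    qed
    then have "hausdorff_pre d \<delta> A + hausdorff_pre d \<delta> B \<le> hausdorff_pre d \<delta> (A \<union> B)"
      unfolding hausdorff_pre_def[of d \<delta> "A \<union> B"] by (auto intro!: INF_greatest)
    also have "\<dots> \<le> hausdorff_outer d (A \<union> B)"
      using \<delta> by (intro hausdorff_pre_le_outer)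
    finally show ?thesis .
  qed
  have "hausdorff_outer d A + hausdorff_outer d B =
     (SUP \<delta>\<in>{0<..}. hausdorff_pre d \<delta> A + hausdorff_pre d \<delta> B)"
    unfolding hausdorff_outer_eq
  proof (rule SUP_add_directed_ennreal[symmetric])
    fix i j :: real assume "i \<in> {0<..}" "j \<in> {0<..}"
    then show "\<exists>k\<in>{0<..}. hausdorff_pre d i A + hausdorff_pre d j B
        \<le> hausdorff_pre d k A + hausdorff_pre d k B"
      by (intro bexI[of _ "min i j"] add_mono hausdorff_pre_antimono) auto
  qed
  also have "\<dots> \<le> hausdorff_outer d (A \<union> B)"
  proof (rule SUP_least)
    fix \<delta> :: real assume \<delta>: "\<delta> \<in> {0<..}"
    \<comment> \<open>\<open>pre\<close> treats only \<delta> below \<open>r\<close>. Larger values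
      reduce to it because \<open>hausdorff_pre\<close> decreases in \<delta>.\<close>
    have "hausdorff_pre d \<delta> A + hausdorff_pre d \<delta> B
      \<le> hausdorff_pre d (min \<delta> (r/2)) A + hausdorff_pre d (min \<delta> (r/2)) B"
      by (intro add_mono hausdorff_pre_antimono) auto
    also have "\<dots> \<le> hausdorff_outer d (A \<union> B)"
      using \<delta> r by (intro pre) (auto simp: min_def)
    finally show "hausdorff_pre d \<delta> A + hausdorff_pre d \<delta> B \<le> hausdorff_outer d (A \<union> B)" .
  qed
  finally show ?thesis .
qed

lemma hausdorff_outer_isometry_le:
  assumes "\<And>x y. dist (f x) (f y) = dist x y"
  shows "hausdorff_outer d (f ` A) \<le> hausdorff_outer d A"
proof -
  have diam: "diameter (f ` C) = diameter C" for C
  proof -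
    have "(\<lambda>(x, y). dist x y) ` (f ` C \<times> f ` C) = (\<lambda>(x, y). dist (f x) (f y)) ` (C \<times> C)"
      by fastforce
    also have "\<dots> = (\<lambda>(x, y). dist x y) ` (C \<times> C)" by (simp only: assms)
    finally show ?thesis unfolding diameter_def by (simp only: image_is_empty)
  qed
  have "hausdorff_pre d \<delta> (f ` A) \<le> hausdorff_pre d \<delta> A" for \<delta>
    unfolding hausdorff_pre_def[of d \<delta> A]
  proof (rule INF_greatest)
    fix C assume "C \<in> {C. hausdorff_cover \<delta> A C}"
    then have "hausdorff_cover \<delta> (f ` A) (\<lambda>i. f ` C i)"
      unfolding hausdorff_cover_def diam mem_Collect_eq
    proof (intro conjI allI; elim conjE)
      fix i assume *: "\<forall>i. bounded (C i) \<and> diameter (C i) \<le> \<delta>"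
      then obtain x e where "\<forall>y\<in>C i. dist x y \<le> e" unfolding bounded_def by blast
      then have "\<forall>y\<in>f ` C i. dist (f x) y \<le> e" using assms by auto
      then show "bounded (f ` C i)" unfolding bounded_def by blast
    next
      assume "A \<subseteq> (\<Union>i. C i)"
      then have "f ` A \<subseteq> f ` (\<Union>i. C i)" by (rule image_mono)
      then show "f ` A \<subseteq> (\<Union>i. f ` C i)" by (simp only: image_UN)
    qed auto
    then have "hausdorff_pre d \<delta> (f ` A) \<le> (\<Sum>i. hausdorff_cost d (f ` C i))"
      by (rule hausdorff_pre_le)
    then show "hausdorff_pre d \<delta> (f ` A) \<le> (\<Sum>i. hausdorff_cost d (C i))"
      by (simp add: hausdorff_cost_def diam)
  qed
  then show ?thesis unfolding hausdorff_outer_eq by (intro SUP_mono) auto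
qed

lemma hausdorff_outer_isometry:
  assumes "\<And>x y. dist (f x) (f y) = dist x y" "surj f"
  shows "hausdorff_outer d (f ` A) = hausdorff_outer d A"
proof (rule antisym)
  have inj: "inj f" using assms(1) by (metis dist_eq_0_iff injI)
  have "dist (inv f x) (inv f y) = dist x y" for x y
    using assms by (metis surj_f_inv_f)
  from hausdorff_outer_isometry_le[OF this, of d "f ` A"]
  show "hausdorff_outer d A \<le> hausdorff_outer d (f ` A)"
    using inj by (simp add: image_comp)
qed (rule hausdorff_outer_isometry_le[OF assms(1)])

text \<open>Induction on metric additivity. The gap \<open>r N\<close> separates \<open>R N\<close>
  from the earlier pieces only and may shrink with \<open>N\<close>, as it does for shells
  accumulating at a closed set.\<close>

lemma sum_hausdorff_outer_separated_le:
  fixes R :: "nat \<Rightarrow> 'a::euclidean_space set"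
  assumes d: "d \<noteq> 0" and sub: "\<And>i. R i \<subseteq> T"
    and sep: "\<And>N x y i. i < N \<Longrightarrow> x \<in> R i \<Longrightarrow> y \<in> R N \<Longrightarrow> r N \<le> dist x y" and r: "\<And>N. 0 < N \<Longrightarrow> 0 < r N"
  shows "(\<Sum>i<N. hausdorff_outer d (R i)) \<le> hausdorff_outer d T"
proof -
  have "(\<Sum>i<N. hausdorff_outer d (R i)) \<le> hausdorff_outer d (\<Union>i<N. R i)"
  proof (induction N)
    case (Suc N)
    have "(\<Sum>i<Suc N. hausdorff_outer d (R i)) \<le> hausdorff_outer d (\<Union>i<N. R i) + hausdorff_outer d (R N)"
      using Suc by (simp add: add_right_mono)
    also have "\<dots> \<le> hausdorff_outer d ((\<Union>i<N. R i) \<union> R N)"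
    \<comment> \<open>For \<open>N = 0\<close> there is no earlier piece and any positive gap will
      do; \<open>r 0\<close> itself may be negative, for instance \<open>1 / 0 - 1\<close> in the
      application.\<close>
    proof (rule hausdorff_outer_metric_additive[OF d, of "if N = 0 then 1 else r N"])
      show "0 < (if N = 0 then 1 else r N)" using r[of N] by auto
      fix x y assume "x \<in> (\<Union>i<N. R i)" "y \<in> R N"
      then obtain i where "i < N" "x \<in> R i" by auto
      with sep[OF this \<open>y \<in> R N\<close>] show "(if N = 0 then 1 else r N) \<le> dist x y" by auto
    qed
    also have "(\<Union>i<N. R i) \<union> R N = (\<Union>i<Suc N. R i)"
      by (auto simp: lessThan_Suc)
    finally show ?case .
  qed simp
  also have "\<dots> \<le> hausdorff_outer d T"
    using sub by (intro hausdorff_outer_mono) auto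
  finally show ?thesis .
qed

text \<open>The Caratheodory criterion. The even shells \<open>R k\<close> around \<open>F\<close> are separated from each other, and so are
  the odd ones; hence their measures have a finite sum, and the part of \<open>T - F\<close> close to \<open>F\<close> is small.\<close>

lemma closed_split_hausdorff_outer:
  fixes F T :: "'a::euclidean_space set"
  assumes d: "d \<noteq> 0" and F: "closed F" "F \<noteq> {}"
  shows "hausdorff_outer d (F \<inter> T) + hausdorff_outer d (T - F) \<le> hausdorff_outer d T"
proof (cases "hausdorff_outer d T = \<infinity>")
  case False
  let ?H = "hausdorff_outer d"
  define S where "S k = {x\<in>T. 1 / real (Suc k) \<le> infdist x F}" for k
  define R where "R k = S (Suc k) - S k" for k
  have R: "1 / real (k + 2) \<le> infdist x F \<and> infdist x F < 1 / real (k + 1)" if "x \<in> R k" for x k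
    using that by (auto simp: R_def S_def not_le add.commute)
  \<comment> \<open>Points of an earlier shell of the same parity have distance at least 1/(2N+a)
    from \<open>F\<close>, points of the N-th one less than 1/(2N+a+1). The omitted shell between
    them is the gap.\<close>
  have parity: "(\<Sum>i<N. ?H (R (2 * i + a))) \<le> ?H T" for N a
  proof (rule sum_hausdorff_outer_separated_le[OF d,
        where r="\<lambda>N. 1 / real (2 * N + a) - 1 / real (2 * N + a + 1)"])
    show "R (2 * i + a) \<subseteq> T" for i by (auto simp: R_def S_def)
    show "0 < 1 / real (2 * N + a) - 1 / real (2 * N + a + 1)" if "0 < N" for N
      using that by (simp add: divide_strict_left_mono)
    fix N i x y assume *: "i < N" "x \<in> R (2 * i + a)" "y \<in> R (2 * N + a)"
    have "1 / real (2 * N + a) \<le> 1 / real (2 * i + a + 2)"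
      using *(1) by (intro divide_left_mono) auto
    also have "\<dots> \<le> infdist x F" using R[OF *(2)] by simp
    finally have "1 / real (2 * N + a) - 1 / real (2 * N + a + 1) \<le> infdist x F - infdist y F"
      using R[OF *(3)] by linarith
    also have "\<dots> \<le> dist x y" using infdist_triangle_abs[of x F y] by linarith
    finally show "1 / real (2 * N + a) - 1 / real (2 * N + a + 1) \<le> dist x y" .
  qed
  have "(\<Sum>k. ?H (R k)) \<le> ?H T + ?H T"
  proof (rule suminf_le_const)
    fix n
    have "(\<Sum>k<n. ?H (R k)) \<le> (\<Sum>k<2 * n. ?H (R k))"
      by (intro sum_mono2) auto
    also have "(\<Sum>k<2 * n. ?H (R k)) = (\<Sum>i<n. ?H (R (2 * i + 0))) + (\<Sum>i<n. ?H (R (2 * i + 1)))"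
      by (induction n) (auto simp: algebra_simps)
    also have "\<dots> \<le> ?H T + ?H T" by (intro add_mono parity)
    finally show "(\<Sum>k<n. ?H (R k)) \<le> ?H T + ?H T" .
  qed auto
  then have fin: "(\<Sum>k. ?H (R k)) \<noteq> \<infinity>"
    using False by (metis ennreal_add_eq_top infinity_ennreal_def top.extremum_unique)
  \<comment> \<open>The partial sum is added on both sides because tails cannot be subtracted in
    \<open>ennreal\<close>; the finite total is cancelled after taking the supremum over
    \<open>k\<close>.\<close>
  have split: "?H (F \<inter> T) + ?H (T - F) + (\<Sum>j<k. ?H (R j)) \<le> ?H T + (\<Sum>j. ?H (R j))" for k
  proof -
    have "T - F \<subseteq> S k \<union> (\<Union>j. R (j + k))"
    proof
      fix x assume x: "x \<in> T - F"
      then have "0 < infdist x F" using F infdist_pos_not_in_closed by fastforce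
      then obtain m where "1 / real (Suc m) < infdist x F"
        using reals_Archimedean[of "infdist x F"] by (auto simp: inverse_eq_divide)
      then have ex: "x \<in> S m" using x by (auto simp: S_def)
      define m0 where "m0 = (LEAST m. x \<in> S m)"
      have m0: "x \<in> S m0" unfolding m0_def using ex by (rule LeastI)
      show "x \<in> S k \<union> (\<Union>j. R (j + k))"
      proof (cases "m0 \<le> k")
        case True
        then have "1 / real (Suc k) \<le> 1 / real (Suc m0)"
          by (intro divide_left_mono) auto
        then show ?thesis using m0 by (auto simp: S_def)
      next
        case False
        then obtain j where j: "m0 = Suc (j + k)"
          by (metis add.commute add_Suc_right less_imp_Suc_add not_le)
        have "x \<notin> S (j + k)"
          using not_less_Least[of "j + k" "\<lambda>m. x \<in> S m"] j unfolding m0_def by simp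
        then show ?thesis using m0 j by (auto simp: R_def)
      qed
    qed
    then have "?H (T - F) \<le> ?H (S k \<union> (\<Union>j. R (j + k)))" by (rule hausdorff_outer_mono)
    also have "\<dots> \<le> ?H (S k) + ?H (\<Union>j. R (j + k))" by (rule hausdorff_outer_subadditive[OF d])
    also have "\<dots> \<le> ?H (S k) + (\<Sum>j. ?H (R (j + k)))"
      by (intro add_left_mono hausdorff_outer_countably_subadditive)
    finally have "?H (F \<inter> T) + ?H (T - F) + (\<Sum>j<k. ?H (R j))
        \<le> ?H (F \<inter> T) + (?H (S k) + (\<Sum>j. ?H (R (j + k)))) + (\<Sum>j<k. ?H (R j))"
      by (intro add_mono order_refl)
    also have "\<dots> = (?H (F \<inter> T) + ?H (S k)) + (\<Sum>j. ?H (R j))"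
      by (subst suminf_offset[of _ k]) (auto simp: add_ac)
    also have "?H (F \<inter> T) + ?H (S k) \<le> ?H ((F \<inter> T) \<union> S k)"
    proof (rule hausdorff_outer_metric_additive[OF d, of "1 / real (Suc k)"])
      fix x y assume xy: "x \<in> F \<inter> T" "y \<in> S k"
      then have "1 / real (Suc k) \<le> infdist y F" by (auto simp: S_def)
      also have "\<dots> \<le> dist y x" using xy by (intro infdist_le) auto
      finally show "1 / real (Suc k) \<le> dist x y" by (simp add: dist_commute)
    qed auto
    also have "\<dots> \<le> ?H T" by (intro hausdorff_outer_mono) (auto simp: S_def)
    finally show ?thesis by (simp add: add_right_mono)
  qed
  have "?H (F \<inter> T) + ?H (T - F) + (\<Sum>j. ?H (R j)) = (SUP k. ?H (F \<inter> T) + ?H (T - F) + (\<Sum>j<k. ?H (R j)))"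
    by (subst suminf_eq_SUP) (auto simp: ennreal_SUP_add_right)
  also have "\<dots> \<le> ?H T + (\<Sum>j. ?H (R j))" using split by (intro SUP_least)
  finally show ?thesis
    using fin ennreal_add_left_cancel_le[of "\<Sum>j. ?H (R j)"] by (simp add: add.commute)
qed simp

text \<open>Closed sets satisfy the Caratheodory criterion and generate the Borel sets. Without this
  fact \<open>measure_of\<close> in \<open>hausdorff_measure\<close> would default to the zero
  measure.\<close>

lemma measure_space_hausdorff:
  assumes d: "d \<noteq> 0"
  shows "measure_space UNIV (sets (borel :: 'a::euclidean_space measure)) (hausdorff_outer d)"
proof -
  let ?L = "lambda_system UNIV UNIV (hausdorff_outer d :: 'a set \<Rightarrow> ennreal)"
  interpret sigma_algebra "UNIV :: 'a set" UNIV by (simp add: sigma_algebra_iff2)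
  have L: "measure_space UNIV ?L (hausdorff_outer d)"
    by (rule caratheodory_lemma[OF hausdorff_outer_measure_space[OF d]])
  have cl: "F \<in> ?L" if "closed F" for F
  proof -
    have "hausdorff_outer d (F \<inter> T) + hausdorff_outer d ((UNIV - F) \<inter> T) = hausdorff_outer d T" for T
    proof (rule antisym)
      have "(UNIV - F) \<inter> T = T - F" by auto
      then show "hausdorff_outer d (F \<inter> T) + hausdorff_outer d ((UNIV - F) \<inter> T) \<le> hausdorff_outer d T"
        \<comment> \<open>The empty set is treated apart: \<open>infdist\<close> to it is 0 by
          convention, so the shells make no sense there.\<close>
        using closed_split_hausdorff_outer[OF d that, of T] hausdorff_outer_empty[OF d]
        by (cases "F = {}") auto
      have "hausdorff_outer d T \<le> hausdorff_outer d ((F \<inter> T) \<union> ((UNIV - F) \<inter> T))"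
        by (intro hausdorff_outer_mono) auto
      also have "\<dots> \<le> hausdorff_outer d (F \<inter> T) + hausdorff_outer d ((UNIV - F) \<inter> T)"
        by (rule hausdorff_outer_subadditive[OF d])
      finally show "hausdorff_outer d T \<le> hausdorff_outer d (F \<inter> T) + hausdorff_outer d ((UNIV - F) \<inter> T)" .
    qed
    then show ?thesis by (auto simp: lambda_system_def)
  qed
  interpret LS: sigma_algebra "UNIV :: 'a set" ?L using L by (simp add: measure_space_def)
  have sub: "sets (borel :: 'a measure) \<subseteq> ?L"
  proof -
    have "sigma_sets UNIV (Collect closed) \<subseteq> ?L"
      by (rule LS.sigma_sets_subset) (auto intro: cl)
    then show ?thesis unfolding borel_eq_closed by simp
  qed
  show ?thesis
    unfolding measure_space_def
  proof (intro conjI)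
    show "sigma_algebra UNIV (sets (borel :: 'a measure))"
      using sets.sigma_algebra_axioms[of "borel :: 'a measure"] by simp
    show "positive (sets (borel :: 'a measure)) (hausdorff_outer d)"
      using d by (simp add: positive_def hausdorff_outer_empty)
    show "countably_additive (sets (borel :: 'a measure)) (hausdorff_outer d)"
      using L sub unfolding measure_space_def countably_additive_def by (meson order_trans sets.countable_UN subsetD)
  qed
qed

lemma
  shows sets_hausdorff_measure [measurable_cong, simp]: "sets (hausdorff_measure d :: 'a::euclidean_space measure) = sets borel"
    and space_hausdorff_measure [simp]: "space (hausdorff_measure d :: 'a measure) = UNIV"
proof -
  show *: "sets (hausdorff_measure d :: 'a measure) = sets borel"
    unfolding hausdorff_measure_def
    using sets.sigma_sets_eq[of "borel :: 'a measure"] by (subst sets_measure_of) auto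
  show "space (hausdorff_measure d :: 'a measure) = UNIV"
    using sets_eq_imp_space_eq[OF *] by simp
qed

lemma emeasure_hausdorff_measure:
  fixes A :: "'a::euclidean_space set"
  assumes "d \<noteq> 0" "A \<in> sets borel"
  shows "emeasure (hausdorff_measure d) A = hausdorff_outer d A"
  unfolding hausdorff_measure_def
proof (rule emeasure_measure_of_sigma)
  show "sigma_algebra UNIV (sets (borel :: 'a measure))"
      "positive (sets (borel :: 'a measure)) (hausdorff_outer d)"
      "countably_additive (sets (borel :: 'a measure)) (hausdorff_outer d)"
    using measure_space_hausdorff[OF assms(1), where 'a='a] by (auto simp: measure_space_def)
qed (rule assms)

section \<open>Uniformly distributed measures and the sphere\<close>

text \<open>Christensen's argument: two uniformly distributed measures with the same ball measures agree.
  By Fubini, \<open>\<integral>\<^sub>U N(U \<inter> B(x,r)) / h(r) dM = \<integral>\<^sub>U M(U \<inter> B(y,r)) / h(r) dN \<le> N U\<close>, and the left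
  integrand tends to \<open>1\<close> on \<open>U\<close>.\<close>

lemma uniform_measure_open_le:
  fixes M N :: "'a::euclidean_space measure"
  assumes sM: "sets M = sets borel" and sN: "sets N = sets borel"
    and sf: "sigma_finite_measure M" "sigma_finite_measure N"
    and aeM: "AE x in M. x \<in> S" and aeN: "AE x in N. x \<in> S"
    and ballM: "\<And>x r. x \<in> S \<Longrightarrow> 0 < r \<Longrightarrow> emeasure M (ball x r) = h r"
    and ballN: "\<And>x r. x \<in> S \<Longrightarrow> 0 < r \<Longrightarrow> emeasure N (ball x r) = h r"
    and h: "\<And>r. 0 < r \<Longrightarrow> 0 < h r \<and> h r < \<infinity>"
    and U: "open U"
  shows "emeasure M U \<le> emeasure N U"
proof -
  interpret pair_sigma_finite M N using sf by (simp add: pair_sigma_finite_def)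
  define r where "r k = 1 / real (Suc k)" for k
  have r: "0 < r k" for k by (simp add: r_def)
  note [measurable_cong] = sM sN
  have U'[measurable]: "U \<in> sets borel" using U by simp
  define F where "F k = (\<lambda>z. indicator U (fst z) * indicator U (snd z) * indicator {z. dist (fst z) (snd z) < r k} z :: ennreal)"
    for k
  have sp: "sets (M \<Otimes>\<^sub>M N) = sets (borel :: ('a \<times> 'a) measure)"
    by (subst borel_prod[symmetric]) (rule sets_pair_measure_cong[OF sM sN])
  have [measurable]: "{z. dist (fst z) (snd z) < r k} \<in> sets (M \<Otimes>\<^sub>M N)" for k
    unfolding sp by (intro borel_open open_Collect_less continuous_intros)
  have [measurable]: "F k \<in> borel_measurable (M \<Otimes>\<^sub>M N)" for k
    unfolding F_def by measurable
  have inner: "(\<integral>\<^sup>+y. F k (x, y) \<partial>N) = indicator U x * emeasure N (U \<inter> ball x (r k))" for k x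
  proof -
    have "(\<integral>\<^sup>+y. F k (x, y) \<partial>N) = (\<integral>\<^sup>+y. indicator U x * indicator (U \<inter> ball x (r k)) y \<partial>N)"
      (is "_ = ?I")
      by (intro nn_integral_cong) (auto simp: F_def indicator_def)
    also have "?I = indicator U x * emeasure N (U \<inter> ball x (r k))"
      by (rule nn_integral_cmult_indicator) (simp add: sN)
    finally show ?thesis .
  qed
  have inner': "(\<integral>\<^sup>+x. F k (x, y) \<partial>M) = indicator U y * emeasure M (U \<inter> ball y (r k))" for k y
  proof -
    have "(\<integral>\<^sup>+x. F k (x, y) \<partial>M) = (\<integral>\<^sup>+x. indicator U y * indicator (U \<inter> ball y (r k)) x \<partial>M)"
      (is "_ = ?I")
      by (intro nn_integral_cong) (auto simp: F_def indicator_def dist_commute[of y])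
    also have "?I = indicator U y * emeasure M (U \<inter> ball y (r k))"
      by (rule nn_integral_cmult_indicator) (simp add: sM)
    finally show ?thesis .
  qed
  have meas[measurable]: "(\<lambda>x. indicator U x * emeasure N (U \<inter> ball x (r k))) \<in> borel_measurable M" for k
    unfolding inner[symmetric] by measurable
  have upper: "(\<integral>\<^sup>+x. indicator U x * emeasure N (U \<inter> ball x (r k)) \<partial>M) \<le> h (r k) * emeasure N U" for k
  proof -
    have "(\<integral>\<^sup>+x. indicator U x * emeasure N (U \<inter> ball x (r k)) \<partial>M)
      = (\<integral>\<^sup>+y. indicator U y * emeasure M (U \<inter> ball y (r k)) \<partial>N)"
      unfolding inner[symmetric] inner'[symmetric] by (rule Fubini'[symmetric]) measurable
    also have "\<dots> \<le> (\<integral>\<^sup>+y. h (r k) * indicator U y \<partial>N)"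
    proof (rule nn_integral_mono_AE, use aeN in eventually_elim)
      fix y assume "y \<in> S"
      have "emeasure M (U \<inter> ball y (r k)) \<le> emeasure M (ball y (r k))"
        by (intro emeasure_mono) (auto simp: sM)
      then show "indicator U y * emeasure M (U \<inter> ball y (r k)) \<le> h (r k) * indicator U y"
        using ballM[OF \<open>y \<in> S\<close> r] by (auto simp: indicator_def)
    qed
    also have "\<dots> = h (r k) * emeasure N U" by (simp add: nn_integral_cmult_indicator sN)
    finally show ?thesis .
  qed
  have "emeasure M U = (\<integral>\<^sup>+x. indicator U x \<partial>M)" by (simp add: sM)
  also have "\<dots> \<le> (\<integral>\<^sup>+x. liminf (\<lambda>k. indicator U x * emeasure N (U \<inter> ball x (r k)) / h (r k)) \<partial>M)"
  proof (rule nn_integral_mono_AE, use aeM in eventually_elim)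
    fix x assume x: "x \<in> S"
    show "indicator U x \<le> liminf (\<lambda>k. indicator U x * emeasure N (U \<inter> ball x (r k)) / h (r k))"
    proof (cases "x \<in> U")
      case True
      then obtain e where e: "0 < e" "ball x e \<subseteq> U" using U open_contains_ball by blast
      obtain k0 where k0: "1 / real (Suc k0) < e"
        using reals_Archimedean[OF e(1)] by (auto simp: inverse_eq_divide)
      have "eventually (\<lambda>k. 1 \<le> indicator U x * emeasure N (U \<inter> ball x (r k)) / h (r k)) sequentially"
        unfolding eventually_sequentially
      proof (intro exI[of _ k0] allI impI)
        fix k assume "k0 \<le> k"
        then have "r k \<le> 1 / real (Suc k0)" unfolding r_def by (intro divide_left_mono) auto
        then have "ball x (r k) \<subseteq> U" using e k0 by (meson less_imp_le order_trans subset_ball)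
        then have "U \<inter> ball x (r k) = ball x (r k)" by auto
        then show "1 \<le> indicator U x * emeasure N (U \<inter> ball x (r k)) / h (r k)"
          using True ballN[OF x r[of k]] h[OF r[of k]]
          by (simp add: ennreal_divide_self less_imp_neq[symmetric])
      qed
      then have "1 \<le> liminf (\<lambda>k. indicator U x * emeasure N (U \<inter> ball x (r k)) / h (r k))"
        by (rule Liminf_bounded)
      then show ?thesis using True by simp
    qed simp
  qed
  also have "\<dots> \<le> liminf (\<lambda>k. \<integral>\<^sup>+x. indicator U x * emeasure N (U \<inter> ball x (r k)) / h (r k) \<partial>M)"
    by (rule nn_integral_liminf) measurable
  also have "\<dots> \<le> liminf (\<lambda>k. emeasure N U)"
  proof (rule Liminf_mono, rule always_eventually, rule allI)
    fix k
    have "(\<integral>\<^sup>+x. indicator U x * emeasure N (U \<inter> ball x (r k)) / h (r k) \<partial>M)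
       = (\<integral>\<^sup>+x. indicator U x * emeasure N (U \<inter> ball x (r k)) \<partial>M) / h (r k)"
      by (rule nn_integral_divide) measurable
    also have "\<dots> \<le> h (r k) * emeasure N U / h (r k)"
      by (intro divide_right_mono_ennreal upper)
    also have "\<dots> = emeasure N U"
      using h[OF r[of k]] ennreal_mult_divide_eq[of "h (r k)" "emeasure N U"]
      by (auto simp: mult.commute[of "emeasure N U"] less_imp_neq[symmetric])
    finally show "(\<integral>\<^sup>+x. indicator U x * emeasure N (U \<inter> ball x (r k)) / h (r k) \<partial>M) \<le> emeasure N U" .
  qed
  also have "\<dots> = emeasure N U" by (simp add: Liminf_const)
  finally show ?thesis .
qed

lemma uniform_measure_eq:
  fixes M N :: "'a::euclidean_space measure"
  assumes sM: "sets M = sets borel" and sN: "sets N = sets borel"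
    and sf: "sigma_finite_measure M" "sigma_finite_measure N"
    and aeM: "AE x in M. x \<in> S" and aeN: "AE x in N. x \<in> S"
    and ballM: "\<And>x r. x \<in> S \<Longrightarrow> 0 < r \<Longrightarrow> emeasure M (ball x r) = h r"
    and ballN: "\<And>x r. x \<in> S \<Longrightarrow> 0 < r \<Longrightarrow> emeasure N (ball x r) = h r"
    and h: "\<And>r. 0 < r \<Longrightarrow> 0 < h r \<and> h r < \<infinity>"
    and fin: "\<And>r. emeasure M (ball 0 r) < \<infinity>"
  shows "M = N"
proof (rule measure_eqI_generator_eq[where E="Collect open" and \<Omega>=UNIV and A="\<lambda>i. ball 0 (real i)"])
  fix U :: "'a set" assume "U \<in> Collect open"
  then have U: "open U" by simp
  show "emeasure M U = emeasure N U"
    using uniform_measure_open_le[OF sM sN sf aeM aeN ballM ballN h U]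
      uniform_measure_open_le[OF sN sM sf(2,1) aeN aeM ballN ballM h U]
    by (intro antisym)
next
  show "(\<Union>i. ball 0 (real i)) = (UNIV :: 'a set)"
    using reals_Archimedean2 by (auto simp: dist_norm)
  show "emeasure M (ball 0 (real i)) \<noteq> \<infinity>" for i using fin[of "real i"] by simp
qed (auto simp: sM sN Int_stable_def borel_def)

text \<open>The image measure gives a ball of radius \<open>r\<close> the Lebesgue measure of
  another ball of radius \<open>r\<close>. So both measures are uniformly distributed with the same
  ball masses, and uniqueness identifies them.\<close>

lemma distr_lborel_isometry:
  fixes T :: "'a::euclidean_space \<Rightarrow> 'a"
  assumes dist: "\<And>x y. dist (T x) (T y) = dist x y" and surj: "surj T"
  shows "distr lborel borel T = lborel"
proof (rule uniform_measure_eq[where S=UNIV and h="\<lambda>r. emeasure lborel (ball (0::'a) r)"])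
  have cont: "continuous_on UNIV T"
    unfolding continuous_on_iff using dist by (auto intro!: exI)
  have [measurable]: "T \<in> borel \<rightarrow>\<^sub>M borel" using cont by (rule borel_measurable_continuous_onI)
  have inv: "T (inv T x) = x" for x using surj by (simp add: surj_f_inv_f)
  have em: "emeasure (distr lborel borel T) (ball x r) = emeasure lborel (ball (inv T x) r)" for x r
  proof -
    have "T -` ball x r = ball (inv T x) r"
      using dist[of "inv T x"] by (auto simp: inv)
    then show ?thesis by (simp add: emeasure_distr)
  qed
  have ball0: "emeasure lborel (ball x r) = emeasure lborel (ball (0::'a) r)" if "0 < r" for x :: 'a and r
    using that by (simp add: emeasure_ball)
  show "emeasure (distr lborel borel T) (ball x r) = emeasure lborel (ball (0::'a) r)" if "0 < r" for x r
    using em ball0[OF that] by simp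
  show "emeasure lborel (ball x r) = emeasure lborel (ball (0::'a) r)" if "0 < r" for x :: 'a and r
    by (rule ball0[OF that])
  show "0 < emeasure lborel (ball (0::'a) r) \<and> emeasure lborel (ball (0::'a) r) < \<infinity>" if "0 < r" for r
    using that by (simp add: emeasure_ball ennreal_zero_less_mult_iff)
  show fin: "emeasure (distr lborel borel T) (ball 0 r) < \<infinity>" for r
    unfolding em by (rule emeasure_lborel_ball_finite)
  show "sigma_finite_measure (distr lborel borel T)"
  proof
    show "\<exists>A. countable A \<and> A \<subseteq> sets (distr lborel borel T) \<and> \<Union> A = space (distr lborel borel T) \<and>
        (\<forall>a\<in>A. emeasure (distr lborel borel T) a \<noteq> \<infinity>)"
    proof (intro exI[of _ "range (\<lambda>i. ball 0 (real i))"] conjI ballI)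
      show "\<Union> (range (\<lambda>i. ball 0 (real i))) = space (distr lborel borel T)"
        using reals_Archimedean2 by (auto simp: dist_norm)
    next
      fix a assume "a \<in> range (\<lambda>i. ball (0::'a) (real i))"
      then obtain i where "a = ball 0 (real i)" by blast
      then show "emeasure (distr lborel borel T) a \<noteq> \<infinity>" using fin[of "real i"] by simp
    qed auto
  qed
qed (auto intro: sigma_finite_lborel)

text \<open>The reflection in the hyperplane orthogonal to \<open>x - y\<close>. Equal norms give
  \<open>2 * (x \<bullet> w) = w \<bullet> w\<close>, which is why it sends \<open>x\<close> to
  \<open>y\<close>.\<close>

lemma exists_linear_isometry:
  fixes x y :: "'a::euclidean_space"
  assumes "norm x = norm y"
  obtains T where "linear T" "\<And>u v. dist (T u) (T v) = dist u v" "surj T" "T x = y"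
proof (cases "x = y")
  case True
  then show thesis by (intro that[of id]) (auto simp: linear_id)
next
  case False
  define w where "w = x - y"
  define T where "T v = v - (2 * (v \<bullet> w) / (w \<bullet> w)) *\<^sub>R w" for v
  have ww: "w \<bullet> w \<noteq> 0" using False by (simp add: w_def)
  have lin: "linear T"
    by (rule linearI) (auto simp: T_def inner_add_left algebra_simps add_divide_distrib)
  have TT: "T (T v) = v" for v
    using ww by (simp add: T_def inner_diff_left algebra_simps)
  have norm: "norm (T v) = norm v" for v
    unfolding norm_eq using ww
    by (simp add: T_def inner_diff_left inner_diff_right inner_commute field_simps power2_eq_square)
  have "dist (T u) (T v) = dist u v" for u v
    unfolding dist_norm using norm[of "u - v"] linear_diff[OF lin] by metis
  moreover have "surj T" using TT by (metis surjI)
  moreover have "T x = y"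
  proof -
    have "x \<bullet> x = y \<bullet> y" using assms by (simp add: norm_eq)
    then have "2 * (x \<bullet> w) = w \<bullet> w" by (simp add: w_def inner_diff_left inner_diff_right inner_commute)
    then show ?thesis using ww by (simp add: T_def w_def)
  qed
  ultimately show thesis using that lin by blast
qed

section \<open>The cone measure of the unit sphere\<close>

text \<open>Up to the factor \<open>DIM('a)\<close> this is the standard surface measure of the unit sphere; the apex is mapped to
  \<open>sgn 0 = 0\<close>, off the sphere, but is a null set.\<close>

definition cone_measure :: "'a::euclidean_space measure" where
  "cone_measure = distr (restrict_space lborel (ball 0 1)) borel sgn"

lemma sgn_borel [measurable]: "(sgn :: 'a::euclidean_space \<Rightarrow> 'a) \<in> borel \<rightarrow>\<^sub>M borel"
  unfolding sgn_div_norm[abs_def] by measurable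

lemma sets_cone_measure [measurable_cong, simp]: "sets cone_measure = sets borel"
  and space_cone_measure [simp]: "space cone_measure = UNIV"
  by (simp_all add: cone_measure_def)

lemma emeasure_cone_measure:
  fixes A :: "'a::euclidean_space set"
  assumes [measurable]: "A \<in> sets borel"
  shows "emeasure cone_measure A = emeasure lborel {y\<in>ball 0 1. sgn y \<in> A}"
proof -
  have [measurable]: "sgn \<in> restrict_space lborel (ball (0::'a) 1) \<rightarrow>\<^sub>M borel"
    by (rule measurable_restrict_space1) simp
  have eq: "sgn -` A \<inter> ball 0 1 = {y\<in>ball 0 1. sgn y \<in> A}" by auto
  show ?thesis
    unfolding cone_measure_def
    using emeasure_restrict_space[of "ball 0 1" lborel "{y\<in>ball 0 1. sgn y \<in> A}"]
    by (subst emeasure_distr) (simp_all add: space_restrict_space eq subset_iff)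
qed

lemma emeasure_cone_sector:
  fixes A :: "'a::euclidean_space set"
  assumes A[measurable]: "A \<in> sets borel" and t: "0 < t"
  shows "emeasure lborel {y\<in>ball 0 t. sgn y \<in> A} = ennreal (t ^ DIM('a)) * emeasure cone_measure A"
proof -
  have eq: "{y\<in>ball 0 t. sgn y \<in> A} = (\<lambda>x. t *\<^sub>R x + 0) ` {y\<in>ball 0 1. sgn y \<in> A}"
  proof (intro set_eqI iffI)
    fix y assume y: "y \<in> {y\<in>ball 0 t. sgn y \<in> A}"
    have "y = t *\<^sub>R ((1/t) *\<^sub>R y) + 0" using t by simp
    moreover have "(1/t) *\<^sub>R y \<in> {y\<in>ball 0 1. sgn y \<in> A}"
      using y t by (simp add: sgn_scaleR field_simps)
    ultimately show "y \<in> (\<lambda>x. t *\<^sub>R x + 0) ` {y\<in>ball 0 1. sgn y \<in> A}" by blast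
  qed (use t in \<open>auto simp: sgn_scaleR\<close>)
  have m: "{y\<in>ball 0 s. sgn y \<in> A} \<in> sets borel" for s :: real
    by measurable
  have "emeasure lborel {y\<in>ball 0 t. sgn y \<in> A} = emeasure lebesgue {y\<in>ball 0 t. sgn y \<in> A}"
    using m by simp
  also have "\<dots> = ennreal (t ^ DIM('a)) * emeasure lebesgue {y\<in>ball 0 1. sgn y \<in> A}"
    unfolding eq emeasure_lebesgue_affine using t by (simp add: ennreal_power)
  also have "emeasure lebesgue {y\<in>ball 0 1. sgn y \<in> A} = emeasure cone_measure A"
    using m[of 1] by (simp add: emeasure_cone_measure)
  finally show ?thesis .
qed

lemma emeasure_cone_measure_UNIV:
  "emeasure (cone_measure :: 'a::euclidean_space measure) UNIV = ennreal (unit_ball_vol (real DIM('a)))"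
proof -
  have "{y\<in>ball 0 1. sgn y \<in> UNIV} = ball (0::'a) 1" by auto
  then show ?thesis using emeasure_ball[of 1 "0::'a"]
    by (subst emeasure_cone_measure) simp_all
qed

lemma AE_cone_measure_sphere: "AE x in (cone_measure :: 'a::euclidean_space measure). x \<in> sphere 0 1"
proof (rule AE_I[where N="- sphere 0 1"])
  have "{y\<in>ball 0 1. sgn y \<in> - sphere (0::'a) 1} \<subseteq> {0}" by (auto simp: norm_sgn)
  then have "emeasure lborel {y\<in>ball 0 1. sgn y \<in> - sphere (0::'a) 1} \<le> emeasure lborel {0::'a}"
    by (intro emeasure_mono) auto
  then show "emeasure cone_measure (- sphere (0::'a) 1) = 0"
    by (simp add: emeasure_cone_measure)
qed auto

text \<open>A linear isometry commutes with \<open>sgn\<close> and preserves both Lebesgue measure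
  and the unit ball, hence the cone measure. The reflection taking \<open>x\<close> to
  \<open>y\<close> moves one cap to the other.\<close>

lemma cone_measure_ball_cong:
  fixes x y :: "'a::euclidean_space"
  assumes "norm x = norm y"
  shows "emeasure cone_measure (ball x r) = emeasure cone_measure (ball y r)"
proof -
  obtain T where T: "linear T" "\<And>u v. dist (T u) (T v) = dist u v" "surj T" "T x = y"
    by (rule exists_linear_isometry[OF assms]) blast
  have T0: "norm (T v) = norm v" for v
    using T(2)[of v 0] linear_0[OF T(1)] by simp
  have sgnT: "sgn (T v) = T (sgn v)" for v
    by (simp add: sgn_div_norm T0 linear_scale[OF T(1)])
  have cont: "continuous_on UNIV T"
    unfolding continuous_on_iff using T(2) by (auto intro!: exI)
  have [measurable]: "T \<in> borel \<rightarrow>\<^sub>M borel" using cont by (rule borel_measurable_continuous_onI)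
  have "emeasure cone_measure (ball y r) = emeasure (distr lborel borel T) {z\<in>ball 0 1. sgn z \<in> ball y r}"
    using T by (simp add: emeasure_cone_measure distr_lborel_isometry)
  also have "\<dots> = emeasure lborel (T -` {z\<in>ball 0 1. sgn z \<in> ball y r})"
    by (subst emeasure_distr) auto
  also have "T -` {z\<in>ball 0 1. sgn z \<in> ball y r} = {z\<in>ball 0 1. sgn z \<in> ball x r}"
    using T(2)[of x] by (auto simp: sgnT T0 T(4))
  finally show ?thesis by (simp add: emeasure_cone_measure)
qed

text \<open>The cone over the cap contains a neighbourhood of \<open>x/2\<close>, a point away from
  the apex, where \<open>sgn\<close> is continuous.\<close>

lemma cone_measure_ball_pos:
  fixes x :: "'a::euclidean_space"
  assumes x: "norm x = 1" and r: "0 < r"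
  shows "0 < emeasure cone_measure (ball x r)"
proof -
  let ?V = "(ball 0 1 - {0}) \<inter> sgn -` ball x r"
  have cont: "continuous_on (ball 0 1 - {0::'a}) sgn"
    by (intro continuous_on_sgn continuous_intros) auto
  have "open ?V"
    by (rule continuous_open_preimage[OF cont, of "ball x r"]) auto
  moreover have "(1/2) *\<^sub>R x \<in> ?V" using x r by (auto simp: sgn_scaleR sgn_div_norm)
  ultimately obtain e where e: "0 < e" "ball ((1/2) *\<^sub>R x) e \<subseteq> ?V"
    using open_contains_ball by blast
  have "0 < emeasure lborel (ball ((1/2) *\<^sub>R x) e)"
    using e(1) by (simp add: emeasure_ball ennreal_zero_less_mult_iff)
  also have "\<dots> \<le> emeasure lborel {y\<in>ball 0 1. sgn y \<in> ball x r}"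
    using e(2) by (intro emeasure_mono) auto
  finally show ?thesis by (simp add: emeasure_cone_measure)
qed

text \<open>Integrate the indicator of \<open>dist x y < r\<close> against the product measure in
  both orders. The ball masses \<open>g\<close> and \<open>h\<close> thus stand in the ratio of the
  total masses, the same for every radius, so that one fixed multiple of \<open>N\<close> has the
  ball masses of \<open>M\<close>.\<close>

lemma uniform_measure_proportional:
  fixes M N :: "'a::euclidean_space measure"
  assumes sM: "sets M = sets borel" and sN: "sets N = sets borel"
    and sf: "sigma_finite_measure M" "sigma_finite_measure N"
    and aeM: "AE x in M. x \<in> S" and aeN: "AE x in N. x \<in> S"
    and ballM: "\<And>x. x \<in> S \<Longrightarrow> emeasure M (ball x r) = g"
    and ballN: "\<And>x. x \<in> S \<Longrightarrow> emeasure N (ball x r) = h"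
  shows "g * emeasure N UNIV = h * emeasure M UNIV"
proof -
  interpret pair_sigma_finite M N using sf by (simp add: pair_sigma_finite_def)
  have sp: "sets (M \<Otimes>\<^sub>M N) = sets (borel :: ('a \<times> 'a) measure)"
    by (subst borel_prod[symmetric]) (rule sets_pair_measure_cong[OF sM sN])
  have [simp]: "space M = UNIV" "space N = UNIV"
    using sets_eq_imp_space_eq[OF sM] sets_eq_imp_space_eq[OF sN] by auto
  have [measurable]: "{z. dist (fst z) (snd z) < r} \<in> sets (M \<Otimes>\<^sub>M N)"
    unfolding sp by (intro borel_open open_Collect_less continuous_intros)
  define F where "F = (indicator {z. dist (fst z) (snd z) < r} :: 'a \<times> 'a \<Rightarrow> ennreal)"
  have [measurable]: "F \<in> borel_measurable (M \<Otimes>\<^sub>M N)" unfolding F_def by measurable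
  have inner: "(\<integral>\<^sup>+y. F (x, y) \<partial>N) = emeasure N (ball x r)" for x
  proof -
    have "(\<integral>\<^sup>+y. F (x, y) \<partial>N) = (\<integral>\<^sup>+y. indicator (ball x r) y \<partial>N)"
      by (intro nn_integral_cong) (auto simp: F_def indicator_def)
    then show ?thesis by (simp add: sN)
  qed
  have inner': "(\<integral>\<^sup>+x. F (x, y) \<partial>M) = emeasure M (ball y r)" for y
  proof -
    have "(\<integral>\<^sup>+x. F (x, y) \<partial>M) = (\<integral>\<^sup>+x. indicator (ball y r) x \<partial>M)"
      by (intro nn_integral_cong) (auto simp: F_def indicator_def dist_commute[of y])
    then show ?thesis by (simp add: sM)
  qed
  have "h * emeasure M UNIV = (\<integral>\<^sup>+x. h \<partial>M)" by simp
  also have "\<dots> = (\<integral>\<^sup>+x. \<integral>\<^sup>+y. F (x, y) \<partial>N \<partial>M)"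
    unfolding inner by (rule nn_integral_cong_AE) (use aeM in eventually_elim, simp add: ballN)
  also have "\<dots> = (\<integral>\<^sup>+y. \<integral>\<^sup>+x. F (x, y) \<partial>M \<partial>N)"
    by (rule Fubini'[symmetric]) measurable
  also have "\<dots> = (\<integral>\<^sup>+x. g \<partial>N)"
    unfolding inner' by (rule nn_integral_cong_AE) (use aeN in eventually_elim, simp add: ballM)
  also have "\<dots> = g * emeasure N UNIV" by simp
  finally show ?thesis ..
qed

section \<open>Hausdorff measure and cone measure on the sphere\<close>

lemma finite_measure_cone_measure: "finite_measure (cone_measure :: 'a::euclidean_space measure)"
  by (rule finite_measureI) (simp add: emeasure_cone_measure_UNIV)

text \<open>The part of the cone over a cap of radius \<open>r\<close> at distance at least \<open>1 - r\<close> from the apex lies in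
  a ball of radius \<open>2 r\<close>.\<close>

lemma cone_measure_cball_le:
  fixes x :: "'a::euclidean_space"
  assumes x: "norm x = 1" and r: "0 < r"
  shows "measure cone_measure (cball x r) \<le> 2 ^ DIM('a) * unit_ball_vol (real DIM('a)) * r ^ (DIM('a) - 1)"
proof -
  let ?n = "DIM('a)" and ?\<omega> = "unit_ball_vol (real DIM('a))"
  interpret finite_measure "cone_measure :: 'a measure" by (rule finite_measure_cone_measure)
  define s where "s = measure cone_measure (cball x r)"
  have n: "?n = Suc (?n - 1)" by simp
  show ?thesis
  \<comment> \<open>For large \<open>r\<close> the total mass is already below the bound, since
    \<open>(2 * r) ^ (n - 1) \<ge> 1\<close>. For \<open>r \<le> 1/2\<close> the inner radius
    \<open>1 - r\<close> is positive and the sector can be rescaled.\<close>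
  proof (cases "r \<le> 1/2")
    case False
    have "s \<le> measure cone_measure (UNIV :: 'a set)"
      unfolding s_def by (rule finite_measure_mono) auto
    also have "\<dots> = ?\<omega>" by (simp add: measure_def emeasure_cone_measure_UNIV)
    also have "\<dots> \<le> (2 * r) ^ (?n - 1) * ?\<omega>"
    proof -
      have "1 \<le> (2 * r) ^ (?n - 1)" using False by (intro one_le_power) auto
      then show ?thesis using mult_right_mono[of 1 "(2 * r) ^ (?n - 1)" ?\<omega>] by simp
    qed
    also have "\<dots> = 2 ^ (?n - 1) * ?\<omega> * r ^ (?n - 1)" by (simp add: power_mult_distrib)
    also have "\<dots> \<le> 2 ^ ?n * ?\<omega> * r ^ (?n - 1)"
      using r by (intro mult_right_mono power_increasing) auto
    finally show ?thesis by (simp add: s_def)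
  next
    case True
    let ?B = "\<lambda>t. {y\<in>ball 0 t. sgn y \<in> cball x r}"
    have [measurable]: "cball x r \<in> sets borel" "ball (0::'a) t \<in> sets borel" for t by auto
    have m[measurable]: "?B t \<in> sets borel" for t by measurable
    have B: "emeasure lborel (?B t) = ennreal (t ^ ?n * s)" if "0 < t" for t
      using that by (subst emeasure_cone_sector) (auto simp: s_def emeasure_eq_measure ennreal_mult)
    have "?B 1 \<subseteq> ?B (1 - r) \<union> cball x (2 * r)"
    proof
      fix y assume y: "y \<in> ?B 1"
      show "y \<in> ?B (1 - r) \<union> cball x (2 * r)"
      proof (cases "norm y < 1 - r")
        case False
        then have y0: "y \<noteq> 0" using True by auto
        have "y - sgn y = (norm y - 1) *\<^sub>R sgn y" using y0 by (simp add: sgn_div_norm algebra_simps)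
        then have "dist y (sgn y) = \<bar>norm y - 1\<bar>" using y0 by (simp add: dist_norm norm_sgn)
        then have "dist y (sgn y) \<le> r" using False y by auto
        moreover have "dist x (sgn y) \<le> r" using y by simp
        ultimately have "dist x y \<le> 2 * r" using dist_triangle[of x y "sgn y"] by (simp add: dist_commute)
        then show ?thesis by simp
      qed (use y in auto)
    qed
    then have "emeasure lborel (?B 1) \<le> emeasure lborel (?B (1 - r) \<union> cball x (2 * r))"
      by (intro emeasure_mono) auto
    also have "\<dots> \<le> emeasure lborel (?B (1 - r)) + emeasure lborel (cball x (2 * r))"
      by (intro emeasure_subadditive) auto
    finally have "ennreal s \<le> ennreal ((1 - r) ^ ?n * s) + ennreal (?\<omega> * (2 * r) ^ ?n)"
      using B[of 1] B[of "1 - r"] True r by (simp add: emeasure_cball)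
    then have "ennreal s \<le> ennreal ((1 - r) ^ ?n * s + ?\<omega> * (2 * r) ^ ?n)"
      using True r by (subst ennreal_plus) (auto simp: s_def)
    moreover have "0 \<le> (1 - r) ^ ?n * s + ?\<omega> * (2 * r) ^ ?n"
      using True r by (auto simp: s_def intro!: add_nonneg_nonneg mult_nonneg_nonneg)
    ultimately have le: "s \<le> (1 - r) ^ ?n * s + ?\<omega> * (2 * r) ^ ?n"
      by (simp only: ennreal_le_iff)
    \<comment> \<open>Weakening \<open>(1 - r) ^ n\<close> to \<open>1 - r\<close> leaves
      \<open>r * s\<close> on the left; dividing by \<open>r\<close> produces the exponent n -
      1.\<close>
    have "(1 - r) ^ ?n \<le> (1 - r) ^ 1"
      using True r by (intro power_decreasing) (auto simp: Suc_le_eq)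
    then have "(1 - r) ^ ?n * s \<le> (1 - r) * s" by (intro mult_right_mono) (auto simp: s_def)
    with le have "r * s \<le> ?\<omega> * (2 * r) ^ ?n" by (simp add: algebra_simps)
    also have "\<dots> = r * (2 ^ ?n * ?\<omega> * r ^ (?n - 1))"
      by (subst (2) n, subst power_mult_distrib) (simp add: power_Suc[symmetric] mult.assoc mult.left_commute)
    finally show ?thesis using r by (simp add: s_def)
  qed
qed

text \<open>Mass distribution principle: a covering set that meets the sphere lies in a cap whose
  radius is its diameter, and the cone measure of the cap is at most \<open>K\<close> times the cost
  of the set. Summing, every cover costs at least the total cone measure divided by
  \<open>K\<close>.\<close>

lemma hausdorff_sphere_pos:
  assumes dim: "DIM('a::euclidean_space) \<ge> 2"
  shows "0 < hausdorff_outer (DIM('a) - 1) (sphere (0::'a) 1)"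
proof -
  let ?n = "DIM('a)" and ?\<omega> = "unit_ball_vol (real DIM('a))"
  interpret finite_measure "cone_measure :: 'a measure" by (rule finite_measure_cone_measure)
  define v where "v = unit_ball_vol (real (DIM('a) - 1))"
  define K where "K = 2 ^ ?n * ?\<omega> * 2 ^ (?n - 1) / v"
  have v: "0 < v" by (simp add: v_def)
  have K: "0 < K" using v by (simp add: K_def)
  have cap: "emeasure cone_measure (cball x r) \<le> ennreal K * ennreal (v * (r / 2) ^ (?n - 1))"
    if x: "norm x = 1" and r: "0 \<le> r" for x :: 'a and r
  proof -
    let ?f = "\<lambda>r. 2 ^ ?n * ?\<omega> * r ^ (?n - 1)"
    have "measure cone_measure (cball x r) \<le> ?f r"
    \<comment> \<open>Covering sets may be single points of diameter 0, which the cap estimate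
      excludes; they are reached from caps of radius \<open>e\<close> as \<open>e\<close> tends to
      0.\<close>
    proof (cases "r = 0")
      case True
      have "measure cone_measure (cball x r) \<le> ?f e" if "0 < e" for e
        using cone_measure_cball_le[OF x that] True that
        by (intro order_trans[OF finite_measure_mono[of "cball x r" "cball x e"]]) auto
      then have "eventually (\<lambda>e. measure cone_measure (cball x r) \<le> ?f e) (at_right 0)"
        by (auto simp: eventually_at_filter)
      moreover have "(?f \<longlongrightarrow> ?f 0) (at_right 0)" by (intro tendsto_intros)
      ultimately have "measure cone_measure (cball x r) \<le> ?f 0"
        by (intro tendsto_lowerbound[where F="at_right (0::real)"]) auto
      then show ?thesis using True by simp
    qed (use cone_measure_cball_le[OF x, of r] r in auto)
    also have "?f r = K * (v * (r / 2) ^ (?n - 1))"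
      using v by (simp add: K_def power_divide)
    finally show ?thesis using r K v
      by (simp add: emeasure_eq_measure ennreal_mult[symmetric] ennreal_leI)
  qed
  have "ennreal ?\<omega> \<le> ennreal K * (\<Sum>i. hausdorff_cost (?n - 1) (C i))"
    if C: "hausdorff_cover 1 (sphere (0::'a) 1) C" for C
  proof -
    let ?S = "sphere (0::'a) 1"
    define x where "x i = (SOME x. x \<in> C i \<inter> ?S)" for i
    have x: "x i \<in> C i \<inter> ?S" if "C i \<inter> ?S \<noteq> {}" for i
      unfolding x_def using that by (metis ex_in_conv someI_ex)
    define D where "D i = (if C i \<inter> ?S = {} then {} else cball (x i) (diameter (C i)))" for i
    have bd: "bounded (C i)" for i using C by (auto simp: hausdorff_cover_def)
    have "?S \<subseteq> (\<Union>i. D i)"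
    proof
      fix y assume y: "y \<in> ?S"
      then obtain i where i: "y \<in> C i" using C by (auto simp: hausdorff_cover_def)
      then have ne: "C i \<inter> ?S \<noteq> {}" using y by auto
      then have "dist (x i) y \<le> diameter (C i)"
        using x[OF ne] i bd by (intro diameter_bounded_bound) auto
      then have "y \<in> D i" using ne by (simp add: D_def)
      then show "y \<in> (\<Union>i. D i)" by blast
    qed
    have "ennreal ?\<omega> = emeasure cone_measure ?S"
    proof -
      have "emeasure cone_measure (space (cone_measure :: 'a measure)) = emeasure cone_measure ?S"
        using AE_cone_measure_sphere[where 'a='a] by (intro emeasure_eq_AE) auto
      then show ?thesis by (simp add: emeasure_cone_measure_UNIV)
    qed
    also have "\<dots> \<le> emeasure cone_measure (\<Union>i. D i)"
      using \<open>?S \<subseteq> (\<Union>i. D i)\<close> by (intro emeasure_mono) (auto simp: D_def)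
    also have "\<dots> \<le> (\<Sum>i. emeasure cone_measure (D i))"
      by (intro emeasure_subadditive_countably) (auto simp: D_def)
    also have "\<dots> \<le> (\<Sum>i. ennreal K * hausdorff_cost (?n - 1) (C i))"
    proof (intro suminf_le allI)
      fix i
      show "emeasure cone_measure (D i) \<le> ennreal K * hausdorff_cost (?n - 1) (C i)"
        using x[of i] cap[of "x i" "diameter (C i)"] diameter_ge_0[OF bd]
        by (auto simp: D_def hausdorff_cost_def v_def)
    qed auto
    also have "\<dots> = ennreal K * (\<Sum>i. hausdorff_cost (?n - 1) (C i))" by simp
    finally show ?thesis .
  qed
  then have "ennreal ?\<omega> / ennreal K \<le> hausdorff_pre (?n - 1) 1 (sphere (0::'a) 1)"
    unfolding hausdorff_pre_def using K
    by (auto intro!: INF_greatest simp: divide_le_posI_ennreal)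
  also have "\<dots> \<le> hausdorff_outer (?n - 1) (sphere (0::'a) 1)"
    by (intro hausdorff_pre_le_outer) auto
  finally show ?thesis
    using K less_le_trans[of 0 "ennreal ?\<omega> / ennreal K"] by (simp add: divide_ennreal)
qed

lemma power_diff_le:
  fixes a b :: real
  assumes "0 \<le> b" "b \<le> a" "a \<le> M"
  shows "a ^ n - b ^ n \<le> real n * M ^ (n - 1) * (a - b)"
proof (induction n)
  case (Suc n)
  have "a ^ Suc n - b ^ Suc n = a * (a ^ n - b ^ n) + (a - b) * b ^ n" by (simp add: algebra_simps)
  also have "\<dots> \<le> M * (real n * M ^ (n - 1) * (a - b)) + (a - b) * M ^ n"
    using assms Suc by (intro add_mono mult_mono power_mono) (auto intro!: power_mono)
  also have "\<dots> = real (Suc n) * M ^ (Suc n - 1) * (a - b)"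
    by (cases n) (auto simp: algebra_simps)
  finally show ?case .
qed simp

text \<open>Volume packing: the balls of radius \<open>t/2\<close> around the points are disjoint and lie in a shell
  of thickness \<open>t\<close>.\<close>

lemma card_separated_sphere_le:
  fixes X :: "'a::euclidean_space set"
  assumes fin: "finite X" and X: "X \<subseteq> sphere 0 1" and t: "0 < t" "t \<le> 1"
    and sep: "\<And>x y. x \<in> X \<Longrightarrow> y \<in> X \<Longrightarrow> x \<noteq> y \<Longrightarrow> t \<le> dist x y"
  shows "real (card X) * t ^ (DIM('a) - 1) \<le> real DIM('a) * 4 ^ DIM('a)"
proof -
  let ?n = "DIM('a)" and ?\<omega> = "unit_ball_vol (real DIM('a))"
  have \<omega>: "0 < ?\<omega>" by simp
  let ?U = "\<Union>x\<in>X. ball x (t/2)"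
  have "measure lebesgue ?U = (\<Sum>x\<in>X. measure lebesgue (ball x (t/2)))"
  proof (rule measure_UNION'[OF fin])
    show "pairwise (\<lambda>x y. disjnt (ball x (t/2)) (ball y (t/2))) X"
    proof (intro pairwiseI)
      fix x y assume "x \<in> X" "y \<in> X" "x \<noteq> y"
      then have "t \<le> dist x y" by (rule sep)
      then show "disjnt (ball x (t/2)) (ball y (t/2))"
        unfolding disjnt_def by (intro disjoint_ballI) auto
    qed
  qed auto
  also have "\<dots> = real (card X) * (?\<omega> * (t/2) ^ ?n)" using t by (simp add: content_ball)
  finally have U: "measure lebesgue ?U = real (card X) * (?\<omega> * (t/2) ^ ?n)" .
  have near: "\<bar>norm y - 1\<bar> < t/2" if y: "y \<in> ?U" for y
  proof -
    obtain x where "x \<in> X" "dist x y < t/2" using y unfolding UN_iff mem_ball by blast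
    moreover have "norm x = 1" using \<open>x \<in> X\<close> X by auto
    ultimately show ?thesis using norm_triangle_ineq3[of y x] by (simp add: dist_norm norm_minus_commute)
  qed
  have "?U \<inter> ball 0 (1 - t/2) = {}"
  proof -
    have "y \<notin> ball 0 (1 - t/2)" if "y \<in> ?U" for y
      using near[OF that] unfolding mem_ball dist_0_norm by linarith
    then show ?thesis by blast
  qed
  moreover have "?U \<in> lmeasurable" using fin by (intro fmeasurable.finite_UN) auto
  ultimately have "measure lebesgue ?U + measure lebesgue (ball (0::'a) (1 - t/2))
      = measure lebesgue (?U \<union> ball 0 (1 - t/2))"
    by (subst measure_Un3) auto
  also have "\<dots> \<le> measure lebesgue (ball (0::'a) (1 + t/2))"
  proof (rule measure_mono_fmeasurable)
    show "?U \<union> ball 0 (1 - t/2) \<subseteq> ball 0 (1 + t/2)"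
    proof
      fix y assume "y \<in> ?U \<union> ball 0 (1 - t/2)"
      then have "\<bar>norm y - 1\<bar> < t/2 \<or> norm y < 1 - t/2"
        using near[of y] unfolding Un_iff mem_ball dist_0_norm by argo
      then show "y \<in> ball 0 (1 + t/2)"
        using t unfolding mem_ball dist_0_norm by linarith
    qed
    have "open (?U \<union> ball 0 (1 - t/2))" by (intro open_Un open_UN ballI open_ball)
    then show "?U \<union> ball 0 (1 - t/2) \<in> sets lebesgue" by (intro sets_completionI_sets) simp
  qed auto
  finally have "real (card X) * (?\<omega> * (t/2) ^ ?n) + ?\<omega> * (1 - t/2) ^ ?n \<le> ?\<omega> * (1 + t/2) ^ ?n"
    using t unfolding U by (simp add: content_ball)
  then have "?\<omega> * (real (card X) * (t/2) ^ ?n) \<le> ?\<omega> * ((1 + t/2) ^ ?n - (1 - t/2) ^ ?n)"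
    by (simp add: algebra_simps)
  then have "real (card X) * (t/2) ^ ?n \<le> (1 + t/2) ^ ?n - (1 - t/2) ^ ?n"
    using \<omega> by (simp only: mult_le_cancel_left_pos)
  also have "\<dots> \<le> real ?n * 2 ^ (?n - 1) * ((1 + t/2) - (1 - t/2))"
    using t by (intro power_diff_le) auto
  also have "\<dots> \<le> real ?n * 2 ^ ?n * t"
    using t by (simp add: mult_right_mono mult_left_mono power_increasing)
  finally have "real (card X) * t ^ ?n \<le> real ?n * 2 ^ ?n * t * 2 ^ ?n"
    by (simp add: power_divide field_simps)
  moreover have "real ?n * 2 ^ ?n * t * 2 ^ ?n = t * (real ?n * 4 ^ ?n)"
    using power_mult_distrib[of "2::real" 2 ?n] by simp
  moreover have "real (card X) * t ^ ?n = t * (real (card X) * t ^ (?n - 1))"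
    using power_Suc[of t "?n - 1"] by simp
  ultimately show ?thesis using t(1) by (simp only: mult_le_cancel_left_pos)
qed

text \<open>A maximal \<open>t\<close>-separated subset of the sphere is a \<open>t\<close>-net. By
  volume packing it has O(t^(1-n)) points, and each ball of radius \<open>t\<close> costs a multiple
  of t^(n-1), so the cost of the cover stays bounded as the mesh shrinks.\<close>

lemma hausdorff_sphere_finite:
  assumes dim: "DIM('a::euclidean_space) \<ge> 2"
  shows "hausdorff_outer (DIM('a) - 1) (sphere (0::'a) 1) < \<infinity>"
proof -
  let ?n = "DIM('a)" and ?S = "sphere (0::'a) 1" and ?v = "unit_ball_vol (real (DIM('a) - 1))"
  define B where "B = real ?n * 4 ^ ?n"
  have "hausdorff_pre (?n - 1) \<delta> ?S \<le> ennreal (?v * B)" if \<delta>: "0 < \<delta>" for \<delta>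
  proof -
    \<comment> \<open>Balls of radius \<open>t\<close> have diameter at most \<delta>, and the
      packing bound is available for \<open>t \<le> 1\<close>.\<close>
    define t where "t = min 1 (\<delta> / 2)"
    have t: "0 < t" "t \<le> 1" "2 * t \<le> \<delta>" using \<delta> by (auto simp: t_def)
    define P where "P X \<longleftrightarrow> finite X \<and> X \<subseteq> ?S \<and> (\<forall>x\<in>X. \<forall>y\<in>X. x \<noteq> y \<longrightarrow> t \<le> dist x y)" for X
    have PB: "real (card X) * t ^ (?n - 1) \<le> B" if "P X" for X
      unfolding B_def using that t by (intro card_separated_sphere_le) (auto simp: P_def)
    have "\<exists>X. P X \<and> (\<forall>Y. P Y \<longrightarrow> card Y \<le> card X)"
    proof (rule ex_has_greatest_nat[of P "{}" card "Suc (nat \<lceil>B / t ^ (?n - 1)\<rceil>)"])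
      show "P {}" by (simp add: P_def)
      show "\<forall>Y. P Y \<longrightarrow> card Y < Suc (nat \<lceil>B / t ^ (?n - 1)\<rceil>)"
      proof (intro allI impI)
        fix Y assume "P Y"
        from PB[OF this] have "real (card Y) \<le> B / t ^ (?n - 1)" using t by (simp add: field_simps)
        then show "card Y < Suc (nat \<lceil>B / t ^ (?n - 1)\<rceil>)" by linarith
      qed
    qed
    then obtain X where X: "P X" "\<And>Y. P Y \<Longrightarrow> card Y \<le> card X" by blast
    have cov: "\<exists>x\<in>X. dist x y < t" if y: "y \<in> ?S" for y
    proof (rule ccontr)
      assume far: "\<not> ?thesis"
      then have "y \<notin> X" using t by auto
      have "P (insert y X)" using X(1) y far unfolding P_def by (auto simp: not_less dist_commute)
      from X(2)[OF this] \<open>y \<notin> X\<close> X(1) show False by (simp add: P_def)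
    qed
    obtain xs where xs: "bij_betw xs {..<card X} X"
      using X(1) ex_bij_betw_nat_finite[of X] by (auto simp: P_def atLeast0LessThan)
    define C where "C i = (if i < card X then ball (xs i) t else {})" for i
    have "hausdorff_cover \<delta> ?S C"
      unfolding hausdorff_cover_def
    proof (intro conjI allI subsetI)
      fix y assume "y \<in> ?S"
      then obtain x where "x \<in> X" "dist x y < t" using cov by blast
      moreover then obtain i where "i < card X" "x = xs i"
        using xs unfolding bij_betw_def by (metis imageE lessThan_iff)
      ultimately have "y \<in> C i" by (simp add: C_def)
      then show "y \<in> (\<Union>i. C i)" by blast
    qed (use t \<delta> in \<open>auto simp: C_def\<close>)
    then have "hausdorff_pre (?n - 1) \<delta> ?S \<le> (\<Sum>i. hausdorff_cost (?n - 1) (C i))"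
      by (rule hausdorff_pre_le)
    also have "\<dots> = (\<Sum>i<card X. hausdorff_cost (?n - 1) (C i))"
      using dim by (intro suminf_finite) (auto simp: C_def hausdorff_cost_empty)
    also have "\<dots> = (\<Sum>i<card X. ennreal (?v * t ^ (?n - 1)))"
      using t by (intro sum.cong) (auto simp: C_def hausdorff_cost_def)
    also have "\<dots> = ennreal (real (card X) * (?v * t ^ (?n - 1)))"
      using t by (simp add: ennreal_mult ennreal_of_nat_eq_real_of_nat)
    also have "\<dots> \<le> ennreal (?v * B)"
      using mult_left_mono[OF PB[OF X(1)], of ?v] by (intro ennreal_leI) (simp add: mult_ac)
    finally show ?thesis .
  qed
  then have "hausdorff_outer (?n - 1) ?S \<le> ennreal (?v * B)"
    unfolding hausdorff_outer_eq by (intro SUP_least) auto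
  then show ?thesis by (rule le_less_trans) simp
qed

text \<open>Reflections preserve both measures, so both are uniformly distributed on the sphere. The
  ratio \<open>C\<close> of the total masses relates their ball masses at every radius, and
  uniqueness applies to the Hausdorff measure and the rescaled cone measure. \<open>C\<close> is
  positive and finite by the two preceding estimates.\<close>

theorem hausdorff_sphere_eq_cone_measure:
  assumes dim: "DIM('a::euclidean_space) \<ge> 2"
  obtains C where "0 < C"
    "\<And>A. A \<in> sets borel \<Longrightarrow>
      emeasure (hausdorff_measure (DIM('a) - 1)) (A \<inter> sphere (0::'a) 1) = ennreal C * emeasure cone_measure A"
proof -
  let ?d = "DIM('a) - 1" and ?S = "sphere (0::'a) 1"
  have d: "?d \<noteq> 0" using dim by simp
  \<comment> \<open>The restriction to the sphere is written as a density, because the uniqueness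
    theorem speaks of Borel measures on the whole space.\<close>
  define M where "M = density (hausdorff_measure ?d) (indicator ?S)"
  have sM: "sets M = sets borel" by (simp add: M_def)
  have M: "emeasure M A = hausdorff_outer ?d (A \<inter> ?S)" if "A \<in> sets borel" for A
  proof -
    have [measurable]: "?S \<in> sets (hausdorff_measure ?d)" "A \<in> sets (hausdorff_measure ?d)"
      using that by simp_all
    have "emeasure M A = emeasure (hausdorff_measure ?d) (A \<inter> ?S)"
      unfolding M_def by (subst emeasure_density)
        (auto simp: indicator_inter_arith[symmetric] Int_commute that)
    then show ?thesis using that d by (simp add: emeasure_hausdorff_measure)
  qed
  have finM: "finite_measure M"
    using hausdorff_sphere_finite[OF dim] sets_eq_imp_space_eq[OF sM]
    by (intro finite_measureI) (auto simp: M)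
  interpret M: finite_measure M by (rule finM)
  interpret N: finite_measure "cone_measure :: 'a measure" by (rule finite_measure_cone_measure)
  have aeM: "AE x in M. x \<in> ?S"
    by (rule AE_I[where N="- ?S"]) (use hausdorff_outer_empty[OF d] in \<open>auto simp: M sM\<close>)
  have ball: "emeasure M (ball x r) = emeasure M (ball y r)" if "x \<in> ?S" "y \<in> ?S" for x y r
  proof -
    have "norm x = norm y" using that by simp
    then obtain T where T: "linear T" "\<And>u v. dist (T u) (T v) = dist u v" "surj T" "T x = y"
      by (rule exists_linear_isometry) blast
    have nT: "norm (T v) = norm v" for v
      using T(2)[of v 0] linear_0[OF T(1)] by simp
    have "T ` (ball x r \<inter> ?S) = ball y r \<inter> ?S"
    proof (intro set_eqI iffI)
      fix z assume z: "z \<in> ball y r \<inter> ?S"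
      obtain u where u: "z = T u" using T(3) by (metis surjD)
      then show "z \<in> T ` (ball x r \<inter> ?S)" using z T(2)[of x u] T(4) nT[of u] by auto
    next
      fix z assume "z \<in> T ` (ball x r \<inter> ?S)"
      then obtain u where "z = T u" "u \<in> ball x r" "u \<in> ?S" by auto
      then show "z \<in> ball y r \<inter> ?S" using T(2)[of x u] T(4) nT[of u] by auto
    qed
    then show ?thesis
      using hausdorff_outer_isometry[OF T(2,3), of ?d "ball x r \<inter> ?S"] by (simp add: M)
  qed
  obtain x0 :: 'a where x0: "norm x0 = 1" using vector_choose_size[of 1] by auto
  define C where "C = measure M UNIV / measure cone_measure (UNIV :: 'a set)"
  have N0: "0 < measure cone_measure (UNIV :: 'a set)"
    by (simp add: measure_def emeasure_cone_measure_UNIV)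
  have M0: "0 < measure M UNIV"
    using hausdorff_sphere_pos[OF dim] M.emeasure_eq_measure[of UNIV] by (simp add: M)
  have C: "0 < C" unfolding C_def using N0 M0 by simp
  let ?N = "scale_measure (ennreal C) (cone_measure :: 'a measure)"
  have "M = ?N"
  proof (rule uniform_measure_eq[where S="?S" and h="\<lambda>r. emeasure M (ball x0 r)"])
    show N: "emeasure ?N (ball x r) = emeasure M (ball x0 r)" if x: "x \<in> ?S" for x r
    proof -
      have "emeasure M (ball x0 r) * emeasure cone_measure (UNIV :: 'a set)
          = emeasure cone_measure (ball x0 r) * emeasure M UNIV"
      proof (rule uniform_measure_proportional[where S="?S" and r=r])
        fix y assume "y \<in> ?S"
        then show "emeasure M (ball y r) = emeasure M (ball x0 r)"
            "emeasure cone_measure (ball y r) = emeasure cone_measure (ball x0 r)"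
          using x0 by (auto intro: ball cone_measure_ball_cong)
      qed (fact aeM sM AE_cone_measure_sphere sets_cone_measure
          M.sigma_finite_measure_axioms N.sigma_finite_measure_axioms)+
      then have "measure M (ball x0 r) * measure cone_measure (UNIV :: 'a set)
          = measure cone_measure (ball x0 r) * measure M UNIV"
        by (simp add: M.emeasure_eq_measure N.emeasure_eq_measure ennreal_mult[symmetric])
      then have "measure M (ball x0 r) = C * measure cone_measure (ball x0 r)"
        using N0 by (simp add: C_def field_simps)
      moreover have "emeasure cone_measure (ball x r) = emeasure cone_measure (ball x0 r)"
        using x x0 by (intro cone_measure_ball_cong) auto
      ultimately show ?thesis
        using C by (simp add: M.emeasure_eq_measure N.emeasure_eq_measure ennreal_mult)
    qed
    fix r :: real assume r: "0 < r"
    have "emeasure M (ball x0 r) = ennreal C * emeasure cone_measure (ball x0 r)"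
      using N[of x0 r] x0 by simp
    then show "0 < emeasure M (ball x0 r) \<and> emeasure M (ball x0 r) < \<infinity>"
      using cone_measure_ball_pos[OF x0 r] C M.emeasure_finite[of "ball x0 r"]
      by (auto simp: ennreal_zero_less_mult_iff less_top)
  next
    show "sigma_finite_measure ?N"
    proof -
      have "finite_measure ?N"
        by (intro finite_measureI) (simp add: emeasure_cone_measure_UNIV ennreal_mult_eq_top_iff)
      then show ?thesis by (simp add: finite_measure_def)
    qed
    show "AE x in ?N. x \<in> ?S"
      using AE_cone_measure_sphere[where 'a='a] C
      by (auto simp: eventually_ae_filter null_sets_def)
    show "emeasure M (ball 0 r) < \<infinity>" for r
      using M.emeasure_finite[of "ball 0 r"] unfolding less_top[symmetric] infinity_ennreal_def .
    show "emeasure M (ball x r) = emeasure M (ball x0 r)" if "x \<in> ?S" for x r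
      by (rule ball[OF that]) (simp add: x0)
    show "sets ?N = sets borel" by simp
  qed (fact sM aeM M.sigma_finite_measure_axioms)+
  then have "emeasure (hausdorff_measure ?d) (A \<inter> ?S) = ennreal C * emeasure cone_measure A"
    if "A \<in> sets borel" for A
    using M[OF that] that d by (simp add: emeasure_hausdorff_measure)
  with C show thesis by (rule that)
qed

section \<open>The divergence theorem on unit balls\<close>

text \<open>A working form of \<open>C_k 1\<close> with the gradient field explicit, so that sums
  and products compute their gradients; \<open>has_grad_C_1\<close> and \<open>C_1_has_grad\<close>
  translate between the two.\<close>

definition has_grad :: "('a::euclidean_space \<Rightarrow> real) \<Rightarrow> ('a \<Rightarrow> 'a) \<Rightarrow> bool" where
  "has_grad \<phi> G \<longleftrightarrow> (\<forall>x. (\<phi> has_derivative (\<lambda>h. G x \<bullet> h)) (at x)) \<and> continuous_on UNIV G"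

lemma has_gradD:
  assumes "has_grad \<phi> G"
  shows "(\<phi> has_derivative (\<lambda>h. G x \<bullet> h)) (at x)" "continuous_on S G" "continuous_on S \<phi>"
proof -
  show "(\<phi> has_derivative (\<lambda>h. G x \<bullet> h)) (at x)" for x using assms by (simp add: has_grad_def)
  then show "continuous_on S \<phi>"
    by (meson continuous_at_imp_continuous_on has_derivative_continuous)
  show "continuous_on S G" using assms continuous_on_subset by (auto simp: has_grad_def)
qed

lemma has_grad_frechet:
  assumes "has_grad \<phi> G"
  shows "frechet_derivative \<phi> (at x) = (\<lambda>h. G x \<bullet> h)"
  using has_gradD(1)[OF assms] by (rule frechet_derivative_at[symmetric])

lemma has_grad_grad:
  assumes "has_grad \<phi> G"
  shows "grad \<phi> = G"
  unfolding grad_def has_grad_frechet[OF assms] by (simp add: euclidean_representation fun_eq_iff)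

lemma has_grad_C_1:
  assumes "has_grad \<phi> G"
  shows "C_k 1 \<phi>"
  using assms has_gradD[OF assms] has_grad_frechet[OF assms]
  by (auto simp: differentiable_def intro!: continuous_intros)

lemma C_1_has_grad:
  assumes "C_k 1 \<phi>"
  shows "has_grad \<phi> (grad \<phi>)"
proof -
  have d: "\<phi> differentiable (at x)" for x using assms by simp
  have c: "continuous_on UNIV (\<lambda>x. frechet_derivative \<phi> (at x) b)" if "b \<in> Basis" for b
    using assms that by simp
  have "frechet_derivative \<phi> (at x) = (\<lambda>h. grad \<phi> x \<bullet> h)" for x
  proof
    fix h
    have lin: "linear (frechet_derivative \<phi> (at x))" by (rule linear_frechet_derivative[OF d])
    have "frechet_derivative \<phi> (at x) h = frechet_derivative \<phi> (at x) (\<Sum>b\<in>Basis. (h \<bullet> b) *\<^sub>R b)"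
      by (simp add: euclidean_representation)
    also have "\<dots> = (\<Sum>b\<in>Basis. (h \<bullet> b) * frechet_derivative \<phi> (at x) b)"
      by (simp add: linear_sum[OF lin] linear_scale[OF lin])
    also have "\<dots> = grad \<phi> x \<bullet> h"
      unfolding grad_def inner_sum_left by (intro sum.cong) (auto simp: inner_commute)
    finally show "frechet_derivative \<phi> (at x) h = grad \<phi> x \<bullet> h" .
  qed
  then have "(\<phi> has_derivative (\<lambda>h. grad \<phi> x \<bullet> h)) (at x)" for x
    using d[of x] frechet_derivative_works by metis
  moreover have "continuous_on UNIV (grad \<phi>)"
    unfolding grad_def using c by (intro continuous_intros) auto
  ultimately show ?thesis by (simp add: has_grad_def)
qed

lemma has_grad_cong:
  assumes "has_grad \<phi> G" "\<And>x. \<phi> x = \<psi> x" "\<And>x. G x = H x" shows "has_grad \<psi> H"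
proof -
  have "\<phi> = \<psi>" "G = H" using assms(2,3) by auto
  then show ?thesis using assms(1) by simp
qed

lemma has_grad_add:
  assumes "has_grad \<phi> G" "has_grad \<psi> H"
  shows "has_grad (\<lambda>x. \<phi> x + \<psi> x) (\<lambda>x. G x + H x)"
  unfolding has_grad_def
proof (intro conjI allI)
  fix x show "((\<lambda>x. \<phi> x + \<psi> x) has_derivative (\<lambda>h. (G x + H x) \<bullet> h)) (at x)"
    by (rule has_derivative_eq_rhs[OF has_derivative_add[OF has_gradD(1)[OF assms(1)] has_gradD(1)[OF assms(2)]]])
      (auto simp: inner_add_left)
qed (intro continuous_intros has_gradD(2)[OF assms(1)] has_gradD(2)[OF assms(2)])

lemma has_grad_mult:
  assumes "has_grad \<phi> G" "has_grad \<psi> H"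
  shows "has_grad (\<lambda>x. \<phi> x * \<psi> x) (\<lambda>x. \<phi> x *\<^sub>R H x + \<psi> x *\<^sub>R G x)"
  unfolding has_grad_def
proof (intro conjI allI)
  fix x show "((\<lambda>x. \<phi> x * \<psi> x) has_derivative (\<lambda>h. (\<phi> x *\<^sub>R H x + \<psi> x *\<^sub>R G x) \<bullet> h)) (at x)"
    by (rule has_derivative_eq_rhs[OF has_derivative_mult[OF has_gradD(1)[OF assms(1)] has_gradD(1)[OF assms(2)]]])
      (auto simp: inner_add_left)
qed (intro continuous_intros has_gradD(2,3)[OF assms(1)] has_gradD(2,3)[OF assms(2)])

lemma has_grad_const: "has_grad (\<lambda>x. c) (\<lambda>x. 0)"
  by (auto simp: has_grad_def)

lemma has_grad_inner: "has_grad (\<lambda>x. (x - a) \<bullet> v) (\<lambda>x. v)"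
proof -
  have "((\<lambda>x. (x - a) \<bullet> v) has_derivative (\<lambda>h. v \<bullet> h)) (at x)" for x
    by (auto intro!: derivative_eq_intros simp: inner_commute)
  then show ?thesis by (simp add: has_grad_def)
qed

lemma has_grad_cmult:
  assumes "has_grad \<phi> G" shows "has_grad (\<lambda>x. c * \<phi> x) (\<lambda>x. c *\<^sub>R G x)"
  by (rule has_grad_cong[OF has_grad_mult[OF has_grad_const assms]]) auto

lemma has_grad_translate:
  assumes "has_grad \<phi> G" shows "has_grad (\<lambda>x. \<phi> (x - a)) (\<lambda>x. G (x - a))"
  unfolding has_grad_def
proof (intro conjI allI)
  fix x show "((\<lambda>x. \<phi> (x - a)) has_derivative (\<lambda>h. G (x - a) \<bullet> h)) (at x)"
    by (rule has_derivative_compose[of "\<lambda>x. x - a" "\<lambda>h. h" x UNIV, OF _ has_gradD(1)[OF assms]])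
      (auto intro!: derivative_eq_intros)
qed (intro continuous_on_compose2[OF has_gradD(2)[OF assms, of UNIV]] continuous_intros, auto)

lemma continuous_bound_cball:
  fixes f :: "'a::euclidean_space \<Rightarrow> 'b::real_normed_vector"
  assumes "continuous_on UNIV f"
  obtains M where "0 < M" "\<And>x. norm x \<le> r \<Longrightarrow> norm (f x) \<le> M"
proof -
  have "compact (f ` cball 0 r)"
    using assms by (intro compact_continuous_image continuous_on_subset[OF assms]) auto
  then obtain M where "0 < M" "\<forall>y\<in>f ` cball 0 r. norm y \<le> M"
    using compact_imp_bounded bounded_pos by blast
  then show thesis by (intro that[of M]) auto
qed

lemma has_grad_lipschitz:
  assumes "has_grad \<phi> G"
  obtains L where "0 < L" "\<And>x y. norm x \<le> r \<Longrightarrow> norm y \<le> r \<Longrightarrow> \<bar>\<phi> x - \<phi> y\<bar> \<le> L * norm (x - y)"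
proof -
  obtain L where L: "0 < L" "\<And>x. norm x \<le> r \<Longrightarrow> norm (G x) \<le> L"
    using continuous_bound_cball[OF has_gradD(2)[OF assms], of r] by blast
  have "\<bar>\<phi> x - \<phi> y\<bar> \<le> L * norm (x - y)" if "norm x \<le> r" "norm y \<le> r" for x y
  proof -
    have "norm (\<phi> x - \<phi> y) \<le> L * norm (x - y)"
    proof (rule differentiable_bound[where S="cball 0 r" and f'="\<lambda>x h. G x \<bullet> h"])
      show "(\<phi> has_derivative (\<lambda>h. G z \<bullet> h)) (at z within cball 0 r)" for z
        using has_gradD(1)[OF assms] by (rule has_derivative_at_withinI)
      fix z assume "z \<in> cball (0::'a) r"
      then have "norm (G z) \<le> L" using L by simp
      then show "onorm (\<lambda>h. G z \<bullet> h) \<le> L"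
        using L(1) order_trans[OF Cauchy_Schwarz_ineq2 mult_right_mono[of "norm (G z)" L]]
        by (intro onorm_bound) auto
    qed (use that in auto)
    then show ?thesis by simp
  qed
  with L(1) show thesis by (rule that)
qed

section \<open>Integration by parts through translation invariance\<close>

lemma lborel_integral_translate:
  fixes f :: "'a::euclidean_space \<Rightarrow> 'b::{banach, second_countable_topology}"
  assumes [measurable]: "f \<in> borel_measurable borel"
  shows "(LINT x|lborel. f (x + a)) = (LINT x|lborel. f x)"
    "integrable lborel (\<lambda>x. f (x + a)) \<longleftrightarrow> integrable lborel f"
proof -
  have "lborel = distr lborel borel (\<lambda>x::'a. x + a)"
    using lborel_affine[of 1 a] by (simp add: density_1 add.commute)
  moreover have [measurable]: "(\<lambda>x::'a. x + a) \<in> lborel \<rightarrow>\<^sub>M borel" by simp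
  moreover have "(LINT x|distr lborel borel (\<lambda>x. x + a). f x) = (LINT x|lborel. f (x + a))"
      "integrable (distr lborel borel (\<lambda>x. x + a)) f \<longleftrightarrow> integrable lborel (\<lambda>x. f (x + a))"
    by (rule integral_distr integrable_distr_eq; measurable)+
  ultimately show "(LINT x|lborel. f (x + a)) = (LINT x|lborel. f x)"
      "integrable lborel (\<lambda>x. f (x + a)) \<longleftrightarrow> integrable lborel f"
    by simp_all
qed

lemma integrable_bounded_support:
  fixes f :: "'a::euclidean_space \<Rightarrow> 'b::{banach, second_countable_topology}"
  assumes [measurable]: "f \<in> borel_measurable borel" and "\<And>x. norm x > r \<Longrightarrow> f x = 0"
    and "\<And>x. norm x \<le> r \<Longrightarrow> norm (f x) \<le> M"
  shows "integrable lborel f"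
proof (rule Bochner_Integration.integrable_bound)
  show "integrable lborel (\<lambda>x. indicator (cball (0::'a) r) x *\<^sub>R M :: real)"
    using emeasure_bounded_finite[OF bounded_cball, of "0::'a" r] by (intro integrable_indicator) simp_all
  show "AE x in lborel. norm (f x) \<le> norm (indicator (cball (0::'a) r) x *\<^sub>R M :: real)"
  proof (rule AE_I2)
    fix x show "norm (f x) \<le> norm (indicator (cball (0::'a) r) x *\<^sub>R M :: real)"
      using assms(2)[of x] assms(3)[of x] by (cases "norm x \<le> r") (auto simp: indicator_def)
  qed
qed simp

lemma has_derivative_imp_quotient_tendsto:
  fixes f :: "'a::real_normed_vector \<Rightarrow> real"
  assumes f: "(f has_derivative f') (at x)"
  shows "(\<lambda>k. real (Suc k) * (f (x + (1 / real (Suc k)) *\<^sub>R v) - f x)) \<longlonglongrightarrow> f' v"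
proof -
  define t where "t k = 1 / real (Suc k)" for k
  have t: "t \<longlonglongrightarrow> 0" "\<And>k. t k \<noteq> 0"
    unfolding t_def using LIMSEQ_inverse_real_of_nat by (simp_all add: inverse_eq_divide)
  have "((\<lambda>s. f (x + s *\<^sub>R v)) has_derivative (\<lambda>s. f' (s *\<^sub>R v))) (at 0)"
    by (rule has_derivative_compose[of "\<lambda>s. x + s *\<^sub>R v" "\<lambda>s. s *\<^sub>R v" 0 UNIV f])
      (use f in \<open>auto intro!: derivative_eq_intros\<close>)
  moreover have "f' (s *\<^sub>R v) = f' v * s" for s
    using linear_scale[OF has_derivative_linear[OF f], of s v] by simp
  ultimately have "DERIV (\<lambda>s. f (x + s *\<^sub>R v)) 0 :> f' v"
    by (simp add: has_field_derivative_def)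
  then have "((\<lambda>h. (f (x + h *\<^sub>R v) - f x) / h) \<longlongrightarrow> f' v) (at 0)"
    by (simp add: DERIV_def)
  then have "(\<lambda>k. (f (x + t k *\<^sub>R v) - f x) / t k) \<longlonglongrightarrow> f' v"
    by (rule tendsto_at_iff_sequentially[THEN iffD1, rule_format, unfolded comp_def]) (use t in auto)
  then show ?thesis by (simp add: t_def mult.commute)
qed

text \<open>Translation invariance makes the integral of the difference quotients of \<open>\<eta> * \<psi>\<close> vanish.\<close>

lemma integral_lipschitz_by_parts:
  fixes \<eta> D :: "'a::euclidean_space \<Rightarrow> real"
  assumes supp: "\<And>x. norm x > r \<Longrightarrow> \<eta> x = 0" and L: "\<And>x y. \<bar>\<eta> x - \<eta> y\<bar> \<le> L * norm (x - y)"
    and D: "AE x in lborel. (\<lambda>k. real (Suc k) * (\<eta> (x + (1 / real (Suc k)) *\<^sub>R v) - \<eta> x)) \<longlonglongrightarrow> D x"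
    and D_meas[measurable]: "D \<in> borel_measurable borel"
    and \<psi>: "has_grad \<psi> G"
  shows "(LINT x|lborel. \<eta> x * (G x \<bullet> v)) = - (LINT x|lborel. D x * \<psi> x)"
proof -
  have contG: "continuous_on UNIV G" and cont\<psi>: "continuous_on UNIV \<psi>"
    using has_gradD[OF \<psi>] by auto
  have "0 \<le> L"
  proof -
    obtain b :: 'a where "norm b = 1" using vector_choose_size[of 1] by auto
    then show ?thesis using L[of b 0] by simp
  qed
  have "continuous_on UNIV \<eta>"
    by (rule lipschitz_on_continuous_on[where L=L])
      (use L \<open>0 \<le> L\<close> in \<open>auto simp: lipschitz_on_def dist_norm\<close>)
  note cont = contG cont\<psi> this
  have [measurable]: "G \<in> borel_measurable borel" "\<psi> \<in> borel_measurable borel" "\<eta> \<in> borel_measurable borel"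
    using cont by (auto intro: borel_measurable_continuous_onI)
  \<comment> \<open>This radius contains the supports of \<eta> and of all its translates by
    \<open>t *\<^sub>R v\<close> with \<open>0 < t \<le> 1\<close>, so all difference quotients
    vanish outside it.\<close>
  define \<rho> where "\<rho> = \<bar>r\<bar> + norm v"
  define t where "t k = 1 / real (Suc k)" for k
  have t: "0 < t k" "t k \<le> 1" for k by (auto simp: t_def)
  have tS: "real (Suc k) * t k = 1" for k by (simp add: t_def)
  have tlim: "t \<longlonglongrightarrow> 0" unfolding t_def using LIMSEQ_inverse_real_of_nat by (simp add: inverse_eq_divide)
  have tv: "norm (t k *\<^sub>R v) \<le> norm v" for k using t[of k] by (simp add: mult_left_le_one_le)
  obtain M where M: "0 < M" "\<And>x. norm x \<le> \<rho> + norm v \<Longrightarrow> norm (\<psi> x) \<le> M"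
    using continuous_bound_cball[OF cont(2), of "\<rho> + norm v"] by blast
  obtain N where N: "0 < N" "\<And>x. norm x \<le> \<rho> + norm v \<Longrightarrow> norm (\<eta> x) \<le> N"
    using continuous_bound_cball[OF cont(3), of "\<rho> + norm v"] by blast
  obtain K where K: "0 < K" "\<And>x y. norm x \<le> \<rho> + norm v \<Longrightarrow> norm y \<le> \<rho> + norm v \<Longrightarrow>
      \<bar>\<psi> x - \<psi> y\<bar> \<le> K * norm (x - y)"
    using has_grad_lipschitz[OF \<psi>, of "\<rho> + norm v"] by blast
  \<comment> \<open>\<open>A k\<close> and \<open>B k\<close> are the two terms of the discrete
    product rule for the quotient of \<eta>\<psi>: their sum has integral 0, while their limits are
    the two sides of the claim.\<close>
  define A where "A k x = real (Suc k) * (\<eta> (x + t k *\<^sub>R v) - \<eta> x) * \<psi> (x + t k *\<^sub>R v)" for k x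
  define B where "B k x = \<eta> x * (real (Suc k) * (\<psi> (x + t k *\<^sub>R v) - \<psi> x))" for k x
  have [measurable]: "A k \<in> borel_measurable borel" "B k \<in> borel_measurable borel" for k
    unfolding A_def[abs_def] B_def[abs_def] by measurable
  have near: "norm (x + t k *\<^sub>R v) \<le> \<rho> + norm v" if "norm x \<le> \<rho>" for x k
    using norm_triangle_ineq[of x "t k *\<^sub>R v"] tv[of k] that by linarith
  have A0: "A k x = 0" if "norm x > \<rho>" for k x
  proof -
    have "norm x \<le> norm (x + t k *\<^sub>R v) + norm (t k *\<^sub>R v)"
      using norm_triangle_ineq4[of "x + t k *\<^sub>R v" "t k *\<^sub>R v"] by simp
    then have "norm (x + t k *\<^sub>R v) > r" "norm x > r"
      using that tv[of k] norm_ge_zero[of v] unfolding \<rho>_def by linarith+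
    then show ?thesis by (simp add: A_def supp)
  qed
  have B0: "B k x = 0" if "norm x > \<rho>" for k x
    using that supp[of x] norm_ge_zero[of v] abs_ge_self[of r] unfolding B_def \<rho>_def by simp
  have Ab: "norm (A k x) \<le> L * norm v * M" if "norm x \<le> \<rho>" for k x
  proof -
    have "norm (A k x) = real (Suc k) * \<bar>\<eta> (x + t k *\<^sub>R v) - \<eta> x\<bar> * \<bar>\<psi> (x + t k *\<^sub>R v)\<bar>"
      by (simp add: A_def abs_mult)
    also have "\<dots> \<le> real (Suc k) * (L * norm (t k *\<^sub>R v)) * M"
      using L[of "x + t k *\<^sub>R v" x] M near[OF that] \<open>0 \<le> L\<close>
      by (intro mult_mono mult_nonneg_nonneg) auto
    also have "\<dots> = (real (Suc k) * t k) * (L * norm v * M)" using t[of k] by simp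
    finally show ?thesis by (simp only: tS mult_1_left)
  qed
  have Bb: "norm (B k x) \<le> N * (K * norm v)" if "norm x \<le> \<rho>" for k x
  proof -
    have "norm (B k x) = \<bar>\<eta> x\<bar> * (real (Suc k) * \<bar>\<psi> (x + t k *\<^sub>R v) - \<psi> x\<bar>)"
      by (simp add: B_def abs_mult)
    also have "\<dots> \<le> N * (real (Suc k) * (K * norm (t k *\<^sub>R v)))"
      using K(2)[of "x + t k *\<^sub>R v" x] N(1) N(2)[of x] near[OF that, of k] that norm_ge_zero[of v] K(1)
      by (intro mult_mono mult_nonneg_nonneg) auto
    also have "\<dots> = (real (Suc k) * t k) * (N * (K * norm v))" using t[of k] by simp
    finally show ?thesis by (simp only: tS mult_1_left)
  qed
  have intA: "integrable lborel (A k)" and intB: "integrable lborel (B k)" for k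
    by (rule integrable_bounded_support[OF _ A0 Ab] integrable_bounded_support[OF _ B0 Bb]; simp)+
  define w :: "'a \<Rightarrow> real" where "w x = indicator (cball 0 \<rho>) x *\<^sub>R (L * norm v * M + N * (K * norm v))" for x
  have w: "integrable lborel w"
    unfolding w_def[abs_def] using emeasure_bounded_finite[OF bounded_cball, of "0::'a" \<rho>]
    by (intro integrable_indicator) simp_all
  have pos: "0 \<le> L * norm v * M" "0 \<le> N * (K * norm v)" using \<open>0 \<le> L\<close> M N K by auto
  have Aw: "norm (A k x) \<le> w x" and Bw: "norm (B k x) \<le> w x" for k x
    using A0[of x k] B0[of x k] Ab[of x k] Bb[of x k] pos
    by (cases "norm x \<le> \<rho>"; simp add: w_def)+
  have shift: "(\<lambda>k. x + t k *\<^sub>R v) \<longlonglongrightarrow> x" for x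
    using tendsto_add[OF tendsto_const tendsto_scaleR[OF tlim tendsto_const], of x v] by simp
  have limA: "AE x in lborel. (\<lambda>k. A k x) \<longlonglongrightarrow> D x * \<psi> x"
    using D
  proof eventually_elim
    case (elim x)
    have "(\<lambda>k. \<psi> (x + t k *\<^sub>R v)) \<longlonglongrightarrow> \<psi> x"
      using cont(2) shift by (intro continuous_on_tendsto_compose[of UNIV \<psi>]) auto
    from tendsto_mult[OF elim this] show ?case by (simp add: A_def t_def)
  qed
  have limB: "(\<lambda>k. B k x) \<longlonglongrightarrow> \<eta> x * (G x \<bullet> v)" for x
  proof -
    have "(\<lambda>k. real (Suc k) * (\<psi> (x + t k *\<^sub>R v) - \<psi> x)) \<longlonglongrightarrow> G x \<bullet> v"
      unfolding t_def by (rule has_derivative_imp_quotient_tendsto[OF has_gradD(1)[OF \<psi>]])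
    then show ?thesis unfolding B_def by (intro tendsto_intros)
  qed
  have zero: "(LINT x|lborel. A k x) + (LINT x|lborel. B k x) = 0" for k
  proof -
    let ?f = "\<lambda>x. real (Suc k) * (\<eta> x * \<psi> x)"
    have f: "integrable lborel ?f"
    proof (rule integrable_bounded_support[where r=\<rho> and M="real (Suc k) * (N * M)"])
      show "?f x = 0" if "norm x > \<rho>" for x
        using supp[of x] that norm_ge_zero[of v] abs_ge_self[of r] unfolding \<rho>_def by simp
      show "norm (?f x) \<le> real (Suc k) * (N * M)" if "norm x \<le> \<rho>" for x
        using N(1) N(2)[of x] M(2)[of x] that norm_ge_zero[of v] unfolding norm_mult
        by (intro mult_mono) auto
    qed measurable
    have "(LINT x|lborel. A k x) + (LINT x|lborel. B k x) = (LINT x|lborel. A k x + B k x)"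
      by (rule Bochner_Integration.integral_add[OF intA intB, symmetric])
    also have "\<dots> = (LINT x|lborel. ?f (x + t k *\<^sub>R v) - ?f x)"
      by (intro Bochner_Integration.integral_cong) (auto simp: A_def B_def algebra_simps)
    also have "\<dots> = (LINT x|lborel. ?f (x + t k *\<^sub>R v)) - (LINT x|lborel. ?f x)"
      using f lborel_integral_translate(2)[of ?f "t k *\<^sub>R v"]
      by (intro Bochner_Integration.integral_diff) auto
    also have "\<dots> = 0" by (subst lborel_integral_translate(1)[of ?f]) auto
    finally show ?thesis .
  qed
  have "(\<lambda>k. LINT x|lborel. A k x) \<longlonglongrightarrow> (LINT x|lborel. D x * \<psi> x)"
    by (rule integral_dominated_convergence[OF _ _ w limA]) (use Aw in auto)
  moreover have "(\<lambda>k. LINT x|lborel. B k x) \<longlonglongrightarrow> (LINT x|lborel. \<eta> x * (G x \<bullet> v))"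
    by (rule integral_dominated_convergence[OF _ _ w]) (use Bw limB in auto)
  ultimately have "(\<lambda>k. (LINT x|lborel. A k x) + (LINT x|lborel. B k x)) \<longlonglongrightarrow>
      (LINT x|lborel. D x * \<psi> x) + (LINT x|lborel. \<eta> x * (G x \<bullet> v))"
    by (rule tendsto_add)
  then have "(LINT x|lborel. D x * \<psi> x) + (LINT x|lborel. \<eta> x * (G x \<bullet> v)) = 0"
    unfolding zero by (simp add: LIMSEQ_const_iff)
  then show "(LINT x|lborel. \<eta> x * (G x \<bullet> v)) = - (LINT x|lborel. D x * \<psi> x)" by linarith
qed

text \<open>Lipschitz with gradient \<open>- sgn x / e\<close> on the shell
  \<open>1 - e < norm x < 1\<close> and 0 elsewhere off two spheres. Integrating by parts against it
  produces a shell average, which approximates the boundary integral.\<close>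

definition cutoff :: "real \<Rightarrow> 'a::real_normed_vector \<Rightarrow> real" where
  "cutoff e x = max 0 (min 1 ((1 - norm x) / e))"

lemma cutoff_lipschitz:
  fixes x y :: "'a::real_normed_vector"
  assumes "0 < e" shows "\<bar>cutoff e x - cutoff e y\<bar> \<le> 1 / e * norm (x - y)"
proof -
  have "\<bar>cutoff e x - cutoff e y\<bar> \<le> \<bar>(1 - norm x) / e - (1 - norm y) / e\<bar>"
    unfolding cutoff_def by (auto simp: max_def min_def)
  also have "\<dots> = \<bar>norm x - norm y\<bar> / e"
    using assms by (simp add: diff_divide_distrib[symmetric] abs_minus_commute)
  also have "\<dots> \<le> 1 / e * norm (x - y)"
    using assms norm_triangle_ineq3[of x y] by (simp add: divide_right_mono)
  finally show ?thesis .
qed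

lemma cutoff_eq:
  assumes "0 < e"
  shows "norm x \<le> 1 - e \<Longrightarrow> cutoff e x = 1" "1 \<le> norm x \<Longrightarrow> cutoff e x = 0"
    "1 - e \<le> norm x \<Longrightarrow> norm x \<le> 1 \<Longrightarrow> cutoff e x = (1 - norm x) / e"
  using assms by (auto simp: cutoff_def max_def min_def field_simps)

lemma cutoff_quotient_tendsto:
  fixes v x :: "'a::euclidean_space"
  assumes e: "0 < e" "e < 1" and x: "norm x \<noteq> 1" "norm x \<noteq> 1 - e"
  shows "(\<lambda>k. real (Suc k) * (cutoff e (x + (1 / real (Suc k)) *\<^sub>R v) - cutoff e x))
    \<longlonglongrightarrow> - (1 / e) * (indicator (ball 0 1 - ball 0 (1 - e)) x * (sgn x \<bullet> v))"
proof -
  consider "norm x < 1 - e" | "1 - e < norm x" "norm x < 1" | "1 < norm x" using x by linarith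
  then show ?thesis
  proof cases
    case 1
    have "((\<lambda>x. 1) has_derivative (\<lambda>h. 0)) (at x)" by simp
    then have "(cutoff e has_derivative (\<lambda>h. 0)) (at x)"
      by (rule has_derivative_transform_within_open[of _ _ _ _ "ball 0 (1 - e)"])
        (use 1 in \<open>auto simp: cutoff_eq(1)[OF e(1)]\<close>)
    from has_derivative_imp_quotient_tendsto[OF this, of v] show ?thesis using 1 by simp
  next
    case 3
    have "((\<lambda>x. 0) has_derivative (\<lambda>h. 0)) (at x)" by simp
    then have "(cutoff e has_derivative (\<lambda>h. 0)) (at x)"
      by (rule has_derivative_transform_within_open[of _ _ _ _ "- cball 0 1"])
        (use 3 in \<open>auto simp: cutoff_eq(2)[OF e(1)]\<close>)
    from has_derivative_imp_quotient_tendsto[OF this, of v] show ?thesis using 3 by simp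
  next
    case 2
    then have x0: "x \<noteq> 0" using e by auto
    have "((\<lambda>x. (1 - norm x) * (1 / e)) has_derivative (\<lambda>h. - (1 / e) * (sgn x \<bullet> h))) (at x)"
    proof -
      have "(norm has_derivative (\<lambda>h. h \<bullet> sgn x)) (at x)" using x0 by (rule has_derivative_norm)
      then show ?thesis using e by (auto intro!: derivative_eq_intros simp: inner_commute)
    qed
    then have "(cutoff e has_derivative (\<lambda>h. - (1 / e) * (sgn x \<bullet> h))) (at x)"
    proof (rule has_derivative_transform_within_open[of _ _ _ _ "ball 0 1 - cball 0 (1 - e)"])
      fix y assume "y \<in> ball (0::'a) 1 - cball 0 (1 - e)"
      then show "(1 - norm y) * (1 / e) = cutoff e y" using cutoff_eq(3)[OF e(1), of y] by simp
    qed (use 2 in \<open>auto intro: open_Diff\<close>)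
    from has_derivative_imp_quotient_tendsto[OF this, of v] show ?thesis using 2 by simp
  qed
qed

text \<open>By the scaling of sectors, \<open>sgn\<close> pushes Lebesgue measure on the shell to
  \<open>1 - (1 - e) ^ n\<close> times the cone measure.\<close>

lemma integral_shell_sgn:
  fixes f :: "'a::euclidean_space \<Rightarrow> real"
  assumes e: "0 < e" "e < 1" and [measurable]: "f \<in> borel_measurable borel"
  shows "(LINT x|lborel. indicator (ball 0 1 - ball 0 (1 - e)) x * f (sgn x))
    = (1 - (1 - e) ^ DIM('a)) * (LINT x|cone_measure. f x)"
proof -
  let ?S = "ball (0::'a) 1 - ball 0 (1 - e)" and ?c = "1 - (1 - e) ^ DIM('a)"
  have [measurable]: "?S \<in> sets borel" by simp
  let ?D = "density lborel (\<lambda>x. ennreal (indicator ?S x))"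
  have c: "0 \<le> ?c" using e by (simp add: power_le_one)
  have [measurable]: "sgn \<in> ?D \<rightarrow>\<^sub>M borel" by simp
  have "distr ?D borel sgn = density cone_measure (\<lambda>_. ennreal ?c)"
  proof (rule measure_eqI)
    fix A :: "'a set" assume "A \<in> sets (distr ?D borel sgn)"
    then have A[measurable]: "A \<in> sets borel" by simp
    interpret finite_measure "cone_measure :: 'a measure" by (rule finite_measure_cone_measure)
    let ?B = "\<lambda>t. {y\<in>ball (0::'a) t. sgn y \<in> A}"
    have [measurable]: "ball (0::'a) t \<in> sets borel" for t by simp
    have [measurable]: "?B t \<in> sets borel" for t by measurable
    have fin: "emeasure lborel (?B t) = ennreal (t ^ DIM('a) * measure cone_measure A)" if "0 < t" for t
      unfolding emeasure_cone_sector[OF A that] using that by (simp add: emeasure_eq_measure ennreal_mult)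
    have "emeasure (distr ?D borel sgn) A = (\<integral>\<^sup>+x. ennreal (indicator ?S x) * indicator (sgn -` A) x \<partial>lborel)"
      using measurable_sets[of sgn borel borel A] by (subst emeasure_distr) (auto simp: emeasure_density)
    also have "\<dots> = (\<integral>\<^sup>+x. indicator (?B 1 - ?B (1 - e)) x \<partial>lborel)"
      by (intro nn_integral_cong) (auto simp: indicator_def)
    also have "\<dots> = emeasure lborel (?B 1 - ?B (1 - e))" by simp
    also have "\<dots> = emeasure lborel (?B 1) - emeasure lborel (?B (1 - e))"
      by (rule emeasure_Diff) (use fin[of "1 - e"] e in auto)
    also have "\<dots> = ennreal (?c * measure cone_measure A)"
      using e by (simp only: fin zero_less_one diff_gt_0_iff_gt) (simp add: ennreal_minus[symmetric] algebra_simps)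
    also have "\<dots> = emeasure (density cone_measure (\<lambda>_. ennreal ?c)) A"
      using c by (simp add: emeasure_density nn_integral_cmult_indicator emeasure_eq_measure ennreal_mult)
    finally show "emeasure (distr ?D borel sgn) A = emeasure (density cone_measure (\<lambda>_. ennreal ?c)) A" .
  qed simp
  then have "(LINT x|distr ?D borel sgn. f x) = (LINT x|density cone_measure (\<lambda>_. ennreal ?c). f x)"
    by simp
  moreover have "(LINT x|distr ?D borel sgn. f x) = (LINT x|lborel. indicator ?S x * f (sgn x))"
    by (subst integral_distr, simp, simp, subst integral_density) (measurable, auto)
  moreover have "(LINT x|density cone_measure (\<lambda>_. ennreal ?c). f x) = ?c * (LINT x|cone_measure. f x)"
    using c by (subst integral_density) auto
  ultimately show ?thesis by simp
qed

lemma AE_lborel_norm_neq: "AE x in lborel. norm (x::'a::euclidean_space) \<noteq> r"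
proof -
  have "sphere (0::'a) r \<in> null_sets lborel"
    using negligible_sphere[of "0::'a" r] by (simp add: negligible_iff_null_sets null_sets_completion_iff)
  from AE_not_in[OF this] show ?thesis by eventually_elim auto
qed

text \<open>As the cutoffs tend to the indicator of the ball, the volume side converges. On the
  shell \<psi> may be replaced by its value at \<open>sgn x\<close>: the error is at most
  \<open>K * e\<close> pointwise, hence of the order of the shell volume after division by
  \<open>e\<close>. The factor n is the limit of \<open>(1 - (1 - e) ^ n) / e\<close>.\<close>

theorem divergence_cone_measure:
  fixes \<psi> :: "'a::euclidean_space \<Rightarrow> real"
  assumes \<psi>: "has_grad \<psi> G"
  shows "(LINT x|lborel. indicator (ball 0 1) x * (G x \<bullet> v)) =
    real DIM('a) * (LINT x|cone_measure. \<psi> x * (x \<bullet> v))"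
proof -
  let ?n = "DIM('a)"
  have contG: "continuous_on UNIV G" and cont\<psi>: "continuous_on UNIV \<psi>"
    using has_gradD[OF \<psi>] by auto
  have [measurable]: "G \<in> borel_measurable borel" "\<psi> \<in> borel_measurable borel"
    using contG cont\<psi> by (auto intro: borel_measurable_continuous_onI)
  have [measurable]: "ball (0::'a) s \<in> sets borel" for s by simp
  have [measurable]: "cutoff s \<in> borel_measurable (borel :: 'a measure)" for s
    unfolding cutoff_def[abs_def] by measurable
  \<comment> \<open>The shift by 2 keeps \<open>e k < 1\<close>, so that the inner ball of the shell
    is nondegenerate.\<close>
  define e where "e k = 1 / real (k + 2)" for k
  have e: "0 < e k" "e k < 1" for k by (auto simp: e_def field_simps)
  have elim: "e \<longlonglongrightarrow> 0"
    using LIMSEQ_ignore_initial_segment[OF LIMSEQ_inverse_real_of_nat, of 1]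
    unfolding e_def[abs_def] by (simp add: inverse_eq_divide add.commute)
  define S where "S k = ball (0::'a) 1 - ball 0 (1 - e k)" for k
  have [measurable]: "S k \<in> sets borel" for k by (simp add: S_def)
  obtain M where M: "0 < M" "\<And>x. norm x \<le> 1 \<Longrightarrow> norm (G x) \<le> M"
    using continuous_bound_cball[OF contG, of 1] by blast
  obtain N where N: "0 < N" "\<And>x. norm x \<le> 1 \<Longrightarrow> norm (\<psi> x) \<le> N"
    using continuous_bound_cball[OF cont\<psi>, of 1] by blast
  obtain K where K: "0 < K" "\<And>x y. norm x \<le> 1 \<Longrightarrow> norm y \<le> 1 \<Longrightarrow> \<bar>\<psi> x - \<psi> y\<bar> \<le> K * norm (x - y)"
    using has_grad_lipschitz[OF \<psi>, of 1] by blast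
  have sgn1: "norm (sgn x) \<le> 1" "\<bar>sgn x \<bullet> v\<bar> \<le> norm v" for x
  proof -
    show *: "norm (sgn x) \<le> 1" by (simp add: norm_sgn)
    have "\<bar>sgn x \<bullet> v\<bar> \<le> norm (sgn x) * norm v" by (rule Cauchy_Schwarz_ineq2)
    also have "\<dots> \<le> norm v" using * by (intro mult_left_le_one_le) auto
    finally show "\<bar>sgn x \<bullet> v\<bar> \<le> norm v" .
  qed
  define R where "R k = (LINT x|lborel. indicator (S k) x * (\<psi> x * (sgn x \<bullet> v)))" for k
  define P where "P k = (LINT x|lborel. indicator (S k) x * (\<psi> (sgn x) * (sgn x \<bullet> v)))" for k
  let ?I = "LINT x|cone_measure. \<psi> x * (x \<bullet> v)"
  have lhs: "(LINT x|lborel. cutoff (e k) x * (G x \<bullet> v)) = 1 / e k * R k" for k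
  proof -
    have "(LINT x|lborel. cutoff (e k) x * (G x \<bullet> v)) =
      - (LINT x|lborel. (- (1 / e k) * (indicator (S k) x * (sgn x \<bullet> v))) * \<psi> x)"
    proof (rule integral_lipschitz_by_parts[OF _ _ _ _ \<psi>])
      show "cutoff (e k) x = 0" if "norm x > 1" for x using that e[of k] by (simp add: cutoff_eq)
      show "\<bar>cutoff (e k) x - cutoff (e k) y\<bar> \<le> 1 / e k * norm (x - y)" for x y
        by (rule cutoff_lipschitz[OF e(1)])
      show "AE x in lborel. (\<lambda>j. real (Suc j) * (cutoff (e k) (x + (1 / real (Suc j)) *\<^sub>R v) - cutoff (e k) x))
        \<longlonglongrightarrow> - (1 / e k) * (indicator (S k) x * (sgn x \<bullet> v))"
        using AE_lborel_norm_neq[of 1] AE_lborel_norm_neq[of "1 - e k"]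
        unfolding S_def by eventually_elim (rule cutoff_quotient_tendsto[OF e])
    qed measurable
    also have "\<dots> = - (LINT x|lborel. (- (1 / e k)) * (indicator (S k) x * (\<psi> x * (sgn x \<bullet> v))))"
      by (intro arg_cong[of _ _ uminus] Bochner_Integration.integral_cong) auto
    also have "\<dots> = 1 / e k * R k" by (simp add: R_def)
    finally show ?thesis .
  qed
  have P: "P k = (1 - (1 - e k) ^ ?n) * ?I" for k
    unfolding P_def S_def by (rule integral_shell_sgn[OF e]) measurable
  have "(\<lambda>k. LINT x|lborel. cutoff (e k) x * (G x \<bullet> v)) \<longlonglongrightarrow> (LINT x|lborel. indicator (ball 0 1) x * (G x \<bullet> v))"
  proof (rule integral_dominated_convergence[where w="\<lambda>x. indicator (cball 0 1) x *\<^sub>R (M * norm v)"])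
    show "integrable lborel (\<lambda>x::'a. indicator (cball 0 1) x *\<^sub>R (M * norm v))"
      using emeasure_bounded_finite[OF bounded_cball, of "0::'a" 1] by (intro integrable_indicator) simp_all
    show "AE x in lborel. (\<lambda>k. cutoff (e k) x * (G x \<bullet> v)) \<longlonglongrightarrow> indicator (ball 0 1) x * (G x \<bullet> v)"
    proof (rule AE_I2, intro tendsto_mult tendsto_const)
      fix x :: 'a
      show "(\<lambda>k. cutoff (e k) x) \<longlonglongrightarrow> indicator (ball 0 1) x"
      proof (cases "norm x < 1")
        case True
        then have "eventually (\<lambda>k. e k < 1 - norm x) sequentially"
          by (intro order_tendstoD(2)[OF elim]) auto
        then have "eventually (\<lambda>k. cutoff (e k) x = indicator (ball 0 1) x) sequentially"
          by eventually_elim (use True e in \<open>simp add: cutoff_eq\<close>)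
        then show ?thesis by (rule tendsto_eventually)
      qed (use e in \<open>simp add: cutoff_eq not_less\<close>)
    qed
    show "AE x in lborel. norm (cutoff (e k) x * (G x \<bullet> v)) \<le> indicator (cball 0 1) x *\<^sub>R (M * norm v)" for k
    proof (rule AE_I2)
      fix x :: 'a
      show "norm (cutoff (e k) x * (G x \<bullet> v)) \<le> indicator (cball 0 1) x *\<^sub>R (M * norm v)"
      proof (cases "norm x \<le> 1")
        case True
        have "\<bar>cutoff (e k) x\<bar> \<le> 1" by (auto simp: cutoff_def max_def min_def)
        moreover have "\<bar>G x \<bullet> v\<bar> \<le> M * norm v"
          using M(2)[OF True] by (intro order_trans[OF Cauchy_Schwarz_ineq2] mult_right_mono) auto
        ultimately have "\<bar>cutoff (e k) x\<bar> * \<bar>G x \<bullet> v\<bar> \<le> 1 * (M * norm v)"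
          by (intro mult_mono) auto
        then show ?thesis using True by (simp add: abs_mult)
      qed (use e in \<open>simp add: cutoff_eq\<close>)
    qed
  qed measurable
  then have l1: "(\<lambda>k. 1 / e k * R k) \<longlonglongrightarrow> (LINT x|lborel. indicator (ball 0 1) x * (G x \<bullet> v))"
    by (simp only: lhs)
  have "(\<lambda>k. (1 - (1 - e k) ^ ?n) / e k) \<longlonglongrightarrow> real ?n"
  proof -
    have "DERIV (\<lambda>x::real. x ^ ?n) 1 :> real ?n" by (auto intro!: derivative_eq_intros)
    then have "((\<lambda>h::real. ((1 + h) ^ ?n - 1) / h) \<longlongrightarrow> real ?n) (at 0)" by (simp add: DERIV_def)
    moreover have "(\<lambda>k. - e k) \<longlonglongrightarrow> 0" using tendsto_minus[OF elim] by simp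
    ultimately have "(\<lambda>k. ((1 + (- e k)) ^ ?n - 1) / (- e k)) \<longlonglongrightarrow> real ?n"
      by (elim tendsto_at_iff_sequentially[THEN iffD1, rule_format, unfolded comp_def])
        (use e in \<open>auto simp: less_imp_neq[symmetric]\<close>)
    then show ?thesis by (simp add: minus_divide_right[symmetric] minus_divide_left)
  qed
  then have l2: "(\<lambda>k. 1 / e k * P k) \<longlonglongrightarrow> real ?n * ?I"
    using tendsto_mult[OF \<open>(\<lambda>k. (1 - (1 - e k) ^ ?n) / e k) \<longlonglongrightarrow> real ?n\<close> tendsto_const[of ?I]] by (simp add: P)
  have "(\<lambda>k. 1 / e k * R k - 1 / e k * P k) \<longlonglongrightarrow> 0"
  proof (rule Lim_null_comparison)
    let ?V = "\<lambda>k. (1 - (1 - e k) ^ ?n) * unit_ball_vol (real ?n)"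
    show "eventually (\<lambda>k. norm (1 / e k * R k - 1 / e k * P k) \<le> K * norm v * ?V k) sequentially"
    proof (intro always_eventually allI)
      fix k
      have iS: "integrable lborel (indicator (S k) :: 'a \<Rightarrow> real)"
        by (rule integrable_bounded_support[where r=1 and M=1]) (auto simp: S_def indicator_def)
      have int: "integrable lborel (\<lambda>x. indicator (S k) x * (\<psi> x * (sgn x \<bullet> v)))"
        "integrable lborel (\<lambda>x. indicator (S k) x * (\<psi> (sgn x) * (sgn x \<bullet> v)))"
        by (rule integrable_bounded_support[where r=1 and M="N * norm v"], measurable,
          simp add: S_def indicator_def,
          use N sgn1 in \<open>auto simp: indicator_def abs_mult intro!: mult_mono\<close>)+
      have "norm (R k - P k) = norm (LINT x|lborel. indicator (S k) x * (\<psi> x * (sgn x \<bullet> v)) - indicator (S k) x * (\<psi> (sgn x) * (sgn x \<bullet> v)))"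
        unfolding R_def P_def by (subst Bochner_Integration.integral_diff[OF int]) simp
      also have "\<dots> \<le> (LINT x|lborel. K * e k * norm v * indicator (S k) x)"
      proof (rule Bochner_Integration.integral_norm_bound_integral)
        show "integrable lborel (\<lambda>x. indicator (S k) x * (\<psi> x * (sgn x \<bullet> v)) - indicator (S k) x * (\<psi> (sgn x) * (sgn x \<bullet> v)))"
          by (rule Bochner_Integration.integrable_diff[OF int])
        show "integrable lborel (\<lambda>x. K * e k * norm v * indicator (S k) x)" using iS by simp
        fix x :: 'a
        show "norm (indicator (S k) x * (\<psi> x * (sgn x \<bullet> v)) - indicator (S k) x * (\<psi> (sgn x) * (sgn x \<bullet> v)))
          \<le> K * e k * norm v * indicator (S k) x"
        proof (cases "x \<in> S k")
          case True
          then have x: "norm x < 1" "1 - e k \<le> norm x" by (auto simp: S_def)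
          then have x0: "x \<noteq> 0" using e[of k] by auto
          have "x - sgn x = (norm x - 1) *\<^sub>R sgn x" using x0 by (simp add: sgn_div_norm algebra_simps)
          then have "norm (x - sgn x) = \<bar>norm x - 1\<bar>" using x0 by (simp add: norm_sgn)
          then have "norm (x - sgn x) \<le> e k" using x by simp
          then have "\<bar>\<psi> x - \<psi> (sgn x)\<bar> \<le> K * e k"
            using K(2)[of x "sgn x"] x sgn1(1)[of x] K(1) by (smt (verit) mult_left_mono)
          then have "\<bar>\<psi> x - \<psi> (sgn x)\<bar> * \<bar>sgn x \<bullet> v\<bar> \<le> K * e k * norm v"
            using sgn1(2)[of x] by (intro mult_mono) auto
          then show ?thesis using True by (simp add: abs_mult[symmetric] algebra_simps)
        qed simp
      qed
      also have "\<dots> = K * e k * norm v * (LINT x|lborel. indicator (S k) (x::'a))" by simp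
      also have "(LINT x|lborel. indicator (S k) (x::'a)) = ?V k"
        using integral_shell_sgn[OF e, of "\<lambda>_::'a. 1" k]
        by (simp add: S_def measure_def emeasure_cone_measure_UNIV)
      finally have "1 / e k * norm (R k - P k) \<le> 1 / e k * (K * e k * norm v * ?V k)"
        using e[of k] by (intro mult_left_mono) auto
      moreover have "norm (1 / e k * R k - 1 / e k * P k) = 1 / e k * norm (R k - P k)"
        unfolding right_diff_distrib[symmetric] norm_mult using e[of k] by simp
      ultimately show "norm (1 / e k * R k - 1 / e k * P k) \<le> K * norm v * ?V k"
        using e[of k] by simp
    qed
    have "(\<lambda>k. K * norm v * ?V k) \<longlonglongrightarrow> K * norm v * ((1 - (1 - 0) ^ ?n) * unit_ball_vol (real ?n))"
      by (intro tendsto_intros elim)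
    then show "(\<lambda>k. K * norm v * ?V k) \<longlonglongrightarrow> 0" by simp
  qed
  from tendsto_add[OF this l2] have "(\<lambda>k. 1 / e k * R k) \<longlonglongrightarrow> real ?n * ?I" by simp
  with l1 show ?thesis by (rule LIMSEQ_unique)
qed

section \<open>Transfer to the Hausdorff surface measure and to translated balls\<close>

lemma integral_lebesgue_on_ball:
  fixes f :: "'a::euclidean_space \<Rightarrow> 'b::{banach, second_countable_topology}"
  assumes [measurable]: "f \<in> borel_measurable borel"
  shows "(LINT x|lebesgue_on (ball x0 r). f x) = (LINT x|lborel. indicator (ball 0 r) x *\<^sub>R f (x + x0))"
proof -
  have [measurable]: "ball x0 r \<in> sets borel" by simp
  have "(LINT x|lebesgue_on (ball x0 r). f x) = (LINT x|lebesgue. indicator (ball x0 r) x *\<^sub>R f x)"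
    by (subst integral_restrict_space) auto
  also have "\<dots> = (LINT x|lborel. indicator (ball x0 r) x *\<^sub>R f x)"
    by (rule integral_completion) measurable
  also have "\<dots> = (LINT x|lborel. indicator (ball x0 r) (x + x0) *\<^sub>R f (x + x0))"
    by (rule lborel_integral_translate(1)[symmetric]) measurable
  also have "\<dots> = (LINT x|lborel. indicator (ball 0 r) x *\<^sub>R f (x + x0))"
    by (intro Bochner_Integration.integral_cong) (auto simp: indicator_def dist_norm)
  finally show ?thesis .
qed

lemma surface_measure_ball:
  fixes x0 :: "'a::euclidean_space"
  assumes "0 < r"
  shows "surface_measure (ball x0 r) = restrict_space (hausdorff_measure (DIM('a) - 1)) (sphere x0 r)"
  using assms by (simp add: surface_measure_def)

lemma distr_hausdorff_measure_translate:
  fixes x0 :: "'a::euclidean_space"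
  assumes "d \<noteq> 0"
  shows "distr (hausdorff_measure d) borel (\<lambda>x. x + x0) = hausdorff_measure d"
proof (rule measure_eqI)
  fix A assume "A \<in> sets (distr (hausdorff_measure d) borel (\<lambda>x::'a. x + x0))"
  then have A[measurable]: "A \<in> sets borel" by simp
  have m: "(\<lambda>x. x + x0) \<in> borel \<rightarrow>\<^sub>M borel" by simp
  have "(\<lambda>x. x + x0) -` A \<in> sets borel" using measurable_sets[OF m A] by simp
  then have "emeasure (distr (hausdorff_measure d) borel (\<lambda>x. x + x0)) A = hausdorff_outer d ((\<lambda>x. x + x0) -` A)"
    using m assms by (subst emeasure_distr) (auto simp: emeasure_hausdorff_measure cong: measurable_cong_sets)
  also have "(\<lambda>x. x + x0) -` A = (\<lambda>x. x - x0) ` A"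
    by (auto simp: image_iff) (metis add_diff_cancel_right')
  also have "hausdorff_outer d ((\<lambda>x. x - x0) ` A) = hausdorff_outer d A"
    by (rule hausdorff_outer_isometry) (auto simp: dist_norm surj_def intro: exI[of _ "_ + x0"])
  finally show "emeasure (distr (hausdorff_measure d) borel (\<lambda>x. x + x0)) A = emeasure (hausdorff_measure d) A"
    using A assms by (simp add: emeasure_hausdorff_measure)
qed simp

lemma integral_surface_measure_translate:
  fixes f :: "'a::euclidean_space \<Rightarrow> real"
  assumes dim: "DIM('a) \<ge> 2" and [measurable]: "f \<in> borel_measurable borel"
  shows "(LINT x|surface_measure (ball x0 1). f x) = (LINT x|surface_measure (ball 0 1). f (x + x0))"
proof -
  let ?H = "hausdorff_measure (DIM('a) - 1) :: 'a measure"
  have [measurable]: "sphere x0 1 \<in> sets borel" "sphere (0::'a) 1 \<in> sets borel" by simp_all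
  have "(LINT x|surface_measure (ball x0 1). f x) = (LINT x|?H. indicator (sphere x0 1) x *\<^sub>R f x)"
    unfolding surface_measure_ball[OF zero_less_one] by (rule integral_restrict_space) simp
  also have "\<dots> = (LINT x|distr ?H borel (\<lambda>x. x + x0). indicator (sphere x0 1) x *\<^sub>R f x)"
    using dim by (subst distr_hausdorff_measure_translate) auto
  also have "\<dots> = (LINT x|?H. indicator (sphere x0 1) (x + x0) *\<^sub>R f (x + x0))"
    by (rule integral_distr) measurable
  also have "\<dots> = (LINT x|?H. indicator (sphere 0 1) x *\<^sub>R f (x + x0))"
    by (intro Bochner_Integration.integral_cong) (auto simp: indicator_def dist_norm)
  also have "\<dots> = (LINT x|surface_measure (ball 0 1). f (x + x0))"
    unfolding surface_measure_ball[OF zero_less_one] by (rule integral_restrict_space[symmetric]) simp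
  finally show ?thesis .
qed

lemma finite_measure_surface_ball:
  fixes x0 :: "'a::euclidean_space"
  assumes dim: "DIM('a) \<ge> 2"
  shows "finite_measure (surface_measure (ball x0 1))"
proof (rule finite_measureI)
  have "sphere x0 1 = (\<lambda>x. x + x0) ` sphere 0 1"
  proof (intro set_eqI iffI)
    fix x assume "x \<in> sphere x0 1"
    then show "x \<in> (\<lambda>x. x + x0) ` sphere 0 1"
      by (intro image_eqI[of _ _ "x - x0"]) (auto simp: dist_norm norm_minus_commute)
  qed (auto simp: dist_norm)
  moreover have "hausdorff_outer (DIM('a) - 1) ((\<lambda>x. x + x0) ` sphere 0 1) \<le> hausdorff_outer (DIM('a) - 1) (sphere (0::'a) 1)"
    by (rule hausdorff_outer_isometry_le) (simp add: dist_norm)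
  moreover have "hausdorff_outer (DIM('a) - 1) (sphere (0::'a) 1) < \<infinity>"
    by (rule hausdorff_sphere_finite[OF dim])
  ultimately have "hausdorff_outer (DIM('a) - 1) (sphere x0 1) < \<infinity>" by simp
  moreover have "emeasure (surface_measure (ball x0 1)) (sphere x0 1) = hausdorff_outer (DIM('a) - 1) (sphere x0 1)"
    using dim unfolding surface_measure_ball[OF zero_less_one]
    by (subst emeasure_restrict_space) (auto intro!: emeasure_hausdorff_measure)
  ultimately show "emeasure (surface_measure (ball x0 1)) (space (surface_measure (ball x0 1))) \<noteq> \<infinity>"
    unfolding surface_measure_ball[OF zero_less_one] by (simp add: space_restrict_space)
qed

text \<open>n times the cone measure is the standard surface measure and the Hausdorff measure is
  \<open>C\<close> times the cone measure, hence \<kappa> is n divided by \<open>C\<close>.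
  Translation invariance makes one \<kappa> serve all centres.\<close>

theorem divergence_theorem_ball:
  assumes dim: "DIM('a::euclidean_space) \<ge> 2"
  obtains \<kappa> where "0 < \<kappa>"
    "\<And>x0 v \<psi> G. has_grad \<psi> G \<Longrightarrow> (LINT x|lebesgue_on (ball (x0::'a) 1). G x \<bullet> v) =
      \<kappa> * (LINT x|surface_measure (ball x0 1). \<psi> x * ((x - x0) \<bullet> v))"
proof -
  let ?H = "hausdorff_measure (DIM('a) - 1) :: 'a measure" and ?S = "sphere (0::'a) 1"
  have [measurable]: "?S \<in> sets borel" by simp
  obtain C where C: "0 < C"
    "\<And>A. A \<in> sets borel \<Longrightarrow> emeasure ?H (A \<inter> ?S) = ennreal C * emeasure cone_measure A"
    using hausdorff_sphere_eq_cone_measure[OF dim] by blast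
  have eq: "density ?H (\<lambda>x. ennreal (indicator ?S x)) = density cone_measure (\<lambda>_. ennreal C)"
  proof (rule measure_eqI)
    fix A assume "A \<in> sets (density ?H (\<lambda>x. ennreal (indicator ?S x)))"
    then have [measurable]: "A \<in> sets borel" by simp
    have "emeasure (density ?H (\<lambda>x. ennreal (indicator ?S x))) A
        = (\<integral>\<^sup>+x. ennreal (indicator ?S x) * indicator A x \<partial>?H)"
      by (rule emeasure_density) auto
    also have "\<dots> = (\<integral>\<^sup>+x. indicator (A \<inter> ?S) x \<partial>?H)"
      by (intro nn_integral_cong) (auto simp: indicator_def)
    also have "\<dots> = emeasure ?H (A \<inter> ?S)" by simp
    finally show "emeasure (density ?H (\<lambda>x. ennreal (indicator ?S x))) A = emeasure (density cone_measure (\<lambda>_. ennreal C)) A"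
      using C by (simp add: emeasure_density nn_integral_cmult_indicator)
  qed simp
  have surf: "(LINT x|surface_measure (ball 0 1). f x) = C * (LINT x|cone_measure. f x)"
    if [measurable]: "f \<in> borel_measurable borel" for f :: "'a \<Rightarrow> real"
  proof -
    have "(LINT x|surface_measure (ball 0 1). f x) = (LINT x|?H. indicator ?S x *\<^sub>R f x)"
      unfolding surface_measure_ball[OF zero_less_one] by (rule integral_restrict_space) simp
    also have "\<dots> = (LINT x|density ?H (\<lambda>x. ennreal (indicator ?S x)). f x)"
      by (rule integral_density[symmetric]) auto
    also have "\<dots> = C * (LINT x|cone_measure. f x)"
      unfolding eq using C by (subst integral_density) auto
    finally show ?thesis .
  qed
  show thesis
  proof (rule that[of "real DIM('a) / C"])
    fix x0 v :: 'a and \<psi> :: "'a \<Rightarrow> real" and G assume \<psi>: "has_grad \<psi> G"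
    have [measurable]: "G \<in> borel_measurable borel" "\<psi> \<in> borel_measurable borel"
      using has_gradD(2,3)[OF \<psi>] by (auto intro: borel_measurable_continuous_onI)
    have \<psi>': "has_grad (\<lambda>x. \<psi> (x + x0)) (\<lambda>x. G (x + x0))"
      using has_grad_translate[OF \<psi>, of "- x0"] by simp
    have "(LINT x|lebesgue_on (ball x0 1). G x \<bullet> v) = (LINT x|lborel. indicator (ball 0 1) x * (G (x + x0) \<bullet> v))"
      by (subst integral_lebesgue_on_ball) auto
    also have "\<dots> = real DIM('a) * (LINT x|cone_measure. \<psi> (x + x0) * (x \<bullet> v))"
      by (rule divergence_cone_measure[OF \<psi>'])
    also have "(LINT x|cone_measure. \<psi> (x + x0) * (x \<bullet> v)) = (LINT x|surface_measure (ball 0 1). \<psi> (x + x0) * (x \<bullet> v)) / C"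
      using C by (subst surf) auto
    also have "(LINT x|surface_measure (ball 0 1). \<psi> (x + x0) * (x \<bullet> v)) = (LINT x|surface_measure (ball x0 1). \<psi> x * ((x - x0) \<bullet> v))"
      by (subst integral_surface_measure_translate[OF dim]) auto
    finally show "(LINT x|lebesgue_on (ball x0 1). G x \<bullet> v) =
      real DIM('a) / C * (LINT x|surface_measure (ball x0 1). \<psi> x * ((x - x0) \<bullet> v))"
      by simp
  qed (use C in simp)
qed

section \<open>Square integrable functions\<close>

lemma L2_D:
  assumes "L2 M f" shows "f \<in> borel_measurable M" "integrable M (\<lambda>x. (norm (f x))\<^sup>2)"
  using assms by (auto simp: L2_def)

lemma L2_inner_integrable:
  assumes "L2 M f" "L2 M g" shows "integrable M (\<lambda>x. f x \<bullet> g x)"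
proof (rule Bochner_Integration.integrable_bound)
  note [measurable] = L2_D(1)[OF assms(1)] L2_D(1)[OF assms(2)]
  show "integrable M (\<lambda>x. (norm (f x))\<^sup>2 + (norm (g x))\<^sup>2)"
    using L2_D(2)[OF assms(1)] L2_D(2)[OF assms(2)] by simp
  show "(\<lambda>x. f x \<bullet> g x) \<in> borel_measurable M" by measurable
  show "AE x in M. norm (f x \<bullet> g x) \<le> norm ((norm (f x))\<^sup>2 + (norm (g x))\<^sup>2)"
  proof (rule AE_I2)
    fix x
    have "\<bar>f x \<bullet> g x\<bar> \<le> norm (f x) * norm (g x)" by (rule Cauchy_Schwarz_ineq2)
    also have "\<dots> \<le> (norm (f x))\<^sup>2 + (norm (g x))\<^sup>2"
      using sum_squares_bound[of "norm (f x)" "norm (g x)"]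
        mult_nonneg_nonneg[OF norm_ge_zero norm_ge_zero, of "f x" "g x"] by linarith
    finally show "norm (f x \<bullet> g x) \<le> norm ((norm (f x))\<^sup>2 + (norm (g x))\<^sup>2)" by simp
  qed
qed

lemma L2_lincomb:
  assumes "L2 M f" "L2 M g" shows "L2 M (\<lambda>x. f x + t *\<^sub>R g x)"
  unfolding L2_def
proof
  note [measurable] = L2_D(1)[OF assms(1)] L2_D(1)[OF assms(2)]
  show "(\<lambda>x. f x + t *\<^sub>R g x) \<in> borel_measurable M" by measurable
  have eq: "(norm (f x + t *\<^sub>R g x))\<^sup>2 = (norm (f x))\<^sup>2 + 2 * t * (f x \<bullet> g x) + t\<^sup>2 * (norm (g x))\<^sup>2" for x
    unfolding power2_norm_eq_inner
    by (simp add: inner_add_left inner_add_right inner_commute algebra_simps power2_eq_square)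
  show "integrable M (\<lambda>x. (norm (f x + t *\<^sub>R g x))\<^sup>2)"
    unfolding eq using L2_D(2)[OF assms(1)] L2_D(2)[OF assms(2)] L2_inner_integrable[OF assms] by simp
qed

lemma L2_diff: "L2 M f \<Longrightarrow> L2 M g \<Longrightarrow> L2 M (\<lambda>x. f x - g x)"
  by (drule (1) L2_lincomb[where t="-1"]) simp

lemma L2_integral_norm_lincomb:
  assumes "L2 M f" "L2 M g"
  shows "(LINT x|M. (norm (f x + t *\<^sub>R g x))\<^sup>2) =
    (LINT x|M. (norm (f x))\<^sup>2) + 2 * t * (LINT x|M. f x \<bullet> g x) + t\<^sup>2 * (LINT x|M. (norm (g x))\<^sup>2)"
proof -
  have eq: "(norm (f x + t *\<^sub>R g x))\<^sup>2 = (norm (f x))\<^sup>2 + 2 * t * (f x \<bullet> g x) + t\<^sup>2 * (norm (g x))\<^sup>2" for x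
    unfolding power2_norm_eq_inner
    by (simp add: inner_add_left inner_add_right inner_commute algebra_simps power2_eq_square)
  show ?thesis
    unfolding eq using L2_D(2)[OF assms(1)] L2_D(2)[OF assms(2)] L2_inner_integrable[OF assms] by simp
qed

lemma L2_Cauchy_Schwarz:
  assumes "L2 M f" "L2 M g"
  shows "(LINT x|M. f x \<bullet> g x)\<^sup>2 \<le> (LINT x|M. (norm (f x))\<^sup>2) * (LINT x|M. (norm (g x))\<^sup>2)"
proof -
  define a b c where "a = (LINT x|M. (norm (f x))\<^sup>2)" "b = (LINT x|M. (norm (g x))\<^sup>2)" "c = (LINT x|M. f x \<bullet> g x)"
  have pos: "0 \<le> a + 2 * t * c + t\<^sup>2 * b" for t
    unfolding a_b_c_def L2_integral_norm_lincomb[OF assms, symmetric] by simp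
  have ab: "0 \<le> a" "0 \<le> b" by (auto simp: a_b_c_def)
  have "c\<^sup>2 \<le> a * b"
  proof (cases "b = 0")
    case True
    have "c = 0"
    proof (rule ccontr)
      assume "c \<noteq> 0"
      then have "2 * (- (a + 1) / (2 * c)) * c = - (a + 1)" by simp
      with pos[of "- (a + 1) / (2 * c)"] True show False by simp
    qed
    then show ?thesis using ab by simp
  next
    case False
    then have "0 < b" using ab by simp
    have "0 \<le> b * (a + 2 * (- c / b) * c + (- c / b)\<^sup>2 * b)"
      by (intro mult_nonneg_nonneg ab(2) pos)
    also have "\<dots> = a * b - c\<^sup>2" using \<open>0 < b\<close> by (simp add: field_simps power2_eq_square)
    finally show ?thesis by simp
  qed
  then show ?thesis by (simp add: a_b_c_def)
qed

lemma L2_tendsto_inner: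
  assumes f: "\<And>k. L2 M (f k)" "L2 M F" and g: "L2 M g"
    and lim: "(\<lambda>k. LINT x|M. (norm (f k x - F x))\<^sup>2) \<longlonglongrightarrow> 0"
  shows "(\<lambda>k. LINT x|M. f k x \<bullet> g x) \<longlonglongrightarrow> (LINT x|M. F x \<bullet> g x)"
proof -
  have "(\<lambda>k. (LINT x|M. f k x \<bullet> g x) - (LINT x|M. F x \<bullet> g x)) \<longlonglongrightarrow> 0"
  proof (rule Lim_null_comparison)
    show "eventually (\<lambda>k. norm ((LINT x|M. f k x \<bullet> g x) - (LINT x|M. F x \<bullet> g x))
      \<le> sqrt ((LINT x|M. (norm (f k x - F x))\<^sup>2) * (LINT x|M. (norm (g x))\<^sup>2))) sequentially"
    proof (intro always_eventually allI)
      fix k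
      have "(LINT x|M. f k x \<bullet> g x) - (LINT x|M. F x \<bullet> g x) = (LINT x|M. (f k x - F x) \<bullet> g x)"
        using f g by (simp add: inner_diff_left L2_inner_integrable)
      then show "norm ((LINT x|M. f k x \<bullet> g x) - (LINT x|M. F x \<bullet> g x))
        \<le> sqrt ((LINT x|M. (norm (f k x - F x))\<^sup>2) * (LINT x|M. (norm (g x))\<^sup>2))"
        using L2_Cauchy_Schwarz[OF L2_diff[OF f(1) f(2)] g, of k]
        by (simp add: real_le_rsqrt)
    qed
    have "(\<lambda>k. sqrt ((LINT x|M. (norm (f k x - F x))\<^sup>2) * (LINT x|M. (norm (g x))\<^sup>2)))
      \<longlonglongrightarrow> sqrt (0 * (LINT x|M. (norm (g x))\<^sup>2))"
      by (intro tendsto_intros lim)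
    then show "(\<lambda>k. sqrt ((LINT x|M. (norm (f k x - F x))\<^sup>2) * (LINT x|M. (norm (g x))\<^sup>2))) \<longlonglongrightarrow> 0"
      by simp
  qed
  then show ?thesis by (simp add: LIM_zero_iff)
qed

text \<open>Along a subsequence with \<open>\<integral>|f\<^bsub>k+1\<^esub> - f\<^bsub>k\<^esub>|\<^sup>2 \<le> 16\<^sup>-\<^sup>k\<close> the series \<open>\<Sum> 4\<^sup>k |f\<^bsub>k+1\<^esub> - f\<^bsub>k\<^esub>|\<^sup>2\<close> is finite almost
  everywhere, so the subsequence converges almost everywhere; Fatou does the rest.\<close>

lemma L2_complete:
  fixes f :: "nat \<Rightarrow> 'a \<Rightarrow> 'b::euclidean_space"
  assumes f: "\<And>k. L2 M (f k)"
    and cauchy: "\<And>e. 0 < e \<Longrightarrow> \<exists>N. \<forall>m\<ge>N. \<forall>n\<ge>N. (LINT x|M. (norm (f m x - f n x))\<^sup>2) < e"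
  obtains F where "L2 M F" "(\<lambda>k. LINT x|M. (norm (f k x - F x))\<^sup>2) \<longlonglongrightarrow> 0"
proof -
  note [measurable] = L2_D(1)[OF f]
  have int: "integrable M (\<lambda>x. (norm (f m x - f n x))\<^sup>2)" for m n
    by (rule L2_D(2)[OF L2_diff[OF f f]])
  have nn: "(\<integral>\<^sup>+x. ennreal ((norm (f m x - f n x))\<^sup>2) \<partial>M) = ennreal (LINT x|M. (norm (f m x - f n x))\<^sup>2)" for m n
    by (rule nn_integral_eq_integral[OF int]) simp
  have "\<exists>N. \<forall>m\<ge>N. \<forall>n\<ge>N. (LINT x|M. (norm (f m x - f n x))\<^sup>2) < (1/16) ^ k" for k :: nat
    by (rule cauchy) simp
  then obtain N where N: "\<And>k m n. m \<ge> N k \<Longrightarrow> n \<ge> N k \<Longrightarrow> (LINT x|M. (norm (f m x - f n x))\<^sup>2) < (1/16) ^ k"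
    by metis
  \<comment> \<open>Both \<open>r k\<close> and \<open>r (Suc k)\<close> must lie beyond
    \<open>N k\<close>, and \<open>r\<close> must tend to infinity: the sum ensures the former, the
    summand \<open>k\<close> the latter.\<close>
  define r where "r k = (\<Sum>i\<le>k. N i) + k" for k
  have rN: "r k \<ge> N k" "r (Suc k) \<ge> N k" "r k \<ge> k" for k
  proof -
    have "N k \<le> (\<Sum>i\<le>k. N i)" by (rule member_le_sum) auto
    then show "r k \<ge> N k" "r (Suc k) \<ge> N k" "r k \<ge> k" by (auto simp: r_def)
  qed
  let ?d = "\<lambda>k x. f (r (Suc k)) x - f (r k) x"
  have "(\<integral>\<^sup>+x. (\<Sum>k. ennreal (4 ^ k * (norm (?d k x))\<^sup>2)) \<partial>M) = (\<Sum>k. \<integral>\<^sup>+x. ennreal (4 ^ k * (norm (?d k x))\<^sup>2) \<partial>M)"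
    by (rule nn_integral_suminf) measurable
  also have "\<dots> \<le> (\<Sum>k. ennreal ((1/4) ^ k))"
  proof (intro suminf_le allI)
    fix k
    have "(\<integral>\<^sup>+x. ennreal (4 ^ k * (norm (?d k x))\<^sup>2) \<partial>M) = (\<integral>\<^sup>+x. ennreal (4 ^ k) * ennreal ((norm (?d k x))\<^sup>2) \<partial>M)"
      by (intro nn_integral_cong) (simp add: ennreal_mult)
    also have "\<dots> = ennreal (4 ^ k) * ennreal (LINT x|M. (norm (?d k x))\<^sup>2)"
      by (subst nn_integral_cmult) (auto simp: nn)
    also have "\<dots> \<le> ennreal (4 ^ k) * ennreal ((1/16) ^ k)"
      using N[OF rN(2) rN(1), of k] by (intro mult_left_mono ennreal_leI) auto
    also have "\<dots> = ennreal ((1/4) ^ k)"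
      by (simp add: ennreal_mult[symmetric] power_mult_distrib[symmetric])
    finally show "(\<integral>\<^sup>+x. ennreal (4 ^ k * (norm (?d k x))\<^sup>2) \<partial>M) \<le> ennreal ((1/4) ^ k)" .
  qed auto
  also have "\<dots> < \<infinity>"
    by (subst suminf_ennreal2) (auto intro: summable_geometric)
  finally have "AE x in M. (\<Sum>k. ennreal (4 ^ k * (norm (?d k x))\<^sup>2)) \<noteq> \<infinity>"
    by (intro nn_integral_PInf_AE) auto
  then have conv: "AE x in M. convergent (\<lambda>k. f (r k) x)"
  proof eventually_elim
    case (elim x)
    define c where "c = enn2real (\<Sum>k. ennreal (4 ^ k * (norm (?d k x))\<^sup>2))"
    have c: "0 \<le> c" "(\<Sum>k. ennreal (4 ^ k * (norm (?d k x))\<^sup>2)) = ennreal c"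
    proof -
      show "0 \<le> c" by (simp add: c_def)
      show "(\<Sum>k. ennreal (4 ^ k * (norm (?d k x))\<^sup>2)) = ennreal c"
        unfolding c_def using elim by (subst ennreal_enn2real) (simp_all add: less_top)
    qed
    have bound: "norm (?d k x) \<le> sqrt c * (1/2) ^ k" for k
    proof -
      have "(\<Sum>j\<in>{k}. ennreal (4 ^ j * (norm (?d j x))\<^sup>2)) \<le> ennreal c"
        unfolding c(2)[symmetric] by (rule sum_le_suminf) auto
      then have "4 ^ k * (norm (?d k x))\<^sup>2 \<le> c" using c(1) by simp
      moreover have "4 ^ k * (norm (?d k x))\<^sup>2 = (2 ^ k * norm (?d k x))\<^sup>2"
      proof -
        have "((2::real) ^ k)\<^sup>2 = 4 ^ k" by (simp add: power2_eq_square power_mult_distrib[symmetric])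
        then show ?thesis by (simp add: power_mult_distrib)
      qed
      ultimately have "2 ^ k * norm (?d k x) \<le> sqrt c"
        by (simp add: real_le_rsqrt)
      then show ?thesis by (simp add: power_divide field_simps)
    qed
    have "summable (\<lambda>k. sqrt c * (1/2) ^ k)" by (intro summable_mult summable_geometric) auto
    then have "summable (\<lambda>k. ?d k x)" by (rule summable_comparison_test') (rule bound)
    then have "(\<lambda>n. \<Sum>k<n. ?d k x) \<longlonglongrightarrow> (\<Sum>k. ?d k x)" by (rule summable_LIMSEQ)
    then have "(\<lambda>n. (f (r n) x - f (r 0) x) + f (r 0) x) \<longlonglongrightarrow> (\<Sum>k. ?d k x) + f (r 0) x"
      unfolding sum_lessThan_telescope[of "\<lambda>k. f (r k) x"] by (intro tendsto_intros)
    then show ?case by (auto simp: convergent_def)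
  qed
  define F where "F x = lim (\<lambda>k. f (r k) x)" for x
  have [measurable]: "F \<in> borel_measurable M" unfolding F_def[abs_def] by measurable
  have lim: "AE x in M. (\<lambda>k. f (r k) x) \<longlonglongrightarrow> F x"
    using conv by eventually_elim (simp add: F_def convergent_LIMSEQ_iff)
  have fatou: "(\<integral>\<^sup>+x. ennreal ((norm (f m x - F x))\<^sup>2) \<partial>M) \<le> ennreal ((1/16) ^ k)" if m: "m \<ge> N k" for m k
  proof -
    have "(\<integral>\<^sup>+x. ennreal ((norm (f m x - F x))\<^sup>2) \<partial>M)
      = (\<integral>\<^sup>+x. liminf (\<lambda>j. ennreal ((norm (f m x - f (r j) x))\<^sup>2)) \<partial>M)"
    proof (rule nn_integral_cong_AE, use lim in eventually_elim)
      case (elim x)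
      have "(\<lambda>j. ennreal ((norm (f m x - f (r j) x))\<^sup>2)) \<longlonglongrightarrow> ennreal ((norm (f m x - F x))\<^sup>2)"
        by (intro tendsto_intros elim tendsto_ennrealI)
      then show ?case by (rule lim_imp_Liminf[OF sequentially_bot, symmetric])
    qed
    also have "\<dots> \<le> liminf (\<lambda>j. \<integral>\<^sup>+x. ennreal ((norm (f m x - f (r j) x))\<^sup>2) \<partial>M)"
      by (rule nn_integral_liminf) measurable
    also have "\<dots> \<le> liminf (\<lambda>j. ennreal ((1/16) ^ k))"
    proof (rule Liminf_mono)
      show "eventually (\<lambda>j. (\<integral>\<^sup>+x. ennreal ((norm (f m x - f (r j) x))\<^sup>2) \<partial>M) \<le> ennreal ((1/16) ^ k)) sequentially"
        unfolding eventually_sequentially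
      proof (intro exI[of _ "N k"] allI impI)
        fix j assume "N k \<le> j"
        then have "r j \<ge> N k" using rN(3)[of j] by linarith
        from N[OF m this] show "(\<integral>\<^sup>+x. ennreal ((norm (f m x - f (r j) x))\<^sup>2) \<partial>M) \<le> ennreal ((1/16) ^ k)"
          unfolding nn by (intro ennreal_leI) simp
      qed
    qed
    also have "\<dots> = ennreal ((1/16) ^ k)" by (simp add: Liminf_const)
    finally show ?thesis .
  qed
  have diffL2: "L2 M (\<lambda>x. f (N k) x - F x)" for k
    unfolding L2_def integrable_iff_bounded
    using fatou[OF order_refl, of k] by (auto intro: le_less_trans)
  have L2F: "L2 M F" using L2_diff[OF f diffL2, of "N 0" 0] by simp
  have "(\<lambda>k. LINT x|M. (norm (f k x - F x))\<^sup>2) \<longlonglongrightarrow> 0"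
  proof (rule LIMSEQ_I)
    fix e :: real assume "0 < e"
    then obtain k where k: "(1/16) ^ k < e" using real_arch_pow_inv[of e "1/16"] by auto
    show "\<exists>no. \<forall>n\<ge>no. norm ((LINT x|M. (norm (f n x - F x))\<^sup>2) - 0) < e"
    proof (intro exI[of _ "N k"] allI impI)
      fix n assume "N k \<le> n"
      from fatou[OF this] have "ennreal (LINT x|M. (norm (f n x - F x))\<^sup>2) \<le> ennreal ((1/16) ^ k)"
        using nn_integral_eq_integral[OF L2_D(2)[OF L2_diff[OF f L2F]], of n] by simp
      then show "norm ((LINT x|M. (norm (f n x - F x))\<^sup>2) - 0) < e" using k by (simp add: ennreal_le_iff[OF zero_le_power])
    qed
  qed
  with L2F show thesis by (rule that)
qed

section \<open>The Robin problem on a unit ball\<close>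

text \<open>The comparison of the Hausdorff measure on the sphere with the standard surface measure enters only
  through the constant \<open>\<kappa>\<close>, whose value is never needed.\<close>

locale robin_ball =
  fixes x0 :: "'a::euclidean_space" and \<kappa> \<beta> :: real
  assumes dim: "DIM('a) \<ge> 2" and kappa_pos: "0 < \<kappa>" and beta_pos: "0 < \<beta>"
    and divergence: "\<And>\<psi> G v. has_grad \<psi> G \<Longrightarrow> (LINT x|lebesgue_on (ball x0 1). G x \<bullet> v) =
      \<kappa> * (LINT x|surface_measure (ball x0 1). \<psi> x * ((x - x0) \<bullet> v))"
begin

abbreviation "vol \<equiv> lebesgue_on (ball x0 1)"
abbreviation "surf \<equiv> surface_measure (ball x0 1)"

lemma finite_vol: "finite_measure vol"
  by (rule finite_measure_lebesgue_on[OF lmeasurable_ball])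

lemma finite_surf: "finite_measure surf"
  by (rule finite_measure_surface_ball[OF dim])

lemma space_surf: "space surf = sphere x0 1"
  by (simp add: surface_measure_ball space_restrict_space)

lemma borel_measurable_vol:
  assumes "f \<in> borel_measurable borel" shows "f \<in> borel_measurable vol"
  using assms by (intro measurable_restrict_space1 measurable_completion) simp

lemma borel_measurable_surf:
  assumes "f \<in> borel_measurable borel" shows "f \<in> borel_measurable surf"
  unfolding surface_measure_def using assms
  by (intro measurable_restrict_space1) (simp cong: measurable_cong_sets)

lemma continuous_bound:
  fixes f :: "'a \<Rightarrow> 'b::euclidean_space"
  assumes "continuous_on UNIV f"
  obtains B where "\<And>x. x \<in> cball x0 1 \<Longrightarrow> norm (f x) \<le> B"
proof -
  obtain B where "\<And>x. norm x \<le> norm x0 + 1 \<Longrightarrow> norm (f x) \<le> B"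
    using continuous_bound_cball[OF assms, of "norm x0 + 1"] by blast
  moreover have "norm x \<le> norm x0 + 1" if "x \<in> cball x0 1" for x
    using that norm_triangle_ineq4[of x "x - x0"] norm_triangle_ineq[of x0 "x - x0"]
    by (simp add: dist_norm norm_minus_commute)
  ultimately show thesis using that by blast
qed

lemma
  fixes f :: "'a \<Rightarrow> 'b::euclidean_space"
  assumes "continuous_on UNIV f"
  shows integrable_vol: "integrable vol f" and integrable_surf: "integrable surf f"
proof -
  have [measurable]: "f \<in> borel_measurable borel" using assms by (rule borel_measurable_continuous_onI)
  obtain B where B: "\<And>x. x \<in> cball x0 1 \<Longrightarrow> norm (f x) \<le> B" using continuous_bound[OF assms] by blast
  show "integrable vol f"
    by (rule finite_measure.integrable_const_bound[OF finite_vol, of _ B])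
      (auto intro!: AE_I2 B borel_measurable_vol simp: space_restrict_space)
  show "integrable surf f"
    by (rule finite_measure.integrable_const_bound[OF finite_surf, of _ B])
      (auto intro!: AE_I2 B borel_measurable_surf simp: space_surf)
qed

lemma
  fixes f :: "'a \<Rightarrow> 'b::euclidean_space"
  assumes "continuous_on UNIV f"
  shows L2_vol: "L2 vol f" and L2_surf: "L2 surf f"
proof -
  have "continuous_on UNIV (\<lambda>x. (norm (f x))\<^sup>2)" by (intro continuous_intros assms)
  from integrable_vol[OF this] integrable_surf[OF this] show "L2 vol f" "L2 surf f"
    using borel_measurable_continuous_onI[OF assms]
    by (auto simp: L2_def borel_measurable_vol borel_measurable_surf)
qed

text \<open>The divergence theorem applied to \<phi>V coordinate by coordinate. \<open>A b\<close>
  is the gradient of the coordinate \<open>b\<close> of \<open>V\<close>, so the sum over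
  \<open>Basis\<close> is the divergence of \<open>V\<close>.\<close>

lemma green_identity:
  assumes \<phi>: "has_grad \<phi> G" and V: "\<And>b. b \<in> Basis \<Longrightarrow> has_grad (\<lambda>x. V x \<bullet> b) (A b)"
  shows "(LINT x|vol. G x \<bullet> V x + \<phi> x * (\<Sum>b\<in>Basis. A b x \<bullet> b)) = \<kappa> * (LINT x|surf. \<phi> x * (V x \<bullet> (x - x0)))"
proof -
  note cont = has_gradD(2,3)[OF \<phi>, of UNIV] has_gradD(2,3)[OF V, of _ UNIV]
  have eq: "G x \<bullet> V x + \<phi> x * (\<Sum>b\<in>Basis. A b x \<bullet> b) = (\<Sum>b\<in>Basis. (\<phi> x *\<^sub>R A b x + (V x \<bullet> b) *\<^sub>R G x) \<bullet> b)" for x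
    by (subst euclidean_inner) (simp add: inner_add_left sum.distrib sum_distrib_left mult.commute)
  have eq2: "\<phi> x * (V x \<bullet> (x - x0)) = (\<Sum>b\<in>Basis. (\<phi> x * (V x \<bullet> b)) * ((x - x0) \<bullet> b))" for x
    by (subst euclidean_inner) (simp add: sum_distrib_left mult.assoc)
  have "(LINT x|vol. (\<Sum>b\<in>Basis. (\<phi> x *\<^sub>R A b x + (V x \<bullet> b) *\<^sub>R G x) \<bullet> b))
      = (\<Sum>b\<in>Basis. (LINT x|vol. (\<phi> x *\<^sub>R A b x + (V x \<bullet> b) *\<^sub>R G x) \<bullet> b))"
    by (intro Bochner_Integration.integral_sum integrable_vol continuous_intros cont)
  also have "\<dots> = (\<Sum>b\<in>Basis. \<kappa> * (LINT x|surf. (\<phi> x * (V x \<bullet> b)) * ((x - x0) \<bullet> b)))"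
    by (intro sum.cong refl divergence has_grad_mult \<phi> V)
  also have "\<dots> = \<kappa> * (LINT x|surf. (\<Sum>b\<in>Basis. (\<phi> x * (V x \<bullet> b)) * ((x - x0) \<bullet> b)))"
    unfolding sum_distrib_left[symmetric]
    by (intro arg_cong[of _ _ "(*) \<kappa>"] Bochner_Integration.integral_sum[symmetric] integrable_surf continuous_intros cont)
  finally show ?thesis unfolding eq eq2 .
qed

text \<open>Integrate the divergence of \<open>\<phi>\<^sup>2 (x - x\<^sub>0)\<close>.\<close>

lemma poincare:
  assumes \<phi>: "has_grad \<phi> G"
  shows "(LINT x|vol. (\<phi> x)\<^sup>2) \<le> (LINT x|vol. (norm (G x))\<^sup>2) + \<kappa> * (LINT x|surf. (\<phi> x)\<^sup>2)"
proof -
  note cont = has_gradD(2,3)[OF \<phi>, of UNIV]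
  have sq: "has_grad (\<lambda>x. \<phi> x * \<phi> x) (\<lambda>x. \<phi> x *\<^sub>R G x + \<phi> x *\<^sub>R G x)" by (rule has_grad_mult[OF \<phi> \<phi>])
  have "(LINT x|vol. (\<phi> x *\<^sub>R G x + \<phi> x *\<^sub>R G x) \<bullet> (x - x0) + \<phi> x * \<phi> x * (\<Sum>b\<in>(Basis :: 'a set). b \<bullet> b))
      = \<kappa> * (LINT x|surf. \<phi> x * \<phi> x * ((x - x0) \<bullet> (x - x0)))"
    by (rule green_identity[OF sq, of "\<lambda>x. x - x0" "\<lambda>b x. b"]) (rule has_grad_inner)
  also have "(LINT x|surf. \<phi> x * \<phi> x * ((x - x0) \<bullet> (x - x0))) = (LINT x|surf. (\<phi> x)\<^sup>2)"
    by (intro Bochner_Integration.integral_cong)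
      (auto simp: space_surf dist_norm norm_minus_commute power2_norm_eq_inner[symmetric] power2_eq_square[of "\<phi> _"])
  finally have div: "(LINT x|vol. 2 * \<phi> x * (G x \<bullet> (x - x0)) + real DIM('a) * (\<phi> x)\<^sup>2) = \<kappa> * (LINT x|surf. (\<phi> x)\<^sup>2)"
    by (simp add: inner_add_left power2_eq_square mult_ac)
  have "(LINT x|vol. (\<phi> x)\<^sup>2 - (norm (G x))\<^sup>2) \<le> (LINT x|vol. 2 * \<phi> x * (G x \<bullet> (x - x0)) + real DIM('a) * (\<phi> x)\<^sup>2)"
  proof (rule integral_mono)
    fix x assume "x \<in> space vol"
    then have "norm (x - x0) \<le> 1" by (simp add: space_restrict_space dist_norm norm_minus_commute)
    then have "\<bar>G x \<bullet> (x - x0)\<bar> \<le> norm (G x)"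
      using Cauchy_Schwarz_ineq2[of "G x" "x - x0"] mult_left_le[of "norm (x - x0)" "norm (G x)"] by simp
    then have "\<bar>\<phi> x * (G x \<bullet> (x - x0))\<bar> \<le> \<bar>\<phi> x\<bar> * norm (G x)"
      unfolding abs_mult by (intro mult_left_mono) auto
    moreover have "2 * (\<bar>\<phi> x\<bar> * norm (G x)) \<le> (\<phi> x)\<^sup>2 + (norm (G x))\<^sup>2"
      using sum_squares_bound[of "\<bar>\<phi> x\<bar>" "norm (G x)"] by simp
    \<comment> \<open>The estimate of the mixed term consumes one \<open>(\<phi> x)\<^sup>2\<close>;
      dimension at least 2 leaves another one for the left-hand side.\<close>
    moreover have "2 * (\<phi> x)\<^sup>2 \<le> real DIM('a) * (\<phi> x)\<^sup>2"
      using dim by (intro mult_right_mono) auto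
    ultimately show "(\<phi> x)\<^sup>2 - (norm (G x))\<^sup>2 \<le> 2 * \<phi> x * (G x \<bullet> (x - x0)) + real DIM('a) * (\<phi> x)\<^sup>2"
      by linarith
  qed (intro integrable_vol continuous_intros cont)+
  then show ?thesis
    unfolding div by (subst (asm) Bochner_Integration.integral_diff) (auto intro!: integrable_vol continuous_intros cont)
qed

lemma smooth_imp_has_grad: "smooth \<phi> \<Longrightarrow> has_grad \<phi> (grad \<phi>)"
  by (rule C_1_has_grad) (simp only: smooth_def)

text \<open>A \<open>C\<^sup>1\<close> function of compact support is Lipschitz: a point of the support and a point at distance
  at least \<open>1\<close> from it are handled by boundedness.\<close>

lemma compact_support_lipschitz:
  assumes \<phi>: "has_grad \<phi> G" and supp: "\<And>x. norm x > r \<Longrightarrow> \<phi> x = 0"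
  obtains L where "\<And>x y. \<bar>\<phi> x - \<phi> y\<bar> \<le> L * norm (x - y)"
proof -
  obtain K where K: "0 < K" "\<And>x y. norm x \<le> r + 1 \<Longrightarrow> norm y \<le> r + 1 \<Longrightarrow> \<bar>\<phi> x - \<phi> y\<bar> \<le> K * norm (x - y)"
    using has_grad_lipschitz[OF \<phi>, of "r + 1"] by blast
  obtain N where N: "0 < N" "\<And>x. norm x \<le> r + 1 \<Longrightarrow> norm (\<phi> x) \<le> N"
    using continuous_bound_cball[OF has_gradD(3)[OF \<phi>], of "r + 1"] by blast
  have far: "\<bar>\<phi> x - \<phi> y\<bar> \<le> (K + N) * norm (x - y)" if "norm x > r + 1" for x y
  proof (cases "norm y > r")
    case True
    then show ?thesis using supp[of x] supp[of y] that K N by simp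
  next
    case False
    then have "1 \<le> norm (x - y)" using that norm_triangle_ineq2[of x y] by linarith
    then have "(K + N) * 1 \<le> (K + N) * norm (x - y)" using K N by (intro mult_left_mono) auto
    then show ?thesis using supp[of x] N(2)[of y] False that K(1) by simp
  qed
  have "\<bar>\<phi> x - \<phi> y\<bar> \<le> (K + N) * norm (x - y)" for x y
  proof -
    consider "norm x > r + 1" | "norm y > r + 1" | "norm x \<le> r + 1" "norm y \<le> r + 1" by linarith
    then show ?thesis
    proof cases
      case 2
      then show ?thesis using far[of y x] by (simp add: abs_minus_commute norm_minus_commute)
    next
      case 3
      have "K * norm (x - y) \<le> (K + N) * norm (x - y)" using N by (intro mult_right_mono) auto
      then show ?thesis using K(2)[OF 3] by linarith
    qed (rule far)
  qed
  then show thesis by (rule that)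
qed

text \<open>The test function takes the role of the Lipschitz function of compact support, and its
  support lies in the ball, so the integrals may be taken over the whole space.\<close>

lemma integral_by_parts_test_function:
  assumes \<phi>: "has_grad \<phi> G" and \<eta>: "test_function (ball x0 1) \<eta>"
  shows "(LINT x|vol. \<phi> x * (grad \<eta> x \<bullet> b)) = - (LINT x|vol. (G x \<bullet> b) * \<eta> x)"
proof -
  have g: "has_grad \<eta> (grad \<eta>)" using \<eta> by (simp add: test_function_def smooth_imp_has_grad)
  obtain K where K: "compact K" "K \<subseteq> ball x0 1" "\<And>x. x \<notin> K \<Longrightarrow> \<eta> x = 0"
    using \<eta> by (auto simp: test_function_def)
  have gK: "grad \<eta> x = 0" if "x \<notin> K" for x
  proof -
    have "((\<lambda>x. 0) has_derivative (\<lambda>h. 0)) (at x)" by simp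
    then have "(\<eta> has_derivative (\<lambda>h. 0)) (at x)"
      by (rule has_derivative_transform_within_open[of _ _ _ _ "- K"])
        (use K that in \<open>auto simp: compact_imp_closed open_Compl\<close>)
    then have "(\<lambda>h. grad \<eta> x \<bullet> h) = (\<lambda>h. 0)"
      using has_gradD(1)[OF g] has_derivative_unique by blast
    then show ?thesis by (metis inner_eq_zero_iff)
  qed
  obtain r where r: "\<And>x. x \<in> K \<Longrightarrow> norm x \<le> r"
    using compact_imp_bounded[OF K(1)] by (auto simp: bounded_iff)
  have supp: "\<eta> x = 0" if "norm x > r" for x using r[of x] that K(3)[of x] by fastforce
  obtain L where L: "\<And>x y. \<bar>\<eta> x - \<eta> y\<bar> \<le> L * norm (x - y)"
    using compact_support_lipschitz[OF g supp] by blast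
  have [measurable]: "G \<in> borel_measurable borel" "\<phi> \<in> borel_measurable borel"
    "grad \<eta> \<in> borel_measurable borel" "\<eta> \<in> borel_measurable borel"
    using has_gradD(2,3)[OF \<phi>] has_gradD(2,3)[OF g] by (auto intro: borel_measurable_continuous_onI)
  have [measurable]: "ball x0 1 \<in> sets borel" by simp
  have vol: "(LINT x|vol. f x) = (LINT x|lborel. f x)"
    if [measurable]: "f \<in> borel_measurable borel" and f: "\<And>x. x \<notin> K \<Longrightarrow> f x = 0" for f :: "'a \<Rightarrow> real"
  proof -
    have "(LINT x|vol. f x) = (LINT x|lebesgue. indicator (ball x0 1) x *\<^sub>R f x)"
      by (subst integral_restrict_space) auto
    also have "\<dots> = (LINT x|lborel. indicator (ball x0 1) x *\<^sub>R f x)"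
      by (rule integral_completion) measurable
    also have "\<dots> = (LINT x|lborel. f x)"
    proof (intro Bochner_Integration.integral_cong refl)
      fix x show "indicator (ball x0 1) x *\<^sub>R f x = f x"
        using K(2) f[of x] by (cases "x \<in> K") auto
    qed
    finally show ?thesis .
  qed
  have "(LINT x|lborel. \<eta> x * (G x \<bullet> b)) = - (LINT x|lborel. (grad \<eta> x \<bullet> b) * \<phi> x)"
  proof (rule integral_lipschitz_by_parts[OF supp L _ _ \<phi>])
    show "AE x in lborel. (\<lambda>k. real (Suc k) * (\<eta> (x + (1 / real (Suc k)) *\<^sub>R b) - \<eta> x)) \<longlonglongrightarrow> grad \<eta> x \<bullet> b"
      by (rule AE_I2, rule has_derivative_imp_quotient_tendsto[OF has_gradD(1)[OF g]])
  qed measurable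
  then show ?thesis
    using K(3) gK by (subst (1 2) vol) (auto simp: mult.commute)
qed

text \<open>The distributional gradient comes for free: integration by parts holds for each
  approximating function and survives the L^2 limits of functions and gradients.\<close>

lemma H1_dataI:
  assumes \<phi>: "\<And>k. has_grad (\<phi> k) (D k)"
    and L2: "L2 vol u" "L2 vol G" "L2 surf w"
    and u: "(\<lambda>k. LINT x|vol. (norm (\<phi> k x - u x))\<^sup>2) \<longlonglongrightarrow> 0"
    and G: "(\<lambda>k. LINT x|vol. (norm (D k x - G x))\<^sup>2) \<longlonglongrightarrow> 0"
    and w: "(\<lambda>k. LINT x|surf. (norm (\<phi> k x - w x))\<^sup>2) \<longlonglongrightarrow> 0"
  shows "H1_data (ball x0 1) u G w"
  unfolding H1_data_def weak_gradient_def
proof (intro conjI L2 allI impI ballI exI[of _ \<phi>])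
  show "C_k 1 (\<phi> k)" for k by (rule has_grad_C_1[OF \<phi>])
  have gr: "grad (\<phi> k) = D k" for k by (rule has_grad_grad[OF \<phi>])
  show "(\<lambda>k. LINT x|vol. (\<phi> k x - u x)\<^sup>2) \<longlonglongrightarrow> 0" "(\<lambda>k. LINT x|vol. (norm (grad (\<phi> k) x - G x))\<^sup>2) \<longlonglongrightarrow> 0"
    "(\<lambda>k. LINT x|surf. (\<phi> k x - w x)\<^sup>2) \<longlonglongrightarrow> 0"
    using u G w by (simp_all add: gr)
  fix \<eta> b assume \<eta>: "test_function (ball x0 1) \<eta>" and b: "b \<in> (Basis :: 'a set)"
  have g: "has_grad \<eta> (grad \<eta>)" using \<eta> by (simp add: test_function_def smooth_imp_has_grad)
  have 1: "L2 vol (\<lambda>x. grad \<eta> x \<bullet> b)" "L2 vol (\<lambda>x. \<eta> x *\<^sub>R b)"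
    by (intro L2_vol continuous_intros has_gradD[OF g])+
  have "(\<lambda>k. LINT x|vol. \<phi> k x \<bullet> (grad \<eta> x \<bullet> b)) \<longlonglongrightarrow> (LINT x|vol. u x \<bullet> (grad \<eta> x \<bullet> b))"
    by (intro L2_tendsto_inner L2_vol has_gradD(3)[OF \<phi>] L2 1 u)
  moreover have "(\<lambda>k. - (LINT x|vol. D k x \<bullet> (\<eta> x *\<^sub>R b))) \<longlonglongrightarrow> - (LINT x|vol. G x \<bullet> (\<eta> x *\<^sub>R b))"
    by (intro tendsto_minus L2_tendsto_inner L2_vol has_gradD(2)[OF \<phi>] L2 1 G)
  moreover have "(LINT x|vol. \<phi> k x \<bullet> (grad \<eta> x \<bullet> b)) = - (LINT x|vol. D k x \<bullet> (\<eta> x *\<^sub>R b))" for k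
    using integral_by_parts_test_function[OF \<phi> \<eta>, of k b] by (simp add: mult.commute)
  ultimately have "(LINT x|vol. u x \<bullet> (grad \<eta> x \<bullet> b)) = - (LINT x|vol. G x \<bullet> (\<eta> x *\<^sub>R b))"
    using LIMSEQ_unique by simp
  then show "(LINT x|vol. u x * frechet_derivative \<eta> (at x) b) = - (LINT x|vol. (G x \<bullet> b) * \<eta> x)"
    by (simp add: has_grad_frechet[OF g] mult.commute)
qed

lemma has_grad_H1_data:
  assumes "has_grad \<phi> G" shows "H1_data (ball x0 1) \<phi> G \<phi>"
  by (rule H1_dataI[of "\<lambda>_. \<phi>" "\<lambda>_. G"])
    (use assms in \<open>auto intro!: L2_vol L2_surf has_gradD[OF assms]\<close>)

end

section \<open>The Robin form, its energy and existence of solutions\<close>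

context robin_ball
begin

text \<open>Gradients and traces are separate arguments, since \<open>H1_data\<close> determines
  them from the function only up to null sets.\<close>

definition aform :: "('a \<Rightarrow> 'a) \<Rightarrow> ('a \<Rightarrow> real) \<Rightarrow> ('a \<Rightarrow> 'a) \<Rightarrow> ('a \<Rightarrow> real) \<Rightarrow> real" where
  "aform G w H h = (LINT x|vol. G x \<bullet> H x) + \<beta> * (LINT x|surf. w x * h x)"

definition energy :: "('a \<Rightarrow> real) \<Rightarrow> ('a \<Rightarrow> real) \<Rightarrow> ('a \<Rightarrow> 'a) \<Rightarrow> ('a \<Rightarrow> real) \<Rightarrow> real" where
  "energy g u G w = 1/2 * (LINT x|vol. (norm (G x))\<^sup>2) + \<beta>/2 * (LINT x|surf. (w x)\<^sup>2) - (LINT x|vol. g x * u x)"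

lemma aform_self: "aform G w G w = (LINT x|vol. (norm (G x))\<^sup>2) + \<beta> * (LINT x|surf. (w x)\<^sup>2)"
  by (simp add: aform_def power2_norm_eq_inner power2_eq_square[of "w _"])

lemma energy_eq: "energy g u G w = 1/2 * aform G w G w - (LINT x|vol. g x * u x)"
  by (simp add: energy_def aform_self field_simps)

lemma aform_nonneg: "0 \<le> aform G w G w"
  unfolding aform_self using beta_pos by simp

lemma robin_J_eq: "robin_J \<beta> g (ball x0 1) = (INF (u, G, w)\<in>{(u, G, w). H1_data (ball x0 1) u G w}. ereal (energy g u G w))"
  unfolding robin_J_def energy_def by simp

lemma H1_dataD:
  assumes "H1_data (ball x0 1) u G w" shows "L2 vol u" "L2 vol G" "L2 surf w"
  using assms by (auto simp: H1_data_def weak_gradient_def)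

lemma L2_mult_integrable:
  fixes f g :: "'c \<Rightarrow> real"
  assumes "L2 M f" "L2 M g" shows "integrable M (\<lambda>x. f x * g x)"
  using L2_inner_integrable[OF assms] by simp

text \<open>The energy along a line is a quadratic polynomial in \<open>t\<close>. It is evaluated
  at 1 and 1/2 for the midpoint argument and at a multiple of the residual for the weak
  equation.\<close>

lemma energy_expand:
  assumes g: "L2 vol g" and u: "L2 vol u" "L2 vol G" "L2 surf w" and v: "L2 vol v" "L2 vol H" "L2 surf h"
  shows "energy g (\<lambda>x. u x + t * v x) (\<lambda>x. G x + t *\<^sub>R H x) (\<lambda>x. w x + t * h x) =
    energy g u G w + t * (aform G w H h - (LINT x|vol. g x * v x)) + t\<^sup>2 / 2 * aform H h H h"
proof -
  have "(LINT x|surf. (w x + t * h x)\<^sup>2) =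
    (LINT x|surf. (w x)\<^sup>2) + 2 * t * (LINT x|surf. w x * h x) + t\<^sup>2 * (LINT x|surf. (h x)\<^sup>2)"
    using L2_integral_norm_lincomb[OF u(3) v(3), of t] by simp
  moreover have "(LINT x|vol. g x * (u x + t * v x)) = (LINT x|vol. g x * u x) + t * (LINT x|vol. g x * v x)"
    using L2_mult_integrable[OF g u(1)] L2_mult_integrable[OF g v(1)]
    by (simp add: distrib_left mult.left_commute)
  moreover have "(LINT x|vol. (norm (G x + t *\<^sub>R H x))\<^sup>2) =
    (LINT x|vol. (norm (G x))\<^sup>2) + 2 * t * (LINT x|vol. G x \<bullet> H x) + t\<^sup>2 * (LINT x|vol. (norm (H x))\<^sup>2)"
    by (rule L2_integral_norm_lincomb[OF u(2) v(2)])
  ultimately show ?thesis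
    unfolding energy_def aform_self by (simp add: aform_def field_simps)
qed

lemma has_grad_L2:
  assumes "has_grad \<phi> D" shows "L2 vol \<phi>" "L2 vol D" "L2 surf \<phi>"
  using has_gradD[OF assms] by (auto intro: L2_vol L2_surf)

text \<open>Chosen with \<open>1 \<le> pc\<close> and \<open>\<kappa> \<le> pc * \<beta>\<close>, so
  that \<open>pc\<close> times the Robin form dominates the right-hand side of
  \<open>poincare\<close>.\<close>

definition pc :: real where "pc = 1 + \<kappa> / \<beta>"

lemma poincare_aform:
  assumes "has_grad \<phi> D" shows "(LINT x|vol. (\<phi> x)\<^sup>2) \<le> pc * aform D \<phi> D \<phi>"
proof -
  have "(LINT x|vol. (\<phi> x)\<^sup>2) \<le> (LINT x|vol. (norm (D x))\<^sup>2) + \<kappa> * (LINT x|surf. (\<phi> x)\<^sup>2)"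
    by (rule poincare[OF assms])
  also have "\<dots> \<le> pc * (LINT x|vol. (norm (D x))\<^sup>2) + (pc * \<beta>) * (LINT x|surf. (\<phi> x)\<^sup>2)"
  proof -
    have "1 \<le> pc" "\<kappa> \<le> pc * \<beta>" using kappa_pos beta_pos by (auto simp: pc_def field_simps)
    then have "1 * (LINT x|vol. (norm (D x))\<^sup>2) \<le> pc * (LINT x|vol. (norm (D x))\<^sup>2)"
        "\<kappa> * (LINT x|surf. (\<phi> x)\<^sup>2) \<le> (pc * \<beta>) * (LINT x|surf. (\<phi> x)\<^sup>2)"
      by (intro mult_right_mono; simp)+
    then show ?thesis by simp
  qed
  finally show ?thesis unfolding aform_self by (simp add: algebra_simps)
qed

text \<open>By the definition of \<open>H1_data\<close>, \<open>C_k 1\<close> functions approximate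
  \<open>v\<close> together with its gradient and trace, and both sides are L^2 continuous in
  these.\<close>

lemma weak_form_H1:
  assumes u: "H1_data (ball x0 1) u G w" and g: "L2 vol g"
    and weak: "\<And>\<psi> D. has_grad \<psi> D \<Longrightarrow> aform G w D \<psi> = (LINT x|vol. g x * \<psi> x)"
    and v: "H1_data (ball x0 1) v H h"
  shows "aform G w H h = (LINT x|vol. g x * v x)"
proof -
  obtain \<phi> where \<phi>: "\<And>k. C_k 1 (\<phi> k)" "(\<lambda>k. LINT x|vol. (\<phi> k x - v x)\<^sup>2) \<longlonglongrightarrow> 0"
      "(\<lambda>k. LINT x|vol. (norm (grad (\<phi> k) x - H x))\<^sup>2) \<longlonglongrightarrow> 0"
      "(\<lambda>k. LINT x|surf. (\<phi> k x - h x)\<^sup>2) \<longlonglongrightarrow> 0"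
    using v unfolding H1_data_def by blast
  have gr: "has_grad (\<phi> k) (grad (\<phi> k))" for k by (rule C_1_has_grad[OF \<phi>(1)])
  note U = H1_dataD[OF u] note V = H1_dataD[OF v] note P = has_grad_L2[OF gr]
  have "(\<lambda>k. LINT x|vol. grad (\<phi> k) x \<bullet> G x) \<longlonglongrightarrow> (LINT x|vol. H x \<bullet> G x)"
    by (rule L2_tendsto_inner[OF P(2) V(2) U(2) \<phi>(3)])
  moreover have "(\<lambda>k. LINT x|surf. \<phi> k x \<bullet> w x) \<longlonglongrightarrow> (LINT x|surf. h x \<bullet> w x)"
    by (rule L2_tendsto_inner[OF P(3) V(3) U(3)]) (use \<phi>(4) in simp)
  ultimately have "(\<lambda>k. aform G w (grad (\<phi> k)) (\<phi> k)) \<longlonglongrightarrow> aform G w H h"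
    unfolding aform_def by (intro tendsto_intros) (simp_all add: inner_commute mult.commute)
  moreover have "(\<lambda>k. LINT x|vol. \<phi> k x \<bullet> g x) \<longlonglongrightarrow> (LINT x|vol. v x \<bullet> g x)"
    by (rule L2_tendsto_inner[OF P(1) V(1) g]) (use \<phi>(2) in simp)
  then have "(\<lambda>k. aform G w (grad (\<phi> k)) (\<phi> k)) \<longlonglongrightarrow> (LINT x|vol. g x * v x)"
    by (simp add: weak[OF gr] mult.commute)
  ultimately show ?thesis by (rule LIMSEQ_unique)
qed

lemma robin_solutionI:
  assumes u: "H1_data (ball x0 1) u G w" and g: "L2 vol g"
    and weak: "\<And>\<psi> D. has_grad \<psi> D \<Longrightarrow> aform G w D \<psi> = (LINT x|vol. g x * \<psi> x)"
  shows "robin_solution (ball x0 1) g \<beta> u"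
  unfolding robin_solution_def using u weak_form_H1[OF assms] by (auto simp: aform_def)

lemma robin_solution_weak:
  assumes "robin_solution (ball x0 1) g \<beta> u"
  obtains G w where "H1_data (ball x0 1) u G w"
    "\<And>v H h. H1_data (ball x0 1) v H h \<Longrightarrow> aform G w H h = (LINT x|vol. g x * v x)"
  using assms unfolding robin_solution_def aform_def by blast

text \<open>Completing the square: the energy of \<open>v\<close> exceeds that of the solution by
  half the form of the difference, and at the solution half of the linear term cancels.\<close>

lemma energy_minimal:
  assumes g: "L2 vol g" and u: "H1_data (ball x0 1) u G w"
    and weak: "\<And>v H h. H1_data (ball x0 1) v H h \<Longrightarrow> aform G w H h = (LINT x|vol. g x * v x)"
  shows "robin_J \<beta> g (ball x0 1) = ereal (- 1/2 * (LINT x|vol. g x * u x))"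
proof (rule antisym)
  have self: "energy g u G w = - 1/2 * (LINT x|vol. g x * u x)"
    unfolding energy_eq weak[OF u] by simp
  show "robin_J \<beta> g (ball x0 1) \<le> ereal (- 1/2 * (LINT x|vol. g x * u x))"
    unfolding robin_J_eq self[symmetric] using u by (intro INF_lower2[of "(u, G, w)"]) auto
  show "ereal (- 1/2 * (LINT x|vol. g x * u x)) \<le> robin_J \<beta> g (ball x0 1)"
    unfolding robin_J_eq
  proof (rule INF_greatest, clarify)
    fix v H h assume v: "H1_data (ball x0 1) v H h"
    note U = H1_dataD[OF u] note V = H1_dataD[OF v]
    have d: "L2 vol (\<lambda>x. v x - u x)" "L2 vol (\<lambda>x. H x - G x)" "L2 surf (\<lambda>x. h x - w x)"
      by (intro L2_diff U V)+
    have "aform G w (\<lambda>x. H x - G x) (\<lambda>x. h x - w x) = aform G w H h - aform G w G w"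
      using L2_inner_integrable[OF U(2) V(2)] L2_inner_integrable[OF U(2) U(2)]
        L2_mult_integrable[OF U(3) V(3)] L2_mult_integrable[OF U(3) U(3)]
      by (simp add: aform_def inner_diff_right right_diff_distrib)
    also have "\<dots> = (LINT x|vol. g x * v x) - (LINT x|vol. g x * u x)"
      using weak[OF v] weak[OF u] by simp
    also have "\<dots> = (LINT x|vol. g x * (v x - u x))"
      using L2_mult_integrable[OF g U(1)] L2_mult_integrable[OF g V(1)] by (simp add: right_diff_distrib)
    finally have "energy g v H h = energy g u G w
        + 1/2 * aform (\<lambda>x. H x - G x) (\<lambda>x. h x - w x) (\<lambda>x. H x - G x) (\<lambda>x. h x - w x)"
      using energy_expand[OF g U d, of 1] by simp
    then show "ereal (- 1/2 * (LINT x|vol. g x * u x)) \<le> ereal (energy g v H h)"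
      unfolding self[symmetric] using aform_nonneg by simp
  qed
qed

text \<open>Direct method over \<open>C_k 1\<close> functions. A minimising sequence is Cauchy for
  the Robin form by the midpoint argument, hence functions, gradients and traces converge in L^2,
  and the limits satisfy the weak equation because the residuals along the sequence tend to
  0.\<close>

lemma exists_robin_solution:
  assumes g: "L2 vol g"
  shows "\<exists>u. robin_solution (ball x0 1) g \<beta> u"
proof -
  define c where "c = (LINT x|vol. (g x)\<^sup>2)"
  have pc0: "0 < pc" using kappa_pos beta_pos by (simp add: pc_def add_pos_pos)
  have c0: "0 \<le> c" by (simp add: c_def)
  let ?E = "\<lambda>(\<phi>, D). energy g \<phi> D \<phi>" and ?P = "{(\<phi>, D). has_grad \<phi> D}"
  \<comment> \<open>Cauchy-Schwarz, \<open>poincare_aform\<close> and the inequality of arithmetic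
    and geometric means bound the linear term by \<open>(A + c * pc) / 2\<close>; the half of the
    form it costs is just what the energy offers.\<close>
  have lower: "- (c * pc / 2) \<le> energy g \<phi> D \<phi>" if \<phi>: "has_grad \<phi> D" for \<phi> D
  proof -
    define A l where "A = aform D \<phi> D \<phi>" and "l = (LINT x|vol. g x * \<phi> x)"
    have A0: "0 \<le> A" unfolding A_def by (rule aform_nonneg)
    have "l\<^sup>2 \<le> c * (LINT x|vol. (\<phi> x)\<^sup>2)"
      using L2_Cauchy_Schwarz[OF g has_grad_L2(1)[OF \<phi>]] by (simp add: l_def c_def)
    also have "\<dots> \<le> c * (pc * A)" unfolding A_def by (intro mult_left_mono poincare_aform \<phi> c0)
    also have "\<dots> \<le> ((A + c * pc) / 2)\<^sup>2"
      using zero_le_power2[of "A - c * pc"] by (simp add: power2_eq_square field_simps)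
    finally have "\<bar>l\<bar> \<le> \<bar>(A + c * pc) / 2\<bar>" by (simp only: abs_le_square_iff)
    moreover have "0 \<le> (A + c * pc) / 2" using A0 c0 pc0 by simp
    ultimately have "l \<le> (A + c * pc) / 2" by linarith
    then show ?thesis unfolding energy_eq A_def[symmetric] l_def[symmetric] by (simp add: field_simps)
  qed
  define m where "m = Inf (?E ` ?P)"
  have bdd: "bdd_below (?E ` ?P)" by (rule bdd_belowI[of _ "- (c * pc / 2)"]) (auto intro: lower)
  have ne: "?P \<noteq> {}" using has_grad_const[of 0] by auto
  have m_le: "m \<le> energy g \<phi> D \<phi>" if "has_grad \<phi> D" for \<phi> D
    unfolding m_def using that by (intro cInf_lower[OF _ bdd] image_eqI[of _ _ "(\<phi>, D)"]) auto
  have "\<exists>p. has_grad (fst p) (snd p) \<and> energy g (fst p) (snd p) (fst p) < m + 1 / real (Suc k)" for k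
  proof -
    have "Inf (?E ` ?P) < m + 1 / real (Suc k)" by (simp add: m_def)
    then obtain y where y: "y \<in> ?E ` ?P" "y < m + 1 / real (Suc k)"
      using ne cInf_less_iff[OF _ bdd] by blast
    then obtain p where "p \<in> ?P" "y = ?E p" by blast
    with y show ?thesis by (intro exI[of _ p]) (simp add: case_prod_beta)
  qed
  then obtain p where p: "\<And>k. has_grad (fst (p k)) (snd (p k)) \<and>
      energy g (fst (p k)) (snd (p k)) (fst (p k)) < m + 1 / real (Suc k)" by metis
  define \<phi> D where "\<phi> k = fst (p k)" and "D k = snd (p k)" for k
  have \<phi>: "has_grad (\<phi> k) (D k)" and min: "energy g (\<phi> k) (D k) (\<phi> k) < m + 1 / real (Suc k)" for k
    using p by (simp_all add: \<phi>_def D_def)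
  note P = has_grad_L2[OF \<phi>]
  define \<epsilon> where "\<epsilon> k = 1 / real (Suc k)" for k
  have \<epsilon>: "0 < \<epsilon> k" for k by (simp add: \<epsilon>_def)
  have \<epsilon>lim: "\<epsilon> \<longlonglongrightarrow> 0" unfolding \<epsilon>_def[abs_def] using LIMSEQ_inverse_real_of_nat by (simp add: inverse_eq_divide)
  define Q where "Q i j = aform (\<lambda>x. D i x - D j x) (\<lambda>x. \<phi> i x - \<phi> j x) (\<lambda>x. D i x - D j x) (\<lambda>x. \<phi> i x - \<phi> j x)" for i j
  have grd: "has_grad (\<lambda>x. \<phi> i x - \<phi> j x) (\<lambda>x. D i x - D j x)" for i j
    by (rule has_grad_cong[OF has_grad_add[OF \<phi>[of i] has_grad_cmult[OF \<phi>[of j], of "-1"]]]) auto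
  \<comment> \<open>The midpoint of the two functions has energy at least \<open>m\<close>.
    Eliminating the linear term \<open>d\<close> from the expansions at 1 and 1/2 gives
    \<open>m \<le> (E i + E j) / 2 - Q i j / 8\<close>.\<close>
  have Q: "Q i j \<le> 4 * (\<epsilon> i + \<epsilon> j)" for i j
  proof -
    let ?v = "\<lambda>x. \<phi> i x - \<phi> j x" and ?H = "\<lambda>x. D i x - D j x"
    note V = has_grad_L2[OF grd, of i j]
    have mid: "has_grad (\<lambda>x. \<phi> j x + 1/2 * ?v x) (\<lambda>x. D j x + (1/2) *\<^sub>R ?H x)"
      by (intro has_grad_add has_grad_cmult \<phi> grd)
    define d where "d = aform (D j) (\<phi> j) ?H ?v - (LINT x|vol. g x * ?v x)"
    define E where "E k = energy g (\<phi> k) (D k) (\<phi> k)" for k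
    have "E i = E j + d + 1/2 * Q i j"
      using energy_expand[OF g P[of j] V, of 1] by (simp add: Q_def E_def d_def)
    moreover have "m \<le> E j + 1/2 * d + 1/8 * Q i j"
      using m_le[OF mid] unfolding energy_expand[OF g P[of j] V, of "1/2"]
      by (simp add: Q_def E_def d_def power2_eq_square)
    moreover have "E i < m + \<epsilon> i" "E j < m + \<epsilon> j"
      using min[of i] min[of j] by (simp_all only: E_def \<epsilon>_def)
    ultimately show ?thesis by argo
  qed
  have cauchy: "\<exists>N. \<forall>m\<ge>N. \<forall>n\<ge>N. F m n < e"
    if e: "0 < e" and K: "0 < K" and F: "\<And>i j. F i j \<le> K * Q i j" for F :: "nat \<Rightarrow> nat \<Rightarrow> real" and K e
  proof -
    have "0 < e / (8 * K)" using e K by simp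
    then have "eventually (\<lambda>k. \<epsilon> k < e / (8 * K)) sequentially"
      by (rule order_tendstoD(2)[OF \<epsilon>lim])
    then obtain N where N: "\<forall>k\<ge>N. \<epsilon> k < e / (8 * K)"
      unfolding eventually_sequentially ..
    show ?thesis
    proof (intro exI[of _ N] allI impI)
      fix i j assume "i \<ge> N" "j \<ge> N"
      then have "\<epsilon> i < e / (8 * K)" "\<epsilon> j < e / (8 * K)" using N by simp_all
      then have "4 * (\<epsilon> i + \<epsilon> j) < 4 * (e / (8 * K) + e / (8 * K))" by argo
      also have "\<dots> = e / K" by (simp add: field_simps)
      finally have "Q i j < e / K" using Q[of i j] by linarith
      then have "K * Q i j < e" using K by (simp add: field_simps)
      then show "F i j < e" using F[of i j] by linarith
    qed
  qed
  have bounds: "(LINT x|vol. (norm (\<phi> i x - \<phi> j x))\<^sup>2) \<le> pc * Q i j"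
      "(LINT x|vol. (norm (D i x - D j x))\<^sup>2) \<le> 1 * Q i j"
      "(LINT x|surf. (norm (\<phi> i x - \<phi> j x))\<^sup>2) \<le> 1 / \<beta> * Q i j" for i j
  proof -
    have nn: "0 \<le> (LINT x|vol. (norm (D i x - D j x))\<^sup>2)" "0 \<le> (LINT x|surf. (\<phi> i x - \<phi> j x)\<^sup>2)" by simp_all
    have Q_eq: "Q i j = (LINT x|vol. (norm (D i x - D j x))\<^sup>2) + \<beta> * (LINT x|surf. (\<phi> i x - \<phi> j x)\<^sup>2)"
      unfolding Q_def aform_self ..
    show "(LINT x|vol. (norm (\<phi> i x - \<phi> j x))\<^sup>2) \<le> pc * Q i j"
      using poincare_aform[OF grd, of i j] by (simp add: Q_def)
    show "(LINT x|vol. (norm (D i x - D j x))\<^sup>2) \<le> 1 * Q i j"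
      unfolding Q_eq using nn beta_pos by simp
    show "(LINT x|surf. (norm (\<phi> i x - \<phi> j x))\<^sup>2) \<le> 1 / \<beta> * Q i j"
      unfolding Q_eq using nn beta_pos by (simp add: distrib_left)
  qed
  obtain u where u: "L2 vol u" "(\<lambda>k. LINT x|vol. (norm (\<phi> k x - u x))\<^sup>2) \<longlonglongrightarrow> 0"
    using L2_complete[OF P(1) cauchy[OF _ pc0 bounds(1)]] .
  obtain G where G: "L2 vol G" "(\<lambda>k. LINT x|vol. (norm (D k x - G x))\<^sup>2) \<longlonglongrightarrow> 0"
    using L2_complete[OF P(2) cauchy[OF _ zero_less_one bounds(2)]] .
  have ib: "0 < 1 / \<beta>" using beta_pos by simp
  obtain w where w: "L2 surf w" "(\<lambda>k. LINT x|surf. (norm (\<phi> k x - w x))\<^sup>2) \<longlonglongrightarrow> 0"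
    using L2_complete[OF P(3) cauchy[OF _ ib bounds(3)]] .
  have H1: "H1_data (ball x0 1) u G w" by (rule H1_dataI[OF \<phi> u(1) G(1) w(1) u(2) G(2) w(2)])
  have "aform G w H \<psi> = (LINT x|vol. g x * \<psi> x)" if \<psi>: "has_grad \<psi> H" for \<psi> H
  proof -
    note V = has_grad_L2[OF \<psi>]
    define A where "A = aform H \<psi> H \<psi>"
    have A0: "0 \<le> A" unfolding A_def by (rule aform_nonneg)
    define d where "d k = aform (D k) (\<phi> k) H \<psi> - (LINT x|vol. g x * \<psi> x)" for k
    have d: "(d k)\<^sup>2 \<le> 2 * (A + 1) * \<epsilon> k" for k
    proof -
      \<comment> \<open>The residual \<open>d k\<close> is the slope of the energy in direction
        \<psi>. A nearly optimal step against it can lower the energy by less than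
        \<open>\<epsilon> k\<close>; the summand 1 avoids division by zero.\<close>
      define t where "t = - d k / (A + 1)"
      have "has_grad (\<lambda>x. \<phi> k x + t * \<psi> x) (\<lambda>x. D k x + t *\<^sub>R H x)"
        by (intro has_grad_add has_grad_cmult \<phi> \<psi>)
      from m_le[OF this] have "- \<epsilon> k \<le> t * d k + t\<^sup>2 / 2 * A"
        unfolding energy_expand[OF g P[of k] V] d_def[symmetric] A_def[symmetric]
        using min[of k] by (simp add: \<epsilon>_def)
      also have "\<dots> \<le> t * d k + t\<^sup>2 / 2 * (A + 1)" by (intro add_left_mono mult_left_mono) auto
      also have "\<dots> = - (d k)\<^sup>2 / (2 * (A + 1))"
      proof -
        have "(- d k / B) * d k + (- d k / B)\<^sup>2 / 2 * B = - (d k)\<^sup>2 / (2 * B)" if "0 < B" for B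
          using that by (simp add: field_simps power2_eq_square)
        from this[of "A + 1"] show ?thesis using A0 by (simp add: t_def)
      qed
      finally show ?thesis using A0 by (simp add: field_simps)
    qed
    have "(\<lambda>k. (d k)\<^sup>2) \<longlonglongrightarrow> 0"
    proof (rule Lim_null_comparison)
      show "eventually (\<lambda>k. norm ((d k)\<^sup>2) \<le> 2 * (A + 1) * \<epsilon> k) sequentially" using d by simp
      show "(\<lambda>k. 2 * (A + 1) * \<epsilon> k) \<longlonglongrightarrow> 0" using tendsto_mult_right_zero[OF \<epsilon>lim] by simp
    qed
    then have d0: "d \<longlonglongrightarrow> 0" by simp
    have "(\<lambda>k. LINT x|vol. D k x \<bullet> H x) \<longlonglongrightarrow> (LINT x|vol. G x \<bullet> H x)"
      by (rule L2_tendsto_inner[OF P(2) G(1) V(2) G(2)])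
    moreover have "(\<lambda>k. LINT x|surf. \<phi> k x \<bullet> \<psi> x) \<longlonglongrightarrow> (LINT x|surf. w x \<bullet> \<psi> x)"
      by (rule L2_tendsto_inner[OF P(3) w(1) V(3) w(2)])
    ultimately have "d \<longlonglongrightarrow> aform G w H \<psi> - (LINT x|vol. g x * \<psi> x)"
      unfolding d_def[abs_def] aform_def by (intro tendsto_intros) simp_all
    from LIMSEQ_unique[OF this d0] show ?thesis by simp
  qed
  from robin_solutionI[OF H1 g this] show ?thesis by blast
qed

end

section \<open>Rearrangements\<close>

text \<open>The superlevel sets are described by \<open>symm_rearr_gt_iff\<close> off the origin
  only, where they are balls; the value at 0 is uncontrolled, so this point is removed and put
  back.\<close>

lemma borel_measurable_symm_rearr:
  fixes \<Omega> :: "'a::euclidean_space set"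
  assumes "\<Omega> \<in> lmeasurable" "\<phi> \<in> borel_measurable (lebesgue_on \<Omega>)"
  shows "symm_rearr \<Omega> \<phi> \<in> borel_measurable borel"
  unfolding borel_measurable_iff_greater
proof
  fix t
  have "{x. symm_rearr \<Omega> \<phi> x > t} - {0} \<in> sets borel"
  proof (cases "0 \<le> t")
    case True
    have "{x. symm_rearr \<Omega> \<phi> x > t} - {0} =
      {x. unit_ball_vol (real DIM('a)) * norm x ^ DIM('a) < measure lebesgue {y\<in>\<Omega>. \<phi> y > t}} - {0}"
      using symm_rearr_gt_iff[OF assms _ True] by (auto simp: content_ball)
    also have "\<dots> \<in> sets borel"
      by (rule sets.Diff) (intro borel_open open_Collect_less continuous_intros, simp)
    finally show ?thesis .
  next
    case False
    have "symm_rearr \<Omega> \<phi> x > t" if "x \<noteq> 0" for x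
    proof -
      have "0 \<le> symm_rearr \<Omega> \<phi> x"
        unfolding symm_rearr_def using symm_rearr_nonempty[OF assms measure_ball_pos[OF that]]
        by (intro cInf_greatest) auto
      then show ?thesis using False by simp
    qed
    then have "{x. symm_rearr \<Omega> \<phi> x > t} - {0} = UNIV - {0}" by auto
    then show ?thesis by simp
  qed
  then have "({x. symm_rearr \<Omega> \<phi> x > t} - {0}) \<union> (if symm_rearr \<Omega> \<phi> 0 > t then {0} else {}) \<in> sets borel"
    by (rule sets.Un) simp
  also have "({x. symm_rearr \<Omega> \<phi> x > t} - {0}) \<union> (if symm_rearr \<Omega> \<phi> 0 > t then {0} else {}) =
    {x. symm_rearr \<Omega> \<phi> x > t}" by auto
  finally have "{x. symm_rearr \<Omega> \<phi> x > t} \<in> sets borel" .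
  then show "{x \<in> space borel. t < symm_rearr \<Omega> \<phi> x} \<in> sets borel" by simp
qed

lemma symm_rearr_nonneg:
  fixes \<Omega> :: "'a::euclidean_space set"
  assumes "\<Omega> \<in> lmeasurable" "\<phi> \<in> borel_measurable (lebesgue_on \<Omega>)" "x \<noteq> 0"
  shows "0 \<le> symm_rearr \<Omega> \<phi> x"
  unfolding symm_rearr_def using symm_rearr_nonempty[OF assms(1,2) measure_ball_pos[OF assms(3)]]
  by (intro cInf_greatest) auto

text \<open>Whatever \<Omega> is, the part of it where the function exceeds \<open>f x\<close> lies
  in the ball of radius \<open>norm x\<close>, so \<open>f x\<close> is one of the levels over which
  the infimum is taken.\<close>

lemma symm_rearr_le_radially_decreasing:
  fixes \<Omega> :: "'a::euclidean_space set"
  assumes "radially_decreasing f" "0 \<le> f x"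
  shows "symm_rearr \<Omega> f x \<le> f x"
  unfolding symm_rearr_def
proof (rule cInf_lower)
  have sub: "{y\<in>\<Omega>. f y > f x} \<subseteq> ball 0 (norm x)"
    using assms(1) unfolding radially_decreasing_def by (auto simp: not_le[symmetric])
  have "measure lebesgue {y\<in>\<Omega>. f y > f x} \<le> measure lebesgue (ball (0::'a) (norm x))"
  \<comment> \<open>\<Omega> is arbitrary here; a non-measurable set has \<open>measure\<close> 0 by
    default.\<close>
  proof (cases "{y\<in>\<Omega>. f y > f x} \<in> sets lebesgue")
    case True
    with sub show ?thesis by (rule measure_mono_fmeasurable) simp
  qed (simp add: measure_notin_sets)
  with assms(2) show "f x \<in> {t. 0 \<le> t \<and> measure lebesgue {y\<in>\<Omega>. f y > t} \<le> measure lebesgue (ball (0::'a) (norm x))}"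
    by simp
qed (auto intro: bdd_belowI[of _ 0])

text \<open>Both factors are written as integrals over their levels and the order of integration is
  exchanged. Negative values vanish on both sides: \<open>ennreal\<close> truncates them, and only
  levels from 0 on are counted.\<close>

lemma nn_integral_mult_layer_cake:
  assumes M: "sigma_finite_measure M" and [measurable]: "F \<in> borel_measurable M" "G \<in> borel_measurable M"
  shows "(\<integral>\<^sup>+x. ennreal (F x) * ennreal (G x) \<partial>M) =
    (\<integral>\<^sup>+s. \<integral>\<^sup>+t. indicator {0..} s * (indicator {0..} t * emeasure M {x\<in>space M. s < F x \<and> t < G x}) \<partial>lborel \<partial>lborel)"
proof -
  interpret sigma_finite_measure M by (rule M)
  interpret pair_sigma_finite M "lborel :: real measure"
    by (intro pair_sigma_finite.intro M sigma_finite_lborel)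
  have layer: "ennreal a = (\<integral>\<^sup>+s. indicator {s. 0 \<le> s \<and> s < a} s \<partial>lborel)" for a :: real
  proof -
    have "{s. 0 \<le> s \<and> s < a} = {0..<a}" by auto
    then show ?thesis by (cases "0 \<le> a") (auto simp: ennreal_neg)
  qed
  define K where "K H p = (indicator {q. 0 \<le> snd q \<and> snd q < H (fst q)} p :: ennreal)" for H :: "'a \<Rightarrow> real" and p :: "'a \<times> real"
  have [measurable]: "K F \<in> borel_measurable (M \<Otimes>\<^sub>M lborel)" "K G \<in> borel_measurable (M \<Otimes>\<^sub>M lborel)"
    unfolding K_def[abs_def] by measurable
  have lay: "ennreal (H x) = (\<integral>\<^sup>+s. K H (x, s) \<partial>lborel)" for H x
    by (subst layer, rule nn_integral_cong) (simp add: K_def indicator_def)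
  have inner: "(\<integral>\<^sup>+x. K F (x, s) * K G (x, t) \<partial>M) =
      indicator {0..} s * (indicator {0..} t * emeasure M {x\<in>space M. s < F x \<and> t < G x})" for s t
  proof -
    have "(\<integral>\<^sup>+x. K F (x, s) * K G (x, t) \<partial>M) =
      (\<integral>\<^sup>+x. (indicator {0..} s * indicator {0..} t) * indicator {x\<in>space M. s < F x \<and> t < G x} x \<partial>M)"
      by (intro nn_integral_cong) (auto simp: K_def indicator_def)
    also have "\<dots> = (indicator {0..} s * indicator {0..} t) * emeasure M {x\<in>space M. s < F x \<and> t < G x}"
      by (rule nn_integral_cmult_indicator) measurable
    finally show ?thesis by (simp add: mult.assoc)
  qed
  have "(\<integral>\<^sup>+x. ennreal (F x) * ennreal (G x) \<partial>M) = (\<integral>\<^sup>+x. \<integral>\<^sup>+s. K F (x, s) * ennreal (G x) \<partial>lborel \<partial>M)"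
    by (intro nn_integral_cong) (simp add: lay[of F] nn_integral_multc)
  also have "\<dots> = (\<integral>\<^sup>+s. \<integral>\<^sup>+x. K F (x, s) * ennreal (G x) \<partial>M \<partial>lborel)"
    by (rule Fubini'[symmetric]) measurable
  also have "\<dots> = (\<integral>\<^sup>+s. \<integral>\<^sup>+t. \<integral>\<^sup>+x. K F (x, s) * K G (x, t) \<partial>M \<partial>lborel \<partial>lborel)"
  proof (intro nn_integral_cong)
    fix s :: real
    have "(\<integral>\<^sup>+x. K F (x, s) * ennreal (G x) \<partial>M) = (\<integral>\<^sup>+x. \<integral>\<^sup>+t. K F (x, s) * K G (x, t) \<partial>lborel \<partial>M)"
      by (intro nn_integral_cong) (simp add: lay[of G] nn_integral_cmult)
    also have "\<dots> = (\<integral>\<^sup>+t. \<integral>\<^sup>+x. K F (x, s) * K G (x, t) \<partial>M \<partial>lborel)"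
      by (rule Fubini'[symmetric]) measurable
    finally show "(\<integral>\<^sup>+x. K F (x, s) * ennreal (G x) \<partial>M) = (\<integral>\<^sup>+t. \<integral>\<^sup>+x. K F (x, s) * K G (x, t) \<partial>M \<partial>lborel)" .
  qed
  finally show ?thesis unfolding inner .
qed

lemma symm_ball_lmeasurable: "symm_ball \<Omega> \<in> lmeasurable"
  by (simp add: symm_ball_def)

text \<open>Superlevel sets of rearrangements are nested balls, so the smaller of the two measures is attained.\<close>

lemma symm_rearr_superlevel_inter:
  fixes \<Omega> :: "'a::euclidean_space set"
  assumes O: "\<Omega> \<in> lmeasurable" and f: "f \<in> borel_measurable (lebesgue_on \<Omega>)"
    and u: "u \<in> borel_measurable (lebesgue_on \<Omega>)" and st: "0 \<le> s" "0 \<le> t"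
    and le: "measure lebesgue {y\<in>\<Omega>. f y > s} \<le> measure lebesgue {y\<in>\<Omega>. u y > t}"
  shows "measure lebesgue {y\<in>\<Omega>. s < f y \<and> t < u y}
    \<le> measure lebesgue {x\<in>symm_ball \<Omega>. s < symm_rearr \<Omega> f x \<and> t < symm_rearr \<Omega> u x}"
proof -
  have [measurable]: "symm_rearr \<Omega> f \<in> borel_measurable lebesgue" "symm_rearr \<Omega> u \<in> borel_measurable lebesgue"
    using borel_measurable_symm_rearr[OF O f] borel_measurable_symm_rearr[OF O u]
    by (auto intro: measurable_completion)
  have [measurable]: "symm_ball \<Omega> \<in> sets lebesgue" by (simp add: symm_ball_def)
  have m1: "{x\<in>symm_ball \<Omega>. s < symm_rearr \<Omega> f x} \<in> sets lebesgue"
    and m2: "{x\<in>symm_ball \<Omega>. s < symm_rearr \<Omega> f x \<and> t < symm_rearr \<Omega> u x} \<in> sets lebesgue"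
  proof -
    have "{x \<in> space lebesgue. x \<in> symm_ball \<Omega> \<and> s < symm_rearr \<Omega> f x} \<in> sets lebesgue"
        "{x \<in> space lebesgue. x \<in> symm_ball \<Omega> \<and> s < symm_rearr \<Omega> f x \<and> t < symm_rearr \<Omega> u x} \<in> sets lebesgue"
      by measurable
    then show "{x\<in>symm_ball \<Omega>. s < symm_rearr \<Omega> f x} \<in> sets lebesgue"
        "{x\<in>symm_ball \<Omega>. s < symm_rearr \<Omega> f x \<and> t < symm_rearr \<Omega> u x} \<in> sets lebesgue"
      by simp_all
  qed
  have "{y\<in>\<Omega>. s < f y \<and> t < u y} = {y\<in>\<Omega>. s < f y} \<inter> {y\<in>\<Omega>. t < u y}" by auto
  then have "measure lebesgue {y\<in>\<Omega>. s < f y \<and> t < u y} \<le> measure lebesgue {y\<in>\<Omega>. s < f y}"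
    using superlevel_lmeasurable[OF O f, of s] superlevel_lmeasurable[OF O u, of t]
    by (intro measure_mono_fmeasurable) auto
  also have "\<dots> = measure lebesgue {x\<in>symm_ball \<Omega>. s < symm_rearr \<Omega> f x}"
    by (rule symm_rearr_equimeasurable[OF O f st(1), symmetric])
  also have "\<dots> = measure lebesgue ({x\<in>symm_ball \<Omega>. s < symm_rearr \<Omega> f x} - {0})"
    by (rule measure_Diff_null_set[OF m1, symmetric]) simp
  also have "\<dots> \<le> measure lebesgue {x\<in>symm_ball \<Omega>. s < symm_rearr \<Omega> f x \<and> t < symm_rearr \<Omega> u x}"
  proof (rule measure_mono_fmeasurable)
    show "{x\<in>symm_ball \<Omega>. s < symm_rearr \<Omega> f x} - {0}
      \<subseteq> {x\<in>symm_ball \<Omega>. s < symm_rearr \<Omega> f x \<and> t < symm_rearr \<Omega> u x}"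
      using symm_rearr_gt_iff[OF O f _ st(1)] symm_rearr_gt_iff[OF O u _ st(2)] le by force
    show "{x\<in>symm_ball \<Omega>. s < symm_rearr \<Omega> f x} - {0} \<in> sets lebesgue" using m1 by auto
    show "{x\<in>symm_ball \<Omega>. s < symm_rearr \<Omega> f x \<and> t < symm_rearr \<Omega> u x} \<in> lmeasurable"
      by (rule fmeasurableI2[OF symm_ball_lmeasurable _ m2]) auto
  qed
  finally show ?thesis .
qed

text \<open>Layer by layer, an intersection of superlevel sets is no larger than the smaller of the
  two, and after rearrangement this bound is attained. No sign is prescribed: only positive parts
  enter the integrals.\<close>

lemma hardy_littlewood:
  fixes \<Omega> :: "'a::euclidean_space set"
  assumes O: "\<Omega> \<in> lmeasurable" and f: "f \<in> borel_measurable (lebesgue_on \<Omega>)"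
    and u: "u \<in> borel_measurable (lebesgue_on \<Omega>)"
  shows "(\<integral>\<^sup>+x. ennreal (f x) * ennreal (u x) \<partial>lebesgue_on \<Omega>) \<le>
    (\<integral>\<^sup>+x. ennreal (symm_rearr \<Omega> f x) * ennreal (symm_rearr \<Omega> u x) \<partial>lebesgue_on (symm_ball \<Omega>))"
proof -
  have sf: "sigma_finite_measure (lebesgue_on S)" if "S \<in> lmeasurable" for S :: "'a set"
    using finite_measure_lebesgue_on[OF that] by (simp add: finite_measure_def)
  have [measurable]: "symm_rearr \<Omega> f \<in> borel_measurable (lebesgue_on (symm_ball \<Omega>))"
      "symm_rearr \<Omega> u \<in> borel_measurable (lebesgue_on (symm_ball \<Omega>))"
    using borel_measurable_symm_rearr[OF O f] borel_measurable_symm_rearr[OF O u]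
    by (auto intro!: measurable_restrict_space1 measurable_completion)
  have em: "emeasure (lebesgue_on S) {x\<in>space (lebesgue_on S). s < F x \<and> t < G x}
      = ennreal (measure lebesgue {x\<in>S. s < F x \<and> t < G x})"
    if S: "S \<in> lmeasurable" and [measurable]: "F \<in> borel_measurable (lebesgue_on S)" "G \<in> borel_measurable (lebesgue_on S)"
    for S :: "'a set" and F G :: "'a \<Rightarrow> real" and s t
  proof -
    interpret finite_measure "lebesgue_on S" by (rule finite_measure_lebesgue_on[OF S])
    have "{x\<in>S. s < F x \<and> t < G x} \<subseteq> S" by auto
    then have "measure (lebesgue_on S) {x\<in>S. s < F x \<and> t < G x} = measure lebesgue {x\<in>S. s < F x \<and> t < G x}"
      using S by (intro measure_restrict_space) auto
    then show ?thesis by (simp add: emeasure_eq_measure space_restrict_space)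
  qed
  have level: "emeasure (lebesgue_on \<Omega>) {x\<in>space (lebesgue_on \<Omega>). s < f x \<and> t < u x} \<le>
      emeasure (lebesgue_on (symm_ball \<Omega>))
        {x\<in>space (lebesgue_on (symm_ball \<Omega>)). s < symm_rearr \<Omega> f x \<and> t < symm_rearr \<Omega> u x}"
    if st: "0 \<le> s" "0 \<le> t" for s t
  proof -
    have "measure lebesgue {y\<in>\<Omega>. s < f y \<and> t < u y}
      \<le> measure lebesgue {x\<in>symm_ball \<Omega>. s < symm_rearr \<Omega> f x \<and> t < symm_rearr \<Omega> u x}"
    proof (cases "measure lebesgue {y\<in>\<Omega>. f y > s} \<le> measure lebesgue {y\<in>\<Omega>. u y > t}")
      case True
      then show ?thesis by (rule symm_rearr_superlevel_inter[OF O f u st])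
    next
      case False
      then have "measure lebesgue {y\<in>\<Omega>. u y > t} \<le> measure lebesgue {y\<in>\<Omega>. f y > s}" by simp
      from symm_rearr_superlevel_inter[OF O u f st(2,1) this] show ?thesis
        by (simp only: conj_commute[of "t < _"])
    qed
    then show ?thesis
      by (subst em[OF O f u], subst em[OF symm_ball_lmeasurable]) (auto intro: ennreal_leI)
  qed
  have "(\<integral>\<^sup>+x. ennreal (f x) * ennreal (u x) \<partial>lebesgue_on \<Omega>) =
    (\<integral>\<^sup>+s. \<integral>\<^sup>+t. indicator {0..} s * (indicator {0..} t *
      emeasure (lebesgue_on \<Omega>) {x\<in>space (lebesgue_on \<Omega>). s < f x \<and> t < u x}) \<partial>lborel \<partial>lborel)"
    by (rule nn_integral_mult_layer_cake[OF sf[OF O] f u])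
  also have "\<dots> \<le> (\<integral>\<^sup>+s. \<integral>\<^sup>+t. indicator {0..} s * (indicator {0..} t *
      emeasure (lebesgue_on (symm_ball \<Omega>))
        {x\<in>space (lebesgue_on (symm_ball \<Omega>)). s < symm_rearr \<Omega> f x \<and> t < symm_rearr \<Omega> u x}) \<partial>lborel \<partial>lborel)"
  proof (intro nn_integral_mono)
    fix s t :: real
    show "indicator {0..} s * (indicator {0..} t *
      emeasure (lebesgue_on \<Omega>) {x\<in>space (lebesgue_on \<Omega>). s < f x \<and> t < u x}) \<le>
      indicator {0..} s * (indicator {0..} t * emeasure (lebesgue_on (symm_ball \<Omega>))
        {x\<in>space (lebesgue_on (symm_ball \<Omega>)). s < symm_rearr \<Omega> f x \<and> t < symm_rearr \<Omega> u x})"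
      using level[of s t] by (cases "0 \<le> s \<and> 0 \<le> t") (auto simp: indicator_def)
  qed
  also have "\<dots> = (\<integral>\<^sup>+x. ennreal (symm_rearr \<Omega> f x) * ennreal (symm_rearr \<Omega> u x) \<partial>lebesgue_on (symm_ball \<Omega>))"
    by (rule nn_integral_mult_layer_cake[OF sf[OF symm_ball_lmeasurable], symmetric]) measurable
  finally show ?thesis .
qed

section \<open>From the pointwise comparison to an inequality of energies\<close>

lemma symm_ball_unit_ball:
  fixes x0 :: "'a::euclidean_space"
  shows "symm_ball (ball x0 1) = ball 0 1"
  by (simp add: symm_ball_def content_ball less_imp_neq[OF unit_ball_vol_pos, symmetric])

lemma (in robin_ball) L2_vol_bounded:
  fixes g :: "'a \<Rightarrow> real"
  assumes "g \<in> borel_measurable borel" "AE x in vol. \<bar>g x\<bar> \<le> C"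
  shows "L2 vol g"
  unfolding L2_def
proof
  show m: "g \<in> borel_measurable vol" using assms(1) by (rule borel_measurable_vol)
  show "integrable vol (\<lambda>x. (norm (g x))\<^sup>2)"
  proof (rule finite_measure.integrable_const_bound[OF finite_vol, of _ "C\<^sup>2"])
    show "AE x in vol. norm ((norm (g x))\<^sup>2) \<le> C\<^sup>2"
      using assms(2)
    proof eventually_elim
      case (elim x)
      then have "\<bar>g x\<bar>\<^sup>2 \<le> C\<^sup>2" by (intro power_mono) auto
      then show ?case by simp
    qed
  qed (use m in measurable)
qed

lemma AE_lebesgue_on_nonzero: "AE x in lebesgue_on (ball 0 1). x \<noteq> (0::'a::euclidean_space)"
proof -
  have "{0::'a} \<in> null_sets lebesgue" by simp
  from AE_not_in[OF this] have "AE x in lebesgue. x \<noteq> (0::'a)" by eventually_elim auto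
  then show ?thesis by (subst AE_restrict_space_iff) auto
qed

lemma AE_symm_rearr_bounds:
  fixes f :: "'a::euclidean_space \<Rightarrow> real"
  assumes f: "continuous_on UNIV f" "radially_decreasing f" "\<And>x. 0 < f x"
  shows "AE x in lebesgue_on (ball 0 1). 0 \<le> symm_rearr (ball x0 1) f x \<and> symm_rearr (ball x0 1) f x \<le> f x"
proof -
  have "f \<in> borel_measurable (lebesgue_on (ball x0 1))"
    using borel_measurable_continuous_onI[OF f(1)] by (intro measurable_restrict_space1 measurable_completion) simp
  note nonneg = symm_rearr_nonneg[OF lmeasurable_ball this]
  show ?thesis
    using AE_lebesgue_on_nonzero
    by eventually_elim (use nonneg symm_rearr_le_radially_decreasing[OF f(2) less_imp_le[OF f(3)]] in auto)
qed

lemma L2_symm_rearr: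
  fixes f :: "'a::euclidean_space \<Rightarrow> real"
  assumes B: "robin_ball (0::'a) \<kappa> \<beta>"
    and f: "continuous_on UNIV f" "radially_decreasing f" "\<And>x. 0 < f x"
  shows "L2 (lebesgue_on (ball 0 1)) (symm_rearr (ball x0 1) f)"
proof (rule robin_ball.L2_vol_bounded[OF B, of _ "f 0"])
  have "f \<in> borel_measurable (lebesgue_on (ball x0 1))"
    using borel_measurable_continuous_onI[OF f(1)] by (intro measurable_restrict_space1 measurable_completion) simp
  then show "symm_rearr (ball x0 1) f \<in> borel_measurable borel"
    by (intro borel_measurable_symm_rearr) simp_all
  have f0: "f x \<le> f 0" for x using f(2) by (auto simp: radially_decreasing_def)
  show "AE x in lebesgue_on (ball 0 1). \<bar>symm_rearr (ball x0 1) f x\<bar> \<le> f 0"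
    using AE_symm_rearr_bounds[OF f, of x0]
  proof eventually_elim
    case (elim x)
    then show ?case using f0[of x] by linarith
  qed
qed

text \<open>The comparison \<open>u\<^sup>\<sharp> \<le> v\<close> contradicts \<open>J(\<Omega>) < J(B)\<close>: testing \<open>J(B)\<close> with \<open>v\<close> and using
  \<open>f\<^sup>\<sharp> \<le> f\<close>, \<open>J(B) \<le> - 1/2 \<integral>\<^sub>B f\<^sup>\<sharp> v \<le> - 1/2 \<integral>\<^sub>B f\<^sup>\<sharp> u\<^sup>\<sharp> \<le> - 1/2 \<integral>\<^sub>\<Omega> f u = J(\<Omega>)\<close>.\<close>

lemma comparison_imp_robin_J_le:
  fixes f :: "'a::euclidean_space \<Rightarrow> real"
  assumes O: "robin_ball x0 \<kappa> \<beta>" and B: "robin_ball (0::'a) \<kappa> \<beta>"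
    and f: "continuous_on UNIV f" "radially_decreasing f" "\<And>x. 0 < f x"
    and u: "robin_solution (ball x0 1) f \<beta> u"
    and v: "robin_solution (ball 0 1) (symm_rearr (ball x0 1) f) \<beta> v"
    and le: "AE x in lebesgue_on (ball 0 1). symm_rearr (ball x0 1) u x \<le> v x"
  shows "robin_J \<beta> f (ball 0 1) \<le> robin_J \<beta> f (ball x0 1)"
proof -
  interpret O: robin_ball x0 \<kappa> \<beta> by (rule O)
  interpret B: robin_ball "0::'a" \<kappa> \<beta> by (rule B)
  let ?fs = "symm_rearr (ball x0 1) f" and ?us = "symm_rearr (ball x0 1) u"
  obtain G w where uG: "H1_data (ball x0 1) u G w"
    and u_weak: "\<And>v H h. H1_data (ball x0 1) v H h \<Longrightarrow> O.aform G w H h = (LINT x|O.vol. f x * v x)"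
    using O.robin_solution_weak[OF u] by blast
  obtain H h where vH: "H1_data (ball 0 1) v H h"
    and v_weak: "\<And>z K k. H1_data (ball 0 1) z K k \<Longrightarrow> B.aform H h K k = (LINT x|B.vol. ?fs x * z x)"
    using B.robin_solution_weak[OF v] by blast
  note U = O.H1_dataD[OF uG] and V = B.H1_dataD[OF vH]
  have fm: "f \<in> borel_measurable borel" using f(1) by (rule borel_measurable_continuous_onI)
  have lm: "ball x0 1 \<in> lmeasurable" by simp
  have fO: "f \<in> borel_measurable O.vol" using fm by (rule O.borel_measurable_vol)
  note uO = L2_D(1)[OF U(1)]
  have fs: "AE x in B.vol. 0 \<le> ?fs x \<and> ?fs x \<le> f x" by (rule AE_symm_rearr_bounds[OF f])
  have us: "AE x in B.vol. 0 \<le> ?us x"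
    using AE_lebesgue_on_nonzero by eventually_elim (rule symm_rearr_nonneg[OF lm uO])
  have fsL2: "L2 B.vol ?fs" by (rule L2_symm_rearr[OF B f])
  have fL2: "L2 O.vol f" "L2 B.vol f" by (rule O.L2_vol B.L2_vol, rule f(1))+
  have int_fsv: "integrable B.vol (\<lambda>x. ?fs x * v x)" by (rule O.L2_mult_integrable[OF fsL2 V(1)])
  \<comment> \<open>Replacing f# by the larger \<open>f\<close> requires \<open>v\<close> to be
    nonnegative almost everywhere; this is provided by the assumed comparison, as u# is
    nonnegative.\<close>
  have le1: "(LINT x|B.vol. ?fs x * v x) \<le> (LINT x|B.vol. f x * v x)"
  proof (rule integral_mono_AE[OF int_fsv O.L2_mult_integrable[OF fL2(2) V(1)]])
    show "AE x in B.vol. ?fs x * v x \<le> f x * v x"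
      using fs us le by eventually_elim (auto intro: mult_right_mono)
  qed
  have le2: "(LINT x|O.vol. f x * u x) \<le> (LINT x|B.vol. ?fs x * v x)"
  proof -
    have int_fu: "integrable O.vol (\<lambda>x. f x * u x)" by (rule O.L2_mult_integrable[OF fL2(1) U(1)])
    \<comment> \<open>The sign of \<open>u\<close> is unknown. Since \<open>f\<close> is positive,
      passing to the positive part of \<open>u\<close> can only increase the integral, and the
      positive part is what \<open>hardy_littlewood\<close> estimates.\<close>
    have int_fu': "integrable O.vol (\<lambda>x. f x * max 0 (u x))"
    proof (rule Bochner_Integration.integrable_bound[OF int_fu])
      show "(\<lambda>x. f x * max 0 (u x)) \<in> borel_measurable O.vol" using fO uO by measurable
      show "AE x in O.vol. norm (f x * max 0 (u x)) \<le> norm (f x * u x)"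
        by (rule AE_I2) (auto simp: abs_mult intro!: mult_left_mono)
    qed
    have v0: "AE x in B.vol. 0 \<le> ?fs x * v x"
      using fs us le by eventually_elim (auto intro!: mult_nonneg_nonneg)
    have "(LINT x|O.vol. f x * u x) \<le> (LINT x|O.vol. f x * max 0 (u x))"
      by (rule integral_mono[OF int_fu int_fu']) (use f(3) in \<open>auto intro!: mult_left_mono less_imp_le\<close>)
    moreover have "ennreal (LINT x|O.vol. f x * max 0 (u x)) \<le> ennreal (LINT x|B.vol. ?fs x * v x)"
    proof -
      have "ennreal (LINT x|O.vol. f x * max 0 (u x)) = (\<integral>\<^sup>+x. ennreal (f x * max 0 (u x)) \<partial>O.vol)"
        by (rule nn_integral_eq_integral[OF int_fu', symmetric])
          (use f(3)[THEN less_imp_le] in \<open>intro AE_I2 mult_nonneg_nonneg, auto\<close>)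
      also have "\<dots> = (\<integral>\<^sup>+x. ennreal (f x) * ennreal (u x) \<partial>O.vol)"
      proof (rule nn_integral_cong)
        fix x
        have "ennreal (max 0 (u x)) = ennreal (u x)" by (cases "0 \<le> u x") (auto simp: ennreal_neg max_def)
        then show "ennreal (f x * max 0 (u x)) = ennreal (f x) * ennreal (u x)"
          using f(3)[of x] by (simp add: ennreal_mult)
      qed
      also have "\<dots> \<le> (\<integral>\<^sup>+x. ennreal (?fs x) * ennreal (?us x) \<partial>lebesgue_on (symm_ball (ball x0 1)))"
        by (rule hardy_littlewood[OF lm fO uO])
      also have "\<dots> \<le> (\<integral>\<^sup>+x. ennreal (?fs x * v x) \<partial>B.vol)"
        unfolding symm_ball_unit_ball
      proof (rule nn_integral_mono_AE)
        show "AE x in B.vol. ennreal (?fs x) * ennreal (?us x) \<le> ennreal (?fs x * v x)"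
          using fs us le
          by eventually_elim (auto simp: ennreal_mult[symmetric] intro!: ennreal_leI mult_left_mono)
      qed
      also have "\<dots> = ennreal (LINT x|B.vol. ?fs x * v x)"
        by (rule nn_integral_eq_integral[OF int_fsv v0])
      finally show ?thesis .
    qed
    moreover have "0 \<le> (LINT x|B.vol. ?fs x * v x)" using v0 by (rule integral_nonneg_AE)
    ultimately show ?thesis by simp
  qed
  have "robin_J \<beta> f (ball 0 1) \<le> ereal (B.energy f v H h)"
    unfolding B.robin_J_eq using vH by (intro INF_lower2[of "(v, H, h)"]) auto
  \<comment> \<open>\<open>v\<close> solves the problem with source f#, not \<open>f\<close>, so
    only the quadratic part of its energy is rewritten; \<open>le1\<close> then bounds the linear
    part.\<close>
  also have "B.energy f v H h = 1/2 * (LINT x|B.vol. ?fs x * v x) - (LINT x|B.vol. f x * v x)"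
    unfolding B.energy_eq v_weak[OF vH] ..
  also have "ereal \<dots> \<le> ereal (- 1/2 * (LINT x|O.vol. f x * u x))"
    using le1 le2 by simp
  also have "\<dots> = robin_J \<beta> f (ball x0 1)"
    by (rule O.energy_minimal[OF fL2(1) uG u_weak, symmetric])
  finally show ?thesis .
qed

section \<open>The bubble\<close>

lemma C_k_const: "C_k k (\<lambda>x::'a::euclidean_space. c)"
proof (induction k arbitrary: c)
  case (Suc k)
  then show ?case by (auto simp: frechet_derivative_const)
qed simp

lemma C_k_SucI:
  assumes "\<And>x. (f has_derivative D x) (at x)" "\<And>b. b \<in> Basis \<Longrightarrow> C_k k (\<lambda>x. D x b)"
  shows "C_k (Suc k) f"
proof -
  have "frechet_derivative f (at x) = D x" for x using frechet_derivative_at[OF assms(1)] by simp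
  then show ?thesis using assms by (auto simp: differentiable_def)
qed

lemma C_k_SucD: "C_k (Suc k) f \<Longrightarrow> C_k k f"
proof (induction k arbitrary: f)
  case 0
  then have "\<forall>x. f differentiable (at x)" by simp
  then show ?case
    using differentiable_imp_continuous_within by (auto intro!: continuous_at_imp_continuous_on)
next
  case (Suc k)
  then show ?case by (subst C_k.simps) (auto simp del: C_k.simps(1) dest: C_k.simps(2)[THEN iffD1])
qed

lemma C_k_Suc_has_derivative:
  assumes "C_k (Suc k) f"
  shows "(f has_derivative frechet_derivative f (at x)) (at x)"
    "b \<in> Basis \<Longrightarrow> C_k k (\<lambda>x. frechet_derivative f (at x) b)"
  using assms by (auto simp: frechet_derivative_works)

lemma C_k_add: "C_k k f \<Longrightarrow> C_k k g \<Longrightarrow> C_k k (\<lambda>x. f x + g x)"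
proof (induction k arbitrary: f g)
  case 0
  then show ?case by (auto intro: continuous_intros)
next
  case (Suc k)
  note f = C_k_Suc_has_derivative[OF Suc.prems(1)] and g = C_k_Suc_has_derivative[OF Suc.prems(2)]
  show ?case by (rule C_k_SucI[OF has_derivative_add[OF f(1) g(1)]]) (intro Suc.IH f(2) g(2))
qed

lemma C_k_mult: "C_k k f \<Longrightarrow> C_k k g \<Longrightarrow> C_k k (\<lambda>x. f x * g x)"
proof (induction k arbitrary: f g)
  case 0
  then show ?case by (auto intro: continuous_intros)
next
  case (Suc k)
  note f = C_k_Suc_has_derivative[OF Suc.prems(1)] and g = C_k_Suc_has_derivative[OF Suc.prems(2)]
  show ?case
    by (rule C_k_SucI[OF has_derivative_mult[OF f(1) g(1)]])
      (intro C_k_add Suc.IH f(2) g(2) C_k_SucD[OF Suc.prems(1)] C_k_SucD[OF Suc.prems(2)])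
qed

lemma C_k_inner: "C_k k (\<lambda>x. x \<bullet> v)"
proof (cases k)
  case 0
  then show ?thesis by (auto intro: continuous_intros)
next
  case (Suc j)
  have "((\<lambda>x. x \<bullet> v) has_derivative (\<lambda>h. h \<bullet> v)) (at x)" for x by (auto intro!: derivative_eq_intros)
  then show ?thesis unfolding Suc by (rule C_k_SucI) (rule C_k_const)
qed

text \<open>\<open>bub 1\<close> is, up to a factor, \<open>-\<Delta>\<close> of a regularised fundamental solution; the regularisation \<open>1/100\<close> is small
  enough for the second variation in every dimension.\<close>

definition bub :: "nat \<Rightarrow> 'a::euclidean_space \<Rightarrow> real" where
  "bub k x = (1/100 + x \<bullet> x) powr (- real DIM('a) / 2 - real k)"

lemma bub_pos: "0 < bub k x"
proof -
  have "0 < 1/100 + x \<bullet> x" using inner_ge_zero[of x] by linarith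
  then show ?thesis by (simp add: bub_def)
qed

lemma bub_Suc: "bub k x = (1/100 + x \<bullet> x) * bub (Suc k) x"
proof -
  have "0 < 1/100 + x \<bullet> x" using inner_ge_zero[of x] by linarith
  then have "(1/100 + x \<bullet> x) * bub (Suc k) x = (1/100 + x \<bullet> x) powr (1 + (- real DIM('a) / 2 - real (Suc k)))"
    by (simp only: bub_def powr_add powr_one)
  then show ?thesis by (simp add: bub_def)
qed

lemma bub_le: "bub k (x::'a::euclidean_space) \<le> bub k (0::'a)"
  unfolding bub_def by (rule powr_mono2') auto

lemma bub_antimono: "norm (x::'a::euclidean_space) \<le> norm (y::'a) \<Longrightarrow> bub k y \<le> bub k x"
  unfolding bub_def power2_norm_eq_inner[symmetric] by (rule powr_mono2') (auto intro: add_pos_nonneg power_mono)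

lemma has_grad_powr:
  "has_grad (\<lambda>x::'a::euclidean_space. (1/100 + x \<bullet> x) powr q) (\<lambda>x. (2 * q * (1/100 + x \<bullet> x) powr (q - 1)) *\<^sub>R x)"
  unfolding has_grad_def
proof (intro conjI allI)
  fix x :: 'a
  have pos: "0 < 1/100 + y \<bullet> y" for y :: 'a using inner_ge_zero[of y] by linarith
  have "((\<lambda>x::'a. 1/100 + x \<bullet> x) has_derivative (\<lambda>h. 2 * (x \<bullet> h))) (at x)"
    by (auto intro!: derivative_eq_intros simp: inner_commute)
  moreover have "((\<lambda>t. t powr q) has_derivative (\<lambda>h. q * (1/100 + x \<bullet> x) powr (q - 1) * h)) (at (1/100 + x \<bullet> x))"
    using has_real_derivative_powr[OF pos[of x], of q] by (simp add: has_field_derivative_def)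
  ultimately have "((\<lambda>x. (1/100 + x \<bullet> x) powr q) has_derivative (\<lambda>h. q * (1/100 + x \<bullet> x) powr (q - 1) * (2 * (x \<bullet> h)))) (at x)"
    by (rule has_derivative_compose)
  then show "((\<lambda>x. (1/100 + x \<bullet> x) powr q) has_derivative (\<lambda>h. (2 * q * (1/100 + x \<bullet> x) powr (q - 1)) *\<^sub>R x \<bullet> h)) (at x)"
    by (simp add: mult_ac)
  show "continuous_on UNIV (\<lambda>x::'a. (2 * q * (1/100 + x \<bullet> x) powr (q - 1)) *\<^sub>R x)"
    using pos by (intro continuous_intros) (auto simp: less_imp_neq[symmetric])
qed

lemma has_grad_bub: "has_grad (bub k :: 'a::euclidean_space \<Rightarrow> real) (\<lambda>x. (- (real DIM('a) + 2 * real k) * bub (Suc k) x) *\<^sub>R x)"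
  by (rule has_grad_cong[OF has_grad_powr[of "- real DIM('a) / 2 - real k"]])
    (auto simp: bub_def algebra_simps)

lemma smooth_bub: "smooth (bub j :: 'a::euclidean_space \<Rightarrow> real)"
  unfolding smooth_def
proof
  fix k show "C_k k (bub j :: 'a \<Rightarrow> real)"
  proof (induction k arbitrary: j)
    case 0
    then show ?case using has_gradD(3)[OF has_grad_bub] by simp
  next
    case (Suc k)
    show ?case
    proof (rule C_k_SucI[OF has_gradD(1)[OF has_grad_bub]])
      fix b :: 'a
      have "C_k k (\<lambda>x. (- (real DIM('a) + 2 * real j) * bub (Suc j) x) * (x \<bullet> b))"
        by (intro C_k_mult C_k_const Suc C_k_inner)
      then show "C_k k (\<lambda>x. (- (real DIM('a) + 2 * real j) * bub (Suc j) x) *\<^sub>R x \<bullet> b)" by simp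
    qed
  qed
qed

text \<open>The potential of the bubble: \<open>-\<Delta>\<close> of it is \<open>N/100 * bub 1\<close>.\<close>

lemma exists_bubble_potential:
  obtains U :: "'a::euclidean_space \<Rightarrow> real"
  where "has_grad U (\<lambda>x. - bub 0 x *\<^sub>R x)" "\<And>x y. norm x = norm y \<Longrightarrow> U x = U y"
proof (cases "DIM('a) = 2")
  case False
  let ?N = "real DIM('a)"
  have N: "?N \<noteq> 2" using False by linarith
  show thesis
  proof (rule that[of "\<lambda>x. 1 / (?N - 2) * (1/100 + x \<bullet> x) powr (1 - ?N / 2)"])
    show "has_grad (\<lambda>x::'a. 1 / (?N - 2) * (1/100 + x \<bullet> x) powr (1 - ?N / 2)) (\<lambda>x. - bub 0 x *\<^sub>R x)"
    proof (rule has_grad_cong[OF has_grad_cmult[OF has_grad_powr[of "1 - ?N / 2"], of "1 / (?N - 2)"] refl])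
      fix x :: 'a
      have "1 / (?N - 2) * (2 * (1 - ?N / 2) * P) = - P" for P
        using N by (simp add: field_simps)
      then show "(1 / (?N - 2)) *\<^sub>R (2 * (1 - ?N / 2) * (1/100 + x \<bullet> x) powr (1 - ?N / 2 - 1)) *\<^sub>R x = - bub 0 x *\<^sub>R x"
        by (simp only: scaleR_scaleR bub_def) simp
    qed
  qed (simp add: norm_eq)
next
  case True
  show thesis
  proof (rule that[of "\<lambda>x. - (1/2) * ln (1/100 + x \<bullet> x)"])
    have pos: "0 < 1/100 + y \<bullet> y" for y :: 'a using inner_ge_zero[of y] by linarith
    show "has_grad (\<lambda>x::'a. - (1/2) * ln (1/100 + x \<bullet> x)) (\<lambda>x. - bub 0 x *\<^sub>R x)"
      unfolding has_grad_def
    proof (intro conjI allI)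
      fix x :: 'a
      have "bub 0 x = inverse (1/100 + x \<bullet> x)"
        using pos[of x] True by (simp add: bub_def powr_minus)
      moreover have "((\<lambda>x::'a. 1/100 + x \<bullet> x) has_derivative (\<lambda>h. 2 * (x \<bullet> h))) (at x)"
        by (auto intro!: derivative_eq_intros simp: inner_commute)
      moreover have "((\<lambda>t. - (1/2) * ln t) has_derivative (\<lambda>h. - (1/2) * (inverse (1/100 + x \<bullet> x) * h))) (at (1/100 + x \<bullet> x))"
      proof (rule has_derivative_mult_right)
        show "(ln has_derivative (\<lambda>h. inverse (1/100 + x \<bullet> x) * h)) (at (1/100 + x \<bullet> x))"
          using DERIV_ln[OF pos[of x]] by (simp add: has_field_derivative_def)
      qed
      ultimately show "((\<lambda>x. - (1/2) * ln (1/100 + x \<bullet> x)) has_derivative (\<lambda>h. - bub 0 x *\<^sub>R x \<bullet> h)) (at x)"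
        using has_derivative_compose by fastforce
      show "continuous_on UNIV (\<lambda>x::'a. - bub 0 x *\<^sub>R x)"
        by (intro continuous_intros has_gradD(3)[OF has_grad_bub])
    qed
  qed (simp add: norm_eq)
qed

context robin_ball
begin

text \<open>Strong solutions are weak solutions; \<open>V\<close> is meant to be the gradient of
  \<open>w\<close>. The factor \<kappa> in the boundary condition converts the standard surface
  measure into the Hausdorff measure.\<close>

lemma green_weak_form:
  assumes \<phi>: "has_grad \<phi> G" and V: "\<And>b. b \<in> Basis \<Longrightarrow> has_grad (\<lambda>x. V x \<bullet> b) (A b)"
    and div: "\<And>x. (\<Sum>b\<in>Basis. A b x \<bullet> b) = - g x"
    and bc: "\<And>x. norm (x - x0) = 1 \<Longrightarrow> \<kappa> * (V x \<bullet> (x - x0)) = - \<beta> * w x"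
    and cont: "continuous_on UNIV V" "continuous_on UNIV g" "continuous_on UNIV w"
  shows "aform V w G \<phi> = (LINT x|vol. g x * \<phi> x)"
proof -
  note c = cont has_gradD(2,3)[OF \<phi>, of UNIV]
  have "(LINT x|vol. G x \<bullet> V x + \<phi> x * (- g x)) = \<kappa> * (LINT x|surf. \<phi> x * (V x \<bullet> (x - x0)))"
    unfolding div[symmetric] by (rule green_identity[OF \<phi> V])
  also have "\<kappa> * (LINT x|surf. \<phi> x * (V x \<bullet> (x - x0))) = (LINT x|surf. \<phi> x * (\<kappa> * (V x \<bullet> (x - x0))))"
    by (subst Bochner_Integration.integral_mult_right_zero[symmetric]) (simp add: mult_ac)
  also have "\<dots> = (LINT x|surf. (- \<beta>) * (w x * \<phi> x))"
  proof (rule Bochner_Integration.integral_cong)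
    fix x assume "x \<in> space surf"
    then have "norm (x - x0) = 1" by (simp add: space_surf dist_norm norm_minus_commute)
    from bc[OF this] show "\<phi> x * (\<kappa> * (V x \<bullet> (x - x0))) = (- \<beta>) * (w x * \<phi> x)" by simp
  qed simp
  also have "\<dots> = - \<beta> * (LINT x|surf. w x * \<phi> x)" by simp
  finally have "(LINT x|vol. G x \<bullet> V x) - (LINT x|vol. \<phi> x * g x) = - \<beta> * (LINT x|surf. w x * \<phi> x)"
    by (subst (asm) Bochner_Integration.integral_add) (auto intro!: integrable_vol continuous_intros c)
  then show ?thesis by (simp add: aform_def inner_commute mult.commute)
qed

lemma integral_vol_bound:
  fixes h :: "'a \<Rightarrow> real"
  assumes "continuous_on UNIV h" "\<And>x. norm (x - x0) < 1 \<Longrightarrow> \<bar>h x\<bar> \<le> C"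
  shows "\<bar>LINT x|vol. h x\<bar> \<le> C * (LINT x|vol. 1)"
proof -
  have "\<bar>LINT x|vol. h x\<bar> \<le> (LINT x|vol. C)"
  proof (rule integral_abs_bound_integral)
    show "integrable vol h" "integrable vol (\<lambda>x. C)" by (intro integrable_vol assms(1) continuous_intros)+
    fix x assume "x \<in> space vol"
    then show "\<bar>h x\<bar> \<le> C" using assms(2)[of x] by (simp add: space_restrict_space dist_norm norm_minus_commute)
  qed
  then show ?thesis by (simp add: mult.commute)
qed

end

lemma integral_unit_ball_odd:
  fixes h :: "'a::euclidean_space \<Rightarrow> real"
  assumes cont: "continuous_on UNIV h" and odd: "\<And>x. h (- x) = - h x"
  shows "(LINT x|lebesgue_on (ball 0 1). h x) = 0"
proof -
  have [measurable]: "h \<in> borel_measurable borel" using cont by (rule borel_measurable_continuous_onI)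
  have [measurable]: "ball (0::'a) 1 \<in> sets borel" by simp
  have um: "uminus \<in> lborel \<rightarrow>\<^sub>M (borel :: 'a measure)" by simp
  have "distr lborel borel uminus = (lborel :: 'a measure)"
    by (rule distr_lborel_isometry) (auto simp: dist_minus)
  then have "(LINT x|lborel. indicator (ball 0 1) x * h x) = (LINT x|distr lborel borel uminus. indicator (ball 0 1) x * h x)"
    by simp
  also have "\<dots> = (LINT x|lborel. indicator (ball 0 1) (- x) * h (- x))"
    by (rule integral_distr[OF um]) measurable
  also have "\<dots> = (LINT x|lborel. - (indicator (ball 0 1) x * h x))"
    by (intro Bochner_Integration.integral_cong) (auto simp: odd indicator_def)
  also have "\<dots> = - (LINT x|lborel. indicator (ball 0 1) x * h x)" by simp
  finally show ?thesis by (subst integral_lebesgue_on_ball) auto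
qed

lemma sum_Basis_inner_mult: "(\<Sum>b\<in>Basis. c * (x \<bullet> b) * (y \<bullet> b)) = c * ((x::'a::euclidean_space) \<bullet> y)"
  by (subst euclidean_inner) (simp add: sum_distrib_left mult.assoc)

section \<open>The shape derivative for the bubble\<close>

text \<open>\<open>u0\<close> is the solution on the centred ball and \<open>bb = \<beta>/\<kappa>\<close> the Robin parameter with respect to the
  standard surface measure. When the centre of the ball moves with velocity \<open>a\<close>, the pulled-back
  right-hand side varies by \<open>df a = a \<cdot> \<nabla>f\<close>, and \<open>zz a\<close> solves the corresponding linearised problem;
  the energy is tested with \<open>u0 + zz a\<close>.\<close>

locale bubble_ball = robin_ball "0 :: 'a::euclidean_space" \<kappa> \<beta> for \<kappa> \<beta> +
  fixes u0 :: "'a::euclidean_space \<Rightarrow> real"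
  assumes u0_grad: "has_grad u0 (\<lambda>x. - bub 0 x *\<^sub>R x)"
    and u0_sphere: "\<And>x. norm x = 1 \<Longrightarrow> \<beta> * u0 x = \<kappa> * bub 0 x"
    and u0_even: "\<And>x. u0 (- x) = u0 x"
begin

definition "N = real DIM('a)"
definition "bb = \<beta> / \<kappa>"
text \<open>The constant value of \<open>bub j\<close> on the unit sphere, where
  \<open>1/100 + x \<bullet> x\<close> is 101/100.\<close>

definition RR :: "nat \<Rightarrow> real" where "RR j = (101/100) powr (- N / 2 - real j)"
text \<open>The solution of \<open>lam - RR 0 + N * RR 1 = - bb * (lam - RR 0)\<close>, which is the
  Robin condition for \<open>zz a\<close> on the sphere.\<close>

definition "lam = RR 0 - N * RR 1 / (1 + bb)"
definition ff :: "'a \<Rightarrow> real" where "ff x = N / 100 * bub 1 x"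
definition df :: "'a \<Rightarrow> 'a \<Rightarrow> real" where "df a x = - (N * (N + 2) / 100) * (bub 2 x * (x \<bullet> a))"
definition d2f :: "'a \<Rightarrow> 'a \<Rightarrow> real" where
  "d2f a x = - (N * (N + 2) / 100) * (bub 2 x * (a \<bullet> a) - (N + 4) * (bub 3 x * (x \<bullet> a)\<^sup>2))"
text \<open>The part \<open>- (x \<bullet> a) * bub 0 x\<close> is the derivative of
  \<open>u0\<close> in direction \<open>a\<close>, hence solves the differentiated equation. The
  harmonic function \<open>lam * (x \<bullet> a)\<close> is added to restore the Robin
  condition.\<close>

definition zz :: "'a \<Rightarrow> 'a \<Rightarrow> real" where "zz a x = (x \<bullet> a) * (lam - bub 0 x)"
definition Gz :: "'a \<Rightarrow> 'a \<Rightarrow> 'a" where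
  "Gz a x = (lam - bub 0 x) *\<^sub>R a + (N * ((x \<bullet> a) * bub 1 x)) *\<^sub>R x"

lemma N_ge_2: "2 \<le> N" using dim by (simp add: N_def)

lemma bb_pos: "0 < bb" using kappa_pos beta_pos by (simp add: bb_def)

lemma RR_pos: "0 < RR j" by (simp add: RR_def)

lemma RR_Suc: "RR j = 101/100 * RR (Suc j)"
proof -
  have "101/100 * RR (Suc j) = (101/100) powr (1 + (- N / 2 - real (Suc j)))"
    by (simp only: RR_def powr_add) simp
  then show ?thesis by (simp add: RR_def)
qed

lemma bub_sphere: "norm x = 1 \<Longrightarrow> bub j (x::'a) = RR j"
  by (simp add: bub_def RR_def N_def power2_norm_eq_inner[symmetric])

lemma bub_grad: "has_grad (bub k :: 'a \<Rightarrow> real) (\<lambda>x. (- (N + 2 * real k) * bub (Suc k) x) *\<^sub>R x)"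
  unfolding N_def by (rule has_grad_bub)

lemma continuous_bub: "continuous_on S (bub k :: 'a \<Rightarrow> real)"
  by (rule has_gradD(3)[OF has_grad_bub])

lemma inner_grad: "has_grad (\<lambda>x. x \<bullet> a) (\<lambda>x. a)"
  using has_grad_inner[of 0 a] by simp

lemma continuous_ff: "continuous_on S ff" "continuous_on S (df a)" "continuous_on S (d2f a)"
    "continuous_on S (zz a)" "continuous_on S (Gz a)"
  unfolding ff_def[abs_def] df_def[abs_def] d2f_def[abs_def] zz_def[abs_def] Gz_def[abs_def]
  by (intro continuous_intros continuous_bub)+

text \<open>The right-hand side is the divergence of \<open>bub 0 x *\<^sub>R x\<close>, that is,
  minus the Laplacian of \<open>u0\<close>.\<close>

lemma ff_eq: "ff x = N * bub 0 x - N * (bub 1 x * (x \<bullet> x))"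
  using bub_Suc[of 0 x] by (simp add: ff_def algebra_simps)

lemma ff_grad: "has_grad ff (\<lambda>x. (- (N * (N + 2) / 100) * bub 2 x) *\<^sub>R x)"
  unfolding ff_def[abs_def]
proof (rule has_grad_cong[OF has_grad_cmult[OF bub_grad[of 1], of "N / 100"] refl])
  fix x :: 'a
  show "(N / 100) *\<^sub>R (- (N + 2 * real 1) * bub (Suc 1) x) *\<^sub>R x = (- (N * (N + 2) / 100) * bub 2 x) *\<^sub>R x"
    unfolding scaleR_scaleR by (rule arg_cong[of _ _ "\<lambda>c. c *\<^sub>R x"]) (simp add: numeral_2_eq_2 algebra_simps)
qed

lemma u0_weak:
  assumes \<phi>: "has_grad \<phi> G"
  shows "aform (\<lambda>x. - bub 0 x *\<^sub>R x) u0 G \<phi> = (LINT x|vol. ff x * \<phi> x)"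
proof (rule green_weak_form[OF \<phi>, where A="\<lambda>b x. - (bub 0 x *\<^sub>R b + ((x \<bullet> b) * (- N * bub 1 x)) *\<^sub>R x)"])
  fix b :: 'a
  show "has_grad (\<lambda>x. (- bub 0 x *\<^sub>R x) \<bullet> b) (\<lambda>x. - (bub 0 x *\<^sub>R b + ((x \<bullet> b) * (- N * bub 1 x)) *\<^sub>R x))"
    by (rule has_grad_cong[OF has_grad_cmult[OF has_grad_mult[OF bub_grad[of 0] inner_grad[of b]], of "-1"]])
      (auto simp: algebra_simps)
next
  fix x :: 'a
  have "(\<Sum>b\<in>Basis. - (bub 0 x *\<^sub>R b + ((x \<bullet> b) * (- N * bub 1 x)) *\<^sub>R x) \<bullet> b)
      = (\<Sum>b\<in>(Basis :: 'a set). - bub 0 x) + (\<Sum>b\<in>Basis. (N * bub 1 x) * (x \<bullet> b) * (x \<bullet> b))"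
    unfolding sum.distrib[symmetric] by (intro sum.cong) (auto simp: inner_diff_left inner_add_left algebra_simps)
  also have "\<dots> = - ff x" unfolding sum_Basis_inner_mult ff_eq by (simp add: N_def)
  finally show "(\<Sum>b\<in>Basis. - (bub 0 x *\<^sub>R b + ((x \<bullet> b) * (- N * bub 1 x)) *\<^sub>R x) \<bullet> b) = - ff x" .
next
  fix x :: 'a assume "norm (x - 0) = 1"
  then show "\<kappa> * ((- bub 0 x *\<^sub>R x) \<bullet> (x - 0)) = - \<beta> * u0 x"
    using u0_sphere[of x] by (simp add: power2_norm_eq_inner[symmetric])
qed (intro continuous_intros continuous_bub continuous_ff has_gradD(3)[OF u0_grad])+

lemma zz_grad: "has_grad (zz a) (Gz a)"
  unfolding zz_def[abs_def] Gz_def[abs_def]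
  by (rule has_grad_cong[OF has_grad_mult[OF inner_grad has_grad_add[OF has_grad_const[of lam] has_grad_cmult[OF bub_grad[of 0], of "-1"]]]])
    (auto simp: algebra_simps)

lemma zz_weak:
  assumes \<phi>: "has_grad \<phi> G"
  shows "aform (Gz a) (zz a) G \<phi> = (LINT x|vol. df a x * \<phi> x)"
proof (rule green_weak_form[OF \<phi>, where
      A="\<lambda>b x. (N * (a \<bullet> b) * bub 1 x) *\<^sub>R x + N *\<^sub>R ((bub 1 x * (x \<bullet> b)) *\<^sub>R a + ((x \<bullet> a) * bub 1 x) *\<^sub>R b
        + (- (N + 2) * ((x \<bullet> a) * (x \<bullet> b)) * bub 2 x) *\<^sub>R x)"])
  fix b :: 'a
  show "has_grad (\<lambda>x. Gz a x \<bullet> b) (\<lambda>x. (N * (a \<bullet> b) * bub 1 x) *\<^sub>R x + N *\<^sub>R ((bub 1 x * (x \<bullet> b)) *\<^sub>R a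
      + ((x \<bullet> a) * bub 1 x) *\<^sub>R b + (- (N + 2) * ((x \<bullet> a) * (x \<bullet> b)) * bub 2 x) *\<^sub>R x))"
    unfolding Gz_def
    by (rule has_grad_cong[OF has_grad_add[OF
          has_grad_cmult[OF has_grad_add[OF has_grad_const[of lam] has_grad_cmult[OF bub_grad[of 0], of "-1"]], of "a \<bullet> b"]
          has_grad_cmult[OF has_grad_mult[OF has_grad_mult[OF inner_grad[of a] bub_grad[of 1]] inner_grad[of b]], of N]]])
      (auto simp: inner_add_left algebra_simps numeral_2_eq_2)
next
  fix x :: 'a
  let ?p = "x \<bullet> a"
  have "(\<Sum>b\<in>Basis. ((N * (a \<bullet> b) * bub 1 x) *\<^sub>R x + N *\<^sub>R ((bub 1 x * (x \<bullet> b)) *\<^sub>R a + (?p * bub 1 x) *\<^sub>R b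
        + (- (N + 2) * (?p * (x \<bullet> b)) * bub 2 x) *\<^sub>R x)) \<bullet> b)
    = (\<Sum>b\<in>Basis. (2 * N * bub 1 x) * (x \<bullet> b) * (a \<bullet> b)) + (\<Sum>b\<in>(Basis :: 'a set). N * (?p * bub 1 x))
      + (\<Sum>b\<in>Basis. (- N * (N + 2) * ?p * bub 2 x) * (x \<bullet> b) * (x \<bullet> b))"
    unfolding sum.distrib[symmetric] by (intro sum.cong) (auto simp: inner_add_left algebra_simps)
  also have "\<dots> = 2 * N * bub 1 x * ?p + N * (N * (?p * bub 1 x)) + - N * (N + 2) * ?p * bub 2 x * (x \<bullet> x)"
    unfolding sum_Basis_inner_mult by (simp add: N_def)
  also have "\<dots> = N * (N + 2) * ?p * (bub 1 x - bub 2 x * (x \<bullet> x))" by (simp add: algebra_simps)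
  also have "bub 1 x - bub 2 x * (x \<bullet> x) = bub 2 x / 100"
    using bub_Suc[of 1 x] by (simp add: numeral_2_eq_2 algebra_simps)
  also have "N * (N + 2) * ?p * (bub 2 x / 100) = - df a x" by (simp add: df_def)
  finally show "(\<Sum>b\<in>Basis. ((N * (a \<bullet> b) * bub 1 x) *\<^sub>R x + N *\<^sub>R ((bub 1 x * (x \<bullet> b)) *\<^sub>R a + (?p * bub 1 x) *\<^sub>R b
        + (- (N + 2) * (?p * (x \<bullet> b)) * bub 2 x) *\<^sub>R x)) \<bullet> b) = - df a x" .
next
  fix x :: 'a assume "norm (x - 0) = 1"
  then have x: "norm x = 1" "x \<bullet> x = 1" by (simp_all add: power2_norm_eq_inner[symmetric])
  have "\<kappa> * (lam - RR 0 + N * RR 1) = - \<beta> * (lam - RR 0)"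
    using bb_pos kappa_pos by (simp add: lam_def bb_def field_simps)
  then have "\<kappa> * (lam - RR 0 + N * RR 1) * (x \<bullet> a) = - \<beta> * (lam - RR 0) * (x \<bullet> a)" by simp
  then show "\<kappa> * (Gz a x \<bullet> (x - 0)) = - \<beta> * zz a x"
    using x by (simp add: Gz_def zz_def bub_sphere inner_add_left inner_commute[of a x] algebra_simps)
qed (intro continuous_ff)+

section \<open>The integrals entering the second variation\<close>

definition om :: real where "om = (LINT x|vol. 1)"

lemma om_pos: "0 < om"
proof -
  have "om = measure lebesgue (ball (0::'a) 1)"
    by (simp add: om_def measure_restrict_space space_restrict_space)
  then show ?thesis by (simp add: content_ball)
qed

text \<open>The divergence theorem for \<open>x \<bullet> a\<close> in direction \<open>a\<close>.
  It reduces the boundary terms quadratic in \<open>a\<close> to the volume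
  \<open>om\<close>.\<close>

lemma surf_inner_sq: "\<kappa> * (LINT x|surf. (x \<bullet> a) * (x \<bullet> a)) = (a \<bullet> a) * om"
  using divergence[OF inner_grad[of a], of a] by (simp add: om_def mult.commute)

text \<open>The weak equation of \<open>u0\<close> tested with 1 gives a boundary integral of a
  constant, and the divergence theorem for the identity field gives the area of the sphere.\<close>

lemma integral_ff: "(LINT x|vol. ff x) = N * RR 0 * om"
proof -
  have "N * om = \<kappa> * (LINT x|surf. 1)"
  proof -
    have "(LINT x|vol. 0 \<bullet> x + 1 * (\<Sum>b\<in>(Basis :: 'a set). b \<bullet> b)) = \<kappa> * (LINT x|surf. 1 * (x \<bullet> (x - 0)))"
      by (rule green_identity[OF has_grad_const[of 1], of "\<lambda>x. x" "\<lambda>b x. b"]) (rule inner_grad)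
    also have "(LINT x|surf. 1 * (x \<bullet> (x - 0))) = (LINT x|surf. 1)"
      by (intro Bochner_Integration.integral_cong) (auto simp: space_surf power2_norm_eq_inner[symmetric])
    finally show ?thesis by (simp add: om_def N_def mult.commute)
  qed
  moreover have "(LINT x|vol. ff x) = \<beta> * (LINT x|surf. u0 x)"
    using u0_weak[OF has_grad_const[of 1]] by (simp add: aform_def)
  moreover have "\<beta> * (LINT x|surf. u0 x) = (LINT x|surf. \<kappa> * RR 0)"
    unfolding Bochner_Integration.integral_mult_right_zero[symmetric]
    by (intro Bochner_Integration.integral_cong) (auto simp: space_surf u0_sphere bub_sphere)
  ultimately show ?thesis by (simp add: mult_ac)
qed

text \<open>The divergence theorem for \<open>ff x * (x \<bullet> a)\<close> in direction
  \<open>a\<close>. The boundary contributes \<open>N / 100 * RR 1\<close> and the volume integral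
  of \<open>ff\<close> contributes \<open>- N * RR 0\<close>; by \<open>RR_Suc\<close> they combine
  to \<open>- N * RR 1\<close>.\<close>

lemma integral_df_inner: "(LINT x|vol. df a x * (x \<bullet> a)) = - N * RR 1 * ((a \<bullet> a) * om)"
proof -
  have "(LINT x|vol. (ff x *\<^sub>R a + (x \<bullet> a) *\<^sub>R ((- (N * (N + 2) / 100) * bub 2 x) *\<^sub>R x)) \<bullet> a)
     = \<kappa> * (LINT x|surf. (ff x * (x \<bullet> a)) * ((x - 0) \<bullet> a))"
    by (rule divergence[OF has_grad_mult[OF ff_grad inner_grad]])
  also have "(LINT x|surf. (ff x * (x \<bullet> a)) * ((x - 0) \<bullet> a)) = (LINT x|surf. N / 100 * RR 1 * ((x \<bullet> a) * (x \<bullet> a)))"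
    by (intro Bochner_Integration.integral_cong) (auto simp: space_surf ff_def bub_sphere)
  also have "\<kappa> * \<dots> = N / 100 * RR 1 * ((a \<bullet> a) * om)"
    unfolding surf_inner_sq[symmetric] by simp
  also have "(LINT x|vol. (ff x *\<^sub>R a + (x \<bullet> a) *\<^sub>R ((- (N * (N + 2) / 100) * bub 2 x) *\<^sub>R x)) \<bullet> a)
     = (LINT x|vol. ff x * (a \<bullet> a) + df a x * (x \<bullet> a))"
    by (intro Bochner_Integration.integral_cong) (auto simp: df_def inner_add_left algebra_simps)
  also have "\<dots> = (LINT x|vol. ff x) * (a \<bullet> a) + (LINT x|vol. df a x * (x \<bullet> a))"
    by (subst Bochner_Integration.integral_add) (auto intro!: integrable_vol continuous_intros continuous_ff)
  finally show ?thesis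
    unfolding integral_ff using RR_Suc[of 0] by (simp add: algebra_simps)
qed

lemma df_grad: "has_grad (df a) (\<lambda>x. (- (N * (N + 2) / 100)) *\<^sub>R (bub 2 x *\<^sub>R a + (x \<bullet> a) *\<^sub>R ((- (N + 4) * bub 3 x) *\<^sub>R x)))"
  unfolding df_def[abs_def]
  by (rule has_grad_cong[OF has_grad_cmult[OF has_grad_mult[OF bub_grad[of 2] inner_grad[of a]], of "- (N * (N + 2) / 100)"]])
    (auto simp: numeral_3_eq_3 numeral_2_eq_2)

text \<open>The divergence theorem for \<open>df a x * u0 x\<close> in direction \<open>a\<close>,
  with \<open>- bub 0 x * (x \<bullet> a)\<close> as the derivative of \<open>u0\<close>.\<close>

lemma integral_d2f_u0:
  "(LINT x|vol. d2f a x * u0 x) - (LINT x|vol. df a x * (bub 0 x * (x \<bullet> a)))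
    = - (N * (N + 2) / 100) * (RR 2 * RR 0 / bb) * ((a \<bullet> a) * om)"
proof -
  let ?D = "\<lambda>x. (- (N * (N + 2) / 100)) *\<^sub>R (bub 2 x *\<^sub>R a + (x \<bullet> a) *\<^sub>R ((- (N + 4) * bub 3 x) *\<^sub>R x))"
  have "(LINT x|vol. (df a x *\<^sub>R (- bub 0 x *\<^sub>R x) + u0 x *\<^sub>R ?D x) \<bullet> a) = \<kappa> * (LINT x|surf. (df a x * u0 x) * ((x - 0) \<bullet> a))"
    by (rule divergence[OF has_grad_mult[OF df_grad u0_grad]])
  also have "(LINT x|surf. (df a x * u0 x) * ((x - 0) \<bullet> a))
    = (LINT x|surf. - (N * (N + 2) / 100) * (RR 2 * RR 0 / bb) * ((x \<bullet> a) * (x \<bullet> a)))"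
  proof (rule Bochner_Integration.integral_cong)
    fix x assume "x \<in> space surf"
    then have x: "norm x = 1" by (simp add: space_surf)
    have "u0 x = RR 0 / bb"
      using u0_sphere[OF x] beta_pos kappa_pos by (simp add: bub_sphere[OF x] bb_def field_simps)
    then show "(df a x * u0 x) * ((x - 0) \<bullet> a) = - (N * (N + 2) / 100) * (RR 2 * RR 0 / bb) * ((x \<bullet> a) * (x \<bullet> a))"
      by (simp add: df_def bub_sphere[OF x])
  qed simp
  also have "\<kappa> * \<dots> = - (N * (N + 2) / 100) * (RR 2 * RR 0 / bb) * ((a \<bullet> a) * om)"
    unfolding surf_inner_sq[symmetric] by simp
  also have "(LINT x|vol. (df a x *\<^sub>R (- bub 0 x *\<^sub>R x) + u0 x *\<^sub>R ?D x) \<bullet> a)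
    = (LINT x|vol. d2f a x * u0 x - df a x * (bub 0 x * (x \<bullet> a)))"
    by (intro Bochner_Integration.integral_cong)
      (auto simp: d2f_def inner_add_left inner_diff_left algebra_simps power2_eq_square)
  also have "\<dots> = (LINT x|vol. d2f a x * u0 x) - (LINT x|vol. df a x * (bub 0 x * (x \<bullet> a)))"
    by (rule Bochner_Integration.integral_diff)
      (intro integrable_vol continuous_intros continuous_ff continuous_bub has_gradD(3)[OF u0_grad])+
  finally show ?thesis .
qed

text \<open>The coefficient in J(B + a) <= J(B) - gain |a|^2 + O(|a|^3). For a general
  regularisation s the bracket would read (N + 2) s / bb + (1 + s) - N / (1 + bb); as s tends to 0
  it becomes 1 - N / (1 + bb), which is negative exactly for bb < N - 1. For fixed s the first
  summand prevents bb from being small.\<close>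

definition "gain = - 1/2 * om * N * (RR 1)\<^sup>2 * ((N + 2) / (100 * bb) + 101/100 - N / (1 + bb))"

text \<open>Both occurrences of \<open>\<integral> df (x \<cdot> a) bub 0\<close> cancel.\<close>

lemma second_variation:
  "1/2 * (LINT x|vol. d2f a x * u0 x) + 1/2 * (LINT x|vol. df a x * zz a x) = gain * (a \<bullet> a)"
proof -
  have "(LINT x|vol. df a x * zz a x) = (LINT x|vol. lam * (df a x * (x \<bullet> a)) - df a x * (bub 0 x * (x \<bullet> a)))"
    by (intro Bochner_Integration.integral_cong) (auto simp: zz_def algebra_simps)
  also have "\<dots> = lam * (LINT x|vol. df a x * (x \<bullet> a)) - (LINT x|vol. df a x * (bub 0 x * (x \<bullet> a)))"
    by (subst Bochner_Integration.integral_diff) (auto intro!: integrable_vol continuous_intros continuous_ff continuous_bub)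
  finally have z: "(LINT x|vol. df a x * zz a x) = lam * (- N * RR 1 * ((a \<bullet> a) * om)) - (LINT x|vol. df a x * (bub 0 x * (x \<bullet> a)))"
    by (simp only: integral_df_inner)
  have "RR 2 * RR 0 = (RR 1)\<^sup>2"
  proof -
    have "RR 2 * RR 0 = (101/100 * RR 2) * RR 1" using RR_Suc[of 0] by simp
    also have "101/100 * RR 2 = RR 1" using RR_Suc[of 1] by (simp add: numeral_2_eq_2)
    finally show ?thesis by (simp add: power2_eq_square)
  qed
  moreover have "lam = RR 1 * (101/100 - N / (1 + bb))"
    using RR_Suc[of 0] by (simp add: lam_def algebra_simps)
  ultimately have "1/2 * (LINT x|vol. d2f a x * u0 x) + 1/2 * (LINT x|vol. df a x * zz a x)
    = 1/2 * (- (N * (N + 2) / 100) * ((RR 1)\<^sup>2 / bb) * ((a \<bullet> a) * om)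
        + RR 1 * (101/100 - N / (1 + bb)) * (- N * RR 1 * ((a \<bullet> a) * om)))"
    using integral_d2f_u0[of a] z by (simp only: ) argo
  also have "\<dots> = gain * (a \<bullet> a)"
  proof -
    have "1/2 * (- (N * (N + 2) / 100) * (R\<^sup>2 / bb) * (A * om) + R * (101/100 - X) * (- N * R * (A * om)))
      = - 1/2 * om * N * R\<^sup>2 * ((N + 2) / (100 * bb) + 101/100 - X) * A" for R A X :: real
      using bb_pos by (simp add: field_simps power2_eq_square)
    then show ?thesis unfolding gain_def .
  qed
  finally show ?thesis .
qed

text \<open>On this range the bracket is at most (N + 2) / 25 + 101/100 - 2 N / 3, which decreases
  in N and is already negative at N = 2.\<close>

lemma gain_pos:
  assumes "1/4 < bb" "bb < 1/2" shows "0 < gain"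
proof -
  have "(N + 2) / (100 * bb) \<le> (N + 2) / 25"
    using assms N_ge_2 by (intro divide_left_mono) auto
  moreover have "N * (2/3) \<le> N / (1 + bb)"
    using assms N_ge_2 bb_pos by (simp add: field_simps)
  ultimately have "(N + 2) / (100 * bb) + 101/100 - N / (1 + bb) < 0"
    using N_ge_2 by argo
  then show ?thesis
    unfolding gain_def using om_pos N_ge_2 RR_pos[of 1]
    by (intro mult_neg_neg) (auto simp: mult_less_0_iff zero_less_mult_iff)
qed

section \<open>The cubic Taylor remainder of the source\<close>

definition d3f :: "'a \<Rightarrow> 'a \<Rightarrow> real" where
  "d3f a x = N * (N + 2) / 100 * (N + 4) *
     (3 * (bub 3 x * (x \<bullet> a) * (a \<bullet> a)) - (N + 6) * (bub 4 x * (x \<bullet> a) ^ 3))"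

lemma d2f_grad:
  "has_grad (d2f a) (\<lambda>x. (- (N * (N + 2) / 100)) *\<^sub>R
     ((a \<bullet> a) *\<^sub>R ((- (N + 4) * bub 3 x) *\<^sub>R x) - (N + 4) *\<^sub>R
       ((x \<bullet> a)\<^sup>2 *\<^sub>R ((- (N + 6) * bub 4 x) *\<^sub>R x) + (bub 3 x * (2 * (x \<bullet> a))) *\<^sub>R a)))"
proof -
  have sq: "has_grad (\<lambda>x. (x \<bullet> a)\<^sup>2) (\<lambda>x. (2 * (x \<bullet> a)) *\<^sub>R a)"
    by (rule has_grad_cong[OF has_grad_mult[OF inner_grad[of a] inner_grad[of a]]])
      (auto simp: power2_eq_square scaleR_2[symmetric])
  have b: "has_grad (bub 2 :: 'a \<Rightarrow> real) (\<lambda>x. (- (N + 4) * bub 3 x) *\<^sub>R x)"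
    "has_grad (bub 3 :: 'a \<Rightarrow> real) (\<lambda>x. (- (N + 6) * bub 4 x) *\<^sub>R x)"
    using bub_grad[of 2] bub_grad[of 3] by simp_all
  have neg: "(- N - 4) *\<^sub>R v = - ((N + 4) *\<^sub>R v)" for v :: 'a
    unfolding scaleR_minus_left[symmetric] by simp
  show ?thesis
    unfolding d2f_def[abs_def]
    by (rule has_grad_cong[OF has_grad_cmult[OF has_grad_add[OF has_grad_cmult[OF b(1), of "a \<bullet> a"]
            has_grad_cmult[OF has_grad_cmult[OF has_grad_mult[OF b(2) sq], of "N + 4"], of "-1"]], of "- (N * (N + 2) / 100)"]])
      (simp_all add: mult.commute add.commute neg)
qed

lemma has_grad_DERIV_line:
  assumes "has_grad \<phi> G" shows "DERIV (\<lambda>t. \<phi> (x + t *\<^sub>R a)) t :> G (x + t *\<^sub>R a) \<bullet> a"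
proof -
  have "((\<lambda>t. \<phi> (x + t *\<^sub>R a)) has_derivative (\<lambda>s. G (x + t *\<^sub>R a) \<bullet> (s *\<^sub>R a))) (at t)"
    by (rule has_derivative_compose[OF _ has_gradD(1)[OF assms]]) (auto intro!: derivative_eq_intros)
  then show ?thesis by (simp add: has_field_derivative_def mult_commute_abs)
qed

text \<open>The numbers 6 = 3 * 2 and 8 = 2^3 come from
  \<open>\<bar>x \<bullet> a\<bar> \<le> 2 * norm a\<close> on the ball of radius 2; each
  \<open>bub k\<close> is largest at 0.\<close>

definition "C3 = N * (N + 2) / 100 * (N + 4) * (6 * bub 3 (0::'a) + 8 * (N + 6) * bub 4 (0::'a))"

lemma d3f_bound:
  assumes x: "norm x \<le> 2" shows "\<bar>d3f a x\<bar> \<le> C3 * norm a ^ 3"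
proof -
  have aa: "a \<bullet> a = norm a ^ 2" by (simp add: power2_norm_eq_inner)
  have p: "\<bar>x \<bullet> a\<bar> \<le> 2 * norm a"
    using order_trans[OF Cauchy_Schwarz_ineq2[of x a] mult_right_mono[OF x norm_ge_zero]] .
  have b: "0 \<le> bub 3 x" "0 \<le> bub 4 x" "bub 3 x \<le> bub 3 (0::'a)" "bub 4 x \<le> bub 4 (0::'a)"
    using bub_pos[of 3 x] bub_pos[of 4 x] bub_le[of 3 x] bub_le[of 4 x] by simp_all
  have 1: "\<bar>bub 3 x * (x \<bullet> a) * (a \<bullet> a)\<bar> \<le> bub 3 (0::'a) * (2 * norm a) * norm a ^ 2"
    unfolding abs_mult aa using b p by (intro mult_mono) (auto intro!: mult_nonneg_nonneg)
  have "\<bar>x \<bullet> a\<bar> ^ 3 \<le> (2 * norm a) ^ 3" using p by (intro power_mono) auto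
  then have 2: "\<bar>bub 4 x * (x \<bullet> a) ^ 3\<bar> \<le> bub 4 (0::'a) * (2 * norm a) ^ 3"
    unfolding abs_mult power_abs using b by (intro mult_mono) auto
  have "\<bar>3 * (bub 3 x * (x \<bullet> a) * (a \<bullet> a)) - (N + 6) * (bub 4 x * (x \<bullet> a) ^ 3)\<bar>
      \<le> 3 * \<bar>bub 3 x * (x \<bullet> a) * (a \<bullet> a)\<bar> + (N + 6) * \<bar>bub 4 x * (x \<bullet> a) ^ 3\<bar>"
    using N_ge_2 abs_triangle_ineq4[of "3 * (bub 3 x * (x \<bullet> a) * (a \<bullet> a))" "(N + 6) * (bub 4 x * (x \<bullet> a) ^ 3)"]
    by (simp add: abs_mult)
  also have "\<dots> \<le> 3 * (bub 3 (0::'a) * (2 * norm a) * norm a ^ 2) + (N + 6) * (bub 4 (0::'a) * (2 * norm a) ^ 3)"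
    using 1 2 N_ge_2 by (intro add_mono mult_left_mono) auto
  also have "\<dots> = (6 * bub 3 (0::'a) + 8 * (N + 6) * bub 4 (0::'a)) * norm a ^ 3"
    by (simp add: power3_eq_cube power2_eq_square algebra_simps)
  finally have "N * (N + 2) / 100 * (N + 4) * \<bar>3 * (bub 3 x * (x \<bullet> a) * (a \<bullet> a)) - (N + 6) * (bub 4 x * (x \<bullet> a) ^ 3)\<bar>
      \<le> N * (N + 2) / 100 * (N + 4) * ((6 * bub 3 (0::'a) + 8 * (N + 6) * bub 4 (0::'a)) * norm a ^ 3)"
    using N_ge_2 by (intro mult_left_mono) auto
  then show ?thesis using N_ge_2 unfolding d3f_def C3_def abs_mult by (simp add: mult.assoc)
qed

text \<open>Maclaurin's formula along the segment from \<open>x\<close> to \<open>x + a\<close>,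
  which stays in the ball of radius 2; the factor 1/6 of the remainder is dropped.\<close>

lemma taylor_ff:
  assumes x: "norm x \<le> 1" and a: "norm a \<le> 1"
  shows "\<bar>ff (x + a) - ff x - df a x - 1/2 * d2f a x\<bar> \<le> C3 * norm a ^ 3"
proof -
  define D where "D m t = (case m of 0 \<Rightarrow> ff (x + t *\<^sub>R a) | Suc 0 \<Rightarrow> df a (x + t *\<^sub>R a)
    | Suc (Suc 0) \<Rightarrow> d2f a (x + t *\<^sub>R a) | _ \<Rightarrow> d3f a (x + t *\<^sub>R a))" for m :: nat and t :: real
  have "DERIV (D m) t :> D (Suc m) t" if m: "m < 3" for m t
  proof -
    consider "m = 0" | "m = Suc 0" | "m = Suc (Suc 0)" using m by linarith
    then show ?thesis
    proof cases
      case 1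
      show ?thesis using has_grad_DERIV_line[OF ff_grad, of x a t] unfolding 1 D_def by (simp add: df_def mult.assoc)
    next
      case 2
      have "((- (N * (N + 2) / 100)) *\<^sub>R (bub 2 y *\<^sub>R a + (y \<bullet> a) *\<^sub>R ((- (N + 4) * bub 3 y) *\<^sub>R y))) \<bullet> a = d2f a y" for y
        by (simp add: d2f_def inner_add_left algebra_simps power2_eq_square)
      then show ?thesis using has_grad_DERIV_line[OF df_grad[of a], of x a t] unfolding 2 D_def by simp
    next
      case 3
      have eq: "- c * (aa * (- (N + 4) * b3 * p) - (N + 4) * (p\<^sup>2 * (- (N + 6) * b4 * p) + b3 * (2 * p) * aa))
          = c * (N + 4) * (3 * (b3 * p * aa) - (N + 6) * (b4 * p ^ 3))" for c aa b3 b4 p :: real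
        by (simp add: power2_eq_square power3_eq_cube algebra_simps)
      have "((- (N * (N + 2) / 100)) *\<^sub>R ((a \<bullet> a) *\<^sub>R ((- (N + 4) * bub 3 y) *\<^sub>R y) - (N + 4) *\<^sub>R
          ((y \<bullet> a)\<^sup>2 *\<^sub>R ((- (N + 6) * bub 4 y) *\<^sub>R y) + (bub 3 y * (2 * (y \<bullet> a))) *\<^sub>R a))) \<bullet> a = d3f a y" for y
        unfolding d3f_def eq[symmetric] by (simp only: inner_scaleR_left inner_diff_left inner_add_left mult.assoc)
      then show ?thesis using has_grad_DERIV_line[OF d2f_grad[of a], of x a t] unfolding 3 D_def by simp
    qed
  qed
  then have "\<exists>t>0. t < 1 \<and> ff (x + 1 *\<^sub>R a) = (\<Sum>m<3. D m 0 / fact m * 1 ^ m) + D 3 t / fact 3 * 1 ^ 3"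
    by (intro Maclaurin[of 1 3 D "\<lambda>t. ff (x + t *\<^sub>R a)"]) (auto simp: D_def)
  then obtain t where t: "0 < t" "t < 1" "ff (x + a) = (\<Sum>m<3. D m 0 / fact m) + D 3 t / 6"
    by (auto simp: fact_numeral)
  have "(\<Sum>m<3. D m 0 / fact m) = ff x + df a x + 1/2 * d2f a x"
    by (simp add: numeral_3_eq_3 D_def)
  then have "ff (x + a) - ff x - df a x - 1/2 * d2f a x = d3f a (x + t *\<^sub>R a) / 6"
    using t(3) by (simp add: D_def numeral_3_eq_3)
  moreover have "\<bar>d3f a (x + t *\<^sub>R a)\<bar> \<le> C3 * norm a ^ 3"
  proof (rule d3f_bound)
    have "norm (t *\<^sub>R a) \<le> 1" using t a mult_mono[of "\<bar>t\<bar>" 1 "norm a" 1] by simp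
    then show "norm (x + t *\<^sub>R a) \<le> 2" using x norm_triangle_ineq[of x "t *\<^sub>R a"] by linarith
  qed
  ultimately show ?thesis by simp
qed

section \<open>The energy of the translated ball\<close>

lemma robin_J_centred: "robin_J \<beta> ff (ball 0 1) = ereal (- 1/2 * (LINT x|vol. ff x * u0 x))"
proof (rule energy_minimal)
  show ffL2: "L2 vol ff" by (rule L2_vol[OF continuous_ff(1)])
  show u: "H1_data (ball 0 1) u0 (\<lambda>x. - bub 0 x *\<^sub>R x) u0" by (rule has_grad_H1_data[OF u0_grad])
  show "aform (\<lambda>x. - bub 0 x *\<^sub>R x) u0 H h = (LINT x|vol. ff x * v x)" if "H1_data (ball 0 1) v H h" for v H h
    by (rule weak_form_H1[OF u ffL2 u0_weak that])
qed

text \<open>The translate of \<phi> is admissible on the ball about \<open>a\<close>. Its gradient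
  and boundary terms are those on the centred ball, and the source is pulled back.\<close>

lemma translated_energy:
  assumes a: "robin_ball a \<kappa> \<beta>" and \<phi>: "has_grad \<phi> G"
  shows "robin_J \<beta> ff (ball a 1) \<le> ereal (energy (\<lambda>x. ff (x + a)) \<phi> G \<phi>)"
proof -
  interpret A: robin_ball a \<kappa> \<beta> by (rule a)
  have t: "has_grad (\<lambda>x. \<phi> (x - a)) (\<lambda>x. G (x - a))" by (rule has_grad_translate[OF \<phi>])
  have vol: "(LINT x|A.vol. h (x - a)) = (LINT x|vol. h x)" if "continuous_on UNIV h" for h :: "'a \<Rightarrow> real"
  proof -
    have [measurable]: "h \<in> borel_measurable borel" using that by (rule borel_measurable_continuous_onI)
    show ?thesis by (subst (1 2) integral_lebesgue_on_ball) auto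
  qed
  have surf: "(LINT x|A.surf. h (x - a)) = (LINT x|surf. h x)" if "continuous_on UNIV h" for h :: "'a \<Rightarrow> real"
  proof -
    have [measurable]: "h \<in> borel_measurable borel" using that by (rule borel_measurable_continuous_onI)
    show ?thesis by (subst integral_surface_measure_translate[OF dim]) auto
  qed
  note c = has_gradD(2,3)[OF \<phi>, of UNIV] continuous_ff(1)
  have "(LINT x|A.vol. (norm (G (x - a)))\<^sup>2) = (LINT x|vol. (norm (G x))\<^sup>2)"
    by (rule vol) (intro continuous_intros c)
  moreover have "(LINT x|A.surf. (\<phi> (x - a))\<^sup>2) = (LINT x|surf. (\<phi> x)\<^sup>2)"
    by (rule surf) (intro continuous_intros c)
  moreover have "(LINT x|A.vol. ff x * \<phi> (x - a)) = (LINT x|vol. ff (x + a) * \<phi> x)"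
    using vol[of "\<lambda>x. ff (x + a) * \<phi> x"]
    by (simp add: continuous_intros c continuous_on_compose2[OF continuous_ff(1)[of UNIV]])
  ultimately have "A.energy ff (\<lambda>x. \<phi> (x - a)) (\<lambda>x. G (x - a)) (\<lambda>x. \<phi> (x - a)) = energy (\<lambda>x. ff (x + a)) \<phi> G \<phi>"
    by (simp add: A.energy_def energy_def)
  then show ?thesis
    unfolding A.robin_J_eq using A.has_grad_H1_data[OF t]
    by (intro INF_lower2[of "(\<lambda>x. \<phi> (x - a), \<lambda>x. G (x - a), \<lambda>x. \<phi> (x - a))"]) auto
qed

text \<open>Test with \<open>u0 + zz a\<close> and expand the source to second order. The first
  order term is the integral of an odd function; the weak equations of \<open>u0\<close> and
  \<open>zz a\<close> leave \<open>second_variation\<close> with a minus sign. The remaining terms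
  are cubic: two contain the Taylor remainder, the third is \<open>d2f a\<close>, quadratic in
  \<open>a\<close>, times \<open>zz a\<close>, which is linear in \<open>a\<close>.\<close>

lemma robin_J_translated_le:
  obtains C where "0 < C" "\<And>a. norm a \<le> 1 \<Longrightarrow> robin_ball a \<kappa> \<beta> \<Longrightarrow>
    robin_J \<beta> ff (ball a 1) \<le> robin_J \<beta> ff (ball 0 1) + ereal (C * norm a ^ 3 - gain * norm a ^ 2)"
proof -
  obtain M where M: "0 < M" "\<And>x. norm x \<le> 1 \<Longrightarrow> norm (u0 x) \<le> M"
    using continuous_bound_cball[OF has_gradD(3)[OF u0_grad], of 1] by blast
  define Cz where "Cz = \<bar>lam\<bar> + bub 0 (0::'a)"
  define C2 where "C2 = N * (N + 2) / 100 * (bub 2 (0::'a) + (N + 4) * bub 3 (0::'a))"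
  have bub0: "0 \<le> bub k x" for k and x :: 'a by (rule less_imp_le[OF bub_pos])
  have C0: "0 \<le> Cz" "0 \<le> C2" "0 \<le> C3"
    using N_ge_2 bub0 by (auto simp: Cz_def C2_def C3_def intro!: add_nonneg_nonneg mult_nonneg_nonneg)
  \<comment> \<open>The first summand collects the three cubic error terms; the summand 1 makes
    \<open>C\<close> strictly positive, as the later quotient \<open>gain / C\<close>
    requires.\<close>
  define C where "C = om * (C3 * M + C3 * Cz + 1/2 * C2 * Cz) + 1"
  have C: "0 < C" unfolding C_def using C0 M(1) om_pos by (intro add_nonneg_pos mult_nonneg_nonneg add_nonneg_nonneg) auto
  have main: "robin_J \<beta> ff (ball a 1) \<le> robin_J \<beta> ff (ball 0 1) + ereal (C * norm a ^ 3 - gain * norm a ^ 2)"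
    if a: "norm a \<le> 1" and rb: "robin_ball a \<kappa> \<beta>" for a
  proof -
    let ?fa = "\<lambda>x. ff (x + a)" and ?Gu = "\<lambda>x::'a. - bub 0 x *\<^sub>R x"
    define r where "r x = ff (x + a) - ff x - df a x - 1/2 * d2f a x" for x
    have cfa: "continuous_on UNIV ?fa"
      by (rule continuous_on_compose2[OF continuous_ff(1)[of UNIV]]) (auto intro: continuous_intros)
    have cu: "continuous_on UNIV u0" by (rule has_gradD(3)[OF u0_grad])
    have cr: "continuous_on UNIV r" unfolding r_def[abs_def] by (intro continuous_intros continuous_ff cfa)
    note cs = cfa cu cr continuous_ff[of UNIV]
    note Lu = has_grad_L2[OF u0_grad] and Lz = has_grad_L2[OF zz_grad[of a]]
    have "energy ?fa (\<lambda>x. u0 x + 1 * zz a x) (\<lambda>x. ?Gu x + 1 *\<^sub>R Gz a x) (\<lambda>x. u0 x + 1 * zz a x)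
      = energy ?fa u0 ?Gu u0 + 1 * (aform ?Gu u0 (Gz a) (zz a) - (LINT x|vol. ff (x + a) * zz a x))
        + 1\<^sup>2 / 2 * aform (Gz a) (zz a) (Gz a) (zz a)"
      by (rule energy_expand[OF L2_vol[OF cfa] Lu Lz])
    also have "\<dots> = 1/2 * (LINT x|vol. ff x * u0 x) - (LINT x|vol. ff (x + a) * u0 x) + (LINT x|vol. ff x * zz a x)
        - (LINT x|vol. ff (x + a) * zz a x) + 1/2 * (LINT x|vol. df a x * zz a x)"
      unfolding energy_eq u0_weak[OF u0_grad] u0_weak[OF zz_grad] zz_weak[OF zz_grad] by simp
    finally have E: "energy ?fa (\<lambda>x. u0 x + 1 * zz a x) (\<lambda>x. ?Gu x + 1 *\<^sub>R Gz a x) (\<lambda>x. u0 x + 1 * zz a x) = \<dots>" .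
    have split: "(LINT x|vol. ff (x + a) * h x) = (LINT x|vol. ff x * h x) + (LINT x|vol. df a x * h x)
        + 1/2 * (LINT x|vol. d2f a x * h x) + (LINT x|vol. r x * h x)" if h: "continuous_on UNIV h" for h :: "'a \<Rightarrow> real"
    proof -
      have "(LINT x|vol. ff (x + a) * h x) = (LINT x|vol. ff x * h x + df a x * h x + 1/2 * (d2f a x * h x) + r x * h x)"
        by (intro Bochner_Integration.integral_cong) (auto simp: r_def algebra_simps)
      moreover have "integrable vol (\<lambda>x. ff x * h x)" "integrable vol (\<lambda>x. df a x * h x)"
          "integrable vol (\<lambda>x. d2f a x * h x)" "integrable vol (\<lambda>x. r x * h x)"
        by (intro integrable_vol continuous_intros cs h)+
      ultimately show ?thesis by simp
    qed
    have odd: "(LINT x|vol. df a x * u0 x) = 0"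
    proof (rule integral_unit_ball_odd)
      show "df a (- x) * u0 (- x) = - (df a x * u0 x)" for x by (simp add: df_def u0_even bub_def)
    qed (intro continuous_intros cs)
    have rbd: "\<bar>r x\<bar> \<le> C3 * norm a ^ 3" if "norm (x - 0) < 1" for x
      unfolding r_def using that a by (intro taylor_ff) auto
    have p: "\<bar>x \<bullet> a\<bar> \<le> norm a" if "norm (x - 0) < 1" for x
      using order_trans[OF Cauchy_Schwarz_ineq2[of x a] mult_left_le_one_le[of "norm a" "norm x"]] that by simp
    have zb: "\<bar>zz a x\<bar> \<le> norm a * Cz" if x: "norm (x - 0) < 1" for x
    proof -
      have "\<bar>lam - bub 0 x\<bar> \<le> Cz"
        using abs_triangle_ineq4[of lam "bub 0 x"] bub0[of 0 x] bub_le[of 0 x] by (simp add: Cz_def)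
      then show ?thesis unfolding zz_def abs_mult using p[OF x] by (intro mult_mono) auto
    qed
    have d2b: "\<bar>d2f a x\<bar> \<le> C2 * norm a ^ 2" if x: "norm (x - 0) < 1" for x
    proof -
      have aa: "a \<bullet> a = norm a ^ 2" by (simp add: power2_norm_eq_inner)
      have pp: "(x \<bullet> a)\<^sup>2 \<le> norm a ^ 2" using p[OF x] by (simp add: abs_le_square_iff[symmetric])
      have "\<bar>bub 2 x * (a \<bullet> a) - (N + 4) * (bub 3 x * (x \<bullet> a)\<^sup>2)\<bar>
          \<le> bub 2 x * (a \<bullet> a) + (N + 4) * (bub 3 x * (x \<bullet> a)\<^sup>2)"
      proof -
        have "0 \<le> bub 2 x * (a \<bullet> a)" "0 \<le> (N + 4) * (bub 3 x * (x \<bullet> a)\<^sup>2)"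
          using bub0 N_ge_2 by (auto intro!: mult_nonneg_nonneg)
        then show ?thesis by linarith
      qed
      also have "\<dots> \<le> bub 2 (0::'a) * norm a ^ 2 + (N + 4) * (bub 3 (0::'a) * norm a ^ 2)"
        unfolding aa using N_ge_2 pp bub0 bub_le[of 2 x] bub_le[of 3 x] by (intro add_mono mult_mono) auto
      finally have "N * (N + 2) / 100 * \<bar>bub 2 x * (a \<bullet> a) - (N + 4) * (bub 3 x * (x \<bullet> a)\<^sup>2)\<bar>
          \<le> N * (N + 2) / 100 * (bub 2 (0::'a) * norm a ^ 2 + (N + 4) * (bub 3 (0::'a) * norm a ^ 2))"
        using N_ge_2 by (intro mult_left_mono) auto
      moreover have "\<bar>d2f a x\<bar> = N * (N + 2) / 100 * \<bar>bub 2 x * (a \<bullet> a) - (N + 4) * (bub 3 x * (x \<bullet> a)\<^sup>2)\<bar>"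
        using N_ge_2 unfolding d2f_def abs_mult by simp
      moreover have "C2 * norm a ^ 2 = N * (N + 2) / 100 * (bub 2 (0::'a) * norm a ^ 2 + (N + 4) * (bub 3 (0::'a) * norm a ^ 2))"
        unfolding C2_def by (simp only: distrib_right distrib_left mult.assoc)
      ultimately show ?thesis by simp
    qed
    have a3: "norm a ^ 3 * norm a \<le> norm a ^ 3"
      using a by (intro mult_left_le) auto
    have b1: "\<bar>LINT x|vol. r x * u0 x\<bar> \<le> (C3 * norm a ^ 3 * M) * (LINT x|vol. 1)"
    proof (rule integral_vol_bound)
      fix x :: 'a assume x: "norm (x - 0) < 1"
      then have "\<bar>u0 x\<bar> \<le> M" using M(2)[of x] by simp
      then show "\<bar>r x * u0 x\<bar> \<le> C3 * norm a ^ 3 * M"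
        unfolding abs_mult using rbd[OF x] C0 by (intro mult_mono) auto
    qed (intro continuous_intros cs)
    have b2: "\<bar>LINT x|vol. r x * zz a x\<bar> \<le> (C3 * norm a ^ 3 * Cz) * (LINT x|vol. 1)"
    proof (rule integral_vol_bound)
      fix x :: 'a assume x: "norm (x - 0) < 1"
      have "\<bar>r x * zz a x\<bar> \<le> (C3 * norm a ^ 3) * (norm a * Cz)"
        unfolding abs_mult using rbd[OF x] zb[OF x] C0 by (intro mult_mono) auto
      also have "\<dots> = (C3 * Cz) * (norm a ^ 3 * norm a)" by simp
      also have "\<dots> \<le> (C3 * Cz) * norm a ^ 3" using a3 C0 by (intro mult_left_mono) auto
      finally show "\<bar>r x * zz a x\<bar> \<le> C3 * norm a ^ 3 * Cz" by (simp add: mult_ac)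
    qed (intro continuous_intros cs)
    have b3: "\<bar>LINT x|vol. d2f a x * zz a x\<bar> \<le> (C2 * Cz * norm a ^ 3) * (LINT x|vol. 1)"
    proof (rule integral_vol_bound)
      fix x :: 'a assume x: "norm (x - 0) < 1"
      have "\<bar>d2f a x * zz a x\<bar> \<le> (C2 * norm a ^ 2) * (norm a * Cz)"
        unfolding abs_mult using d2b[OF x] zb[OF x] C0 by (intro mult_mono) auto
      then show "\<bar>d2f a x * zz a x\<bar> \<le> C2 * Cz * norm a ^ 3"
        by (simp add: power2_eq_square power3_eq_cube mult_ac)
    qed (intro continuous_intros cs)
    have sv: "1/2 * (LINT x|vol. d2f a x * u0 x) + 1/2 * (LINT x|vol. df a x * zz a x) = gain * norm a ^ 2"
      using second_variation[of a] by (simp add: power2_norm_eq_inner)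
    let ?I = "\<lambda>h k. LINT x|vol. h x * k x :: real"
    have "energy ?fa (\<lambda>x. u0 x + 1 * zz a x) (\<lambda>x. ?Gu x + 1 *\<^sub>R Gz a x) (\<lambda>x. u0 x + 1 * zz a x)
      = - 1/2 * ?I ff u0 - gain * norm a ^ 2 - ?I r u0 - ?I r (zz a) - 1/2 * ?I (d2f a) (zz a)"
      unfolding E split[OF cu] split[OF continuous_ff(4)] odd sv[symmetric] by argo
    also have "\<dots> \<le> - 1/2 * ?I ff u0 - gain * norm a ^ 2 + C * norm a ^ 3"
    proof -
      have "- ?I r u0 - ?I r (zz a) - 1/2 * ?I (d2f a) (zz a)
        \<le> (C3 * norm a ^ 3 * M) * om + (C3 * norm a ^ 3 * Cz) * om + 1/2 * ((C2 * Cz * norm a ^ 3) * om)"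
        using b1 b2 b3 unfolding om_def[symmetric] by argo
      also have "\<dots> = (C - 1) * norm a ^ 3" by (simp add: C_def algebra_simps)
      also have "\<dots> \<le> C * norm a ^ 3" by (intro mult_right_mono) auto
      finally show ?thesis by argo
    qed
    finally have "energy ?fa (\<lambda>x. u0 x + 1 * zz a x) (\<lambda>x. ?Gu x + 1 *\<^sub>R Gz a x) (\<lambda>x. u0 x + 1 * zz a x)
      \<le> - 1/2 * ?I ff u0 + (C * norm a ^ 3 - gain * norm a ^ 2)" by argo
    moreover have "has_grad (\<lambda>x. u0 x + 1 * zz a x) (\<lambda>x. ?Gu x + 1 *\<^sub>R Gz a x)"
      by (intro has_grad_add has_grad_cmult u0_grad zz_grad)
    ultimately show ?thesis
      using translated_energy[OF rb, of "\<lambda>x. u0 x + 1 * zz a x" "\<lambda>x. ?Gu x + 1 *\<^sub>R Gz a x"]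
      unfolding robin_J_centred plus_ereal.simps by (meson ereal_less_eq(3) order_trans)
  qed
  from C main show thesis by (rule that)
qed

end

theorem mainTheorem6:
  assumes "CARD('n::finite) \<ge> 2"
  shows "\<exists>(R::real) (f :: real ^ 'n \<Rightarrow> real) (a::real) (b::real).
    R > 0 \<and> smooth f \<and> radially_decreasing f \<and> (\<forall>x. f x > 0) \<and> 0 \<le> a \<and> a < b \<and>
    (\<forall>\<beta>\<in>{a<..<b}. \<exists>\<delta>>0. \<forall>x0. x0 \<noteq> 0 \<and> norm x0 < \<delta> \<longrightarrow>
       (let \<Omega> = ball x0 R; \<Omega>s = symm_ball \<Omega>; fs = symm_rearr \<Omega> f in
          robin_J \<beta> f \<Omega> < robin_J \<beta> f (ball 0 R) \<and>
          \<Omega>s = ball 0 R \<and>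
          (\<exists>u. robin_solution \<Omega> f \<beta> u) \<and> (\<exists>v. robin_solution \<Omega>s fs \<beta> v) \<and>
          (\<forall>u v. robin_solution \<Omega> f \<beta> u \<and> robin_solution \<Omega>s fs \<beta> v \<longrightarrow>
             \<not> (AE x in lebesgue_on \<Omega>s. symm_rearr \<Omega> u x \<le> v x))))"
proof -
  let ?N = "real DIM(real ^ 'n)"
  define f :: "real ^ 'n \<Rightarrow> real" where "f x = ?N / 100 * bub 1 x" for x
  have dim: "DIM(real ^ 'n) \<ge> 2" using assms by simp
  have f_smooth: "smooth f"
    unfolding smooth_def f_def[abs_def]
    by (intro allI C_k_mult C_k_const smooth_bub[unfolded smooth_def, rule_format])
  have f_dec: "radially_decreasing f"
    unfolding radially_decreasing_def f_def using bub_antimono by (auto intro!: mult_left_mono)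
  have f_pos: "0 < f x" for x unfolding f_def using dim bub_pos[of 1 x] by simp
  have f_cont: "continuous_on UNIV f"
    unfolding f_def[abs_def] by (intro continuous_intros has_gradD(3)[OF has_grad_bub])
  obtain \<kappa> where \<kappa>: "0 < \<kappa>" "\<And>x0 v \<psi> G. has_grad \<psi> G \<Longrightarrow> (LINT x|lebesgue_on (ball (x0 :: real ^ 'n) 1). G x \<bullet> v) =
      \<kappa> * (LINT x|surface_measure (ball x0 1). \<psi> x * ((x - x0) \<bullet> v))"
    using divergence_theorem_ball[OF dim] by blast
  obtain U :: "real ^ 'n \<Rightarrow> real" where U: "has_grad U (\<lambda>x. - bub 0 x *\<^sub>R x)" "\<And>x y. norm x = norm y \<Longrightarrow> U x = U y"
    using exists_bubble_potential by blast
  obtain e :: "real ^ 'n" where e: "norm e = 1" using vector_choose_size[of 1] by auto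
  have main: "\<exists>\<delta>>0. \<forall>x0. x0 \<noteq> 0 \<and> norm x0 < \<delta> \<longrightarrow>
       (robin_J \<beta> f (ball x0 1) < robin_J \<beta> f (ball 0 1) \<and>
          (\<exists>u. robin_solution (ball x0 1) f \<beta> u) \<and> (\<exists>v. robin_solution (ball 0 1) (symm_rearr (ball x0 1) f) \<beta> v) \<and>
          (\<forall>u v. robin_solution (ball x0 1) f \<beta> u \<and> robin_solution (ball 0 1) (symm_rearr (ball x0 1) f) \<beta> v \<longrightarrow>
             \<not> (AE x in lebesgue_on (ball 0 1). symm_rearr (ball x0 1) u x \<le> v x)))"
    if \<beta>: "\<beta> \<in> {\<kappa> / 4<..<\<kappa> / 2}" for \<beta>
  proof -
    have \<beta>0: "0 < \<beta>" "1/4 < \<beta> / \<kappa>" "\<beta> / \<kappa> < 1/2" using \<beta> \<kappa>(1) by (auto simp: field_simps)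
    have rb: "robin_ball x0 \<kappa> \<beta>" for x0 :: "real ^ 'n"
      by (rule robin_ball.intro) (use dim \<kappa> \<beta>0 in auto)
    \<comment> \<open>The gradient fixes the potential up to a constant, and both \<open>U\<close>
      and \<open>bub 0\<close> are constant on the unit sphere; matching at the sample point
      \<open>e\<close> therefore gives the Robin condition on the whole sphere.\<close>
    define u0 where "u0 x = U x + (\<kappa> / \<beta> * bub 0 e - U e)" for x
    interpret bubble_ball \<kappa> \<beta> u0
    proof (intro bubble_ball.intro rb bubble_ball_axioms.intro)
      show "has_grad u0 (\<lambda>x. - bub 0 x *\<^sub>R x)"
        by (rule has_grad_cong[OF has_grad_add[OF U(1) has_grad_const]]) (auto simp: u0_def)
      show "u0 (- x) = u0 x" for x using U(2)[of "- x" x] by (simp add: u0_def)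
      fix x :: "real ^ 'n" assume x: "norm x = 1"
      have "bub 0 x = bub 0 e"
        using bub_antimono[of x e 0] bub_antimono[of e x 0] x e by simp
      then show "\<beta> * u0 x = \<kappa> * bub 0 x"
        using U(2)[of x e] x e \<beta>0 by (simp add: u0_def)
    qed
    have ff: "ff = f" by (simp add: fun_eq_iff ff_def f_def N_def)
    have gain: "0 < gain" by (rule gain_pos) (use \<beta>0 in \<open>simp_all add: bb_def\<close>)
    obtain C where C: "0 < C" "\<And>a. norm a \<le> 1 \<Longrightarrow> robin_ball a \<kappa> \<beta> \<Longrightarrow>
        robin_J \<beta> ff (ball a 1) \<le> robin_J \<beta> ff (ball 0 1) + ereal (C * norm a ^ 3 - gain * norm a ^ 2)"
      using robin_J_translated_le by blast
    show ?thesis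
    \<comment> \<open>Below \<open>gain / C\<close> the quadratic gain beats the cubic error; the
      bound 1 is the range of the Taylor estimate.\<close>
    proof (intro exI[of _ "min 1 (gain / C)"] conjI allI impI)
      fix x0 :: "real ^ 'n" assume x0: "x0 \<noteq> 0 \<and> norm x0 < min 1 (gain / C)"
      then have "C * norm x0 < gain" using C(1) by (simp add: field_simps)
      then have "(C * norm x0 - gain) * norm x0 ^ 2 < 0" using x0 by (intro mult_neg_pos) auto
      then have "C * norm x0 ^ 3 - gain * norm x0 ^ 2 < 0"
        by (simp add: power2_eq_square power3_eq_cube algebra_simps)
      \<comment> \<open>Strictness in \<open>ereal\<close> needs a finite value on the centred ball,
        which \<open>robin_J_centred\<close> supplies.\<close>
      then have "robin_J \<beta> ff (ball 0 1) + ereal (C * norm x0 ^ 3 - gain * norm x0 ^ 2) < robin_J \<beta> ff (ball 0 1)"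
        unfolding robin_J_centred by simp
      with C(2)[OF _ rb, of x0] x0 show less: "robin_J \<beta> f (ball x0 1) < robin_J \<beta> f (ball 0 1)"
        unfolding ff by (auto intro: le_less_trans)
      show "\<exists>u. robin_solution (ball x0 1) f \<beta> u"
        by (rule robin_ball.exists_robin_solution[OF rb]) (rule robin_ball.L2_vol[OF rb f_cont])
      show "\<exists>v. robin_solution (ball 0 1) (symm_rearr (ball x0 1) f) \<beta> v"
        by (rule exists_robin_solution) (rule L2_symm_rearr[OF rb f_cont f_dec f_pos])
      fix u v assume uv: "robin_solution (ball x0 1) f \<beta> u \<and> robin_solution (ball 0 1) (symm_rearr (ball x0 1) f) \<beta> v"
      show "\<not> (AE x in lebesgue_on (ball 0 1). symm_rearr (ball x0 1) u x \<le> v x)"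
      proof
        assume "AE x in lebesgue_on (ball 0 1). symm_rearr (ball x0 1) u x \<le> v x"
        from comparison_imp_robin_J_le[OF rb rb f_cont f_dec f_pos _ _ this] uv less show False by auto
      qed
    qed (use gain C in simp)
  qed
  show ?thesis
  \<comment> \<open>The unit radius, and the interval corresponding to \<open>1/4 < bb < 1/2\<close>
    after multiplication by \<kappa>.\<close>
  proof (rule exI[of _ 1], rule exI[of _ f], rule exI[of _ "\<kappa> / 4"], rule exI[of _ "\<kappa> / 2"],
      unfold Let_def symm_ball_unit_ball, intro conjI ballI)
    fix \<beta> assume "\<beta> \<in> {\<kappa> / 4<..<\<kappa> / 2}"
    from main[OF this] show "\<exists>\<delta>>0. \<forall>x0. x0 \<noteq> 0 \<and> norm x0 < \<delta> \<longrightarrow>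
       robin_J \<beta> f (ball x0 1) < robin_J \<beta> f (ball 0 1) \<and> ball 0 1 = (ball 0 1 :: (real ^ 'n) set) \<and>
          (\<exists>u. robin_solution (ball x0 1) f \<beta> u) \<and> (\<exists>v. robin_solution (ball 0 1) (symm_rearr (ball x0 1) f) \<beta> v) \<and>
          (\<forall>u v. robin_solution (ball x0 1) f \<beta> u \<and> robin_solution (ball 0 1) (symm_rearr (ball x0 1) f) \<beta> v \<longrightarrow>
             \<not> (AE x in lebesgue_on (ball 0 1). symm_rearr (ball x0 1) u x \<le> v x))"
      by (simp only: simp_thms)
  qed (use f_smooth f_dec f_pos \<kappa>(1) in auto)
qed

end
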